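(* Let $m\in\mathbb{N}$ and $0\le\beta<\alpha<1$. Assume that the distribution $V\in H^{-m\alpha}_{per}[-1,1]$ is of period $1$ and real valued, i.e. $\hat V(2k+1)=0$ and $\hat V(-k)=\overline{\hat V(k)}$ for all $k\in\mathbb{Z}$. Let $(\lambda_k)_{k\ge0}$ be the ordered periodic eigenvalues of $L_m=(-1)^m d^{2m}/dx^{2m}+V$ and $\gamma_{mn}:=\lambda_{2n}-\lambda_{2n-1}$ for $n\ge1$. Then $V\in H^{-m\beta}_{per}[-1,1]$ if and only if $(\gamma_{mn})_{n\ge1}\in h^{-m\beta}$.
   Context: Write $\langle k\rangle:=1+|k|$. For $s\in\mathbb{R}$, $H^s_{per}=H^s_{per}[-1,1]$ is the space of (2-periodic) distributions $f=\sum_{k\in\mathbb{Z}}\hat f(k)e^{ik\pi x}$ with $\|f\|_{H^s_{per}}:=\left(\sum_{k\in\mathbb{Z}}\langle k\rangle^{2s}|\hat f(k)|^2\right)^{1/2}<\infty$; the Fourier coefficients $\hat f(k)=\langle f,e^{ik\pi x}\rangle$ are taken with respect to the sesquilinear pairing between $H^s_{per}$ and $H^{-s}_{per}$ extending $\frac12\int_{-1}^1 g\overline h\,dx$. For $s\in\mathbb{R}$, $h^s=h^s(\mathbb{N};\mathbb{C})$ is the space of complex sequences $x=(x_n)_{n\ge1}$ with $\|x\|_s:=\left(\sum_{n\ge1}\langle n\rangle^{2s}|x_n|^2\right)^{1/2}<\infty$. The operator $L_m=(-1)^m d^{2m}/dx^{2m}+V$ acts as an unbounded operator on $H^{-m\alpha}_{per}$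 with domain $H^{m(2-\alpha)}_{per}$, where the product $Vf$ is defined by convolution of Fourier coefficients, $\widehat{Vf}(k)=\sum_j\hat V(k-j)\hat f(j)$. Its spectrum is discrete and consists of a sequence of eigenvalues $(\lambda_k)_{k\ge0}$ with $\mathrm{Re}\,\lambda_k\to+\infty$, repeated according to algebraic multiplicity and ordered so that for each $k$ either $\mathrm{Re}\,\lambda_k<\mathrm{Re}\,\lambda_{k+1}$, or $\mathrm{Re}\,\lambda_k=\mathrm{Re}\,\lambda_{k+1}$ and $\mathrm{Im}\,\lambda_k\le\mathrm{Im}\,\lambda_{k+1}$. *)

theory Defs
  imports "HOL-Analysis.Analysis" "HOL-Library.Function_Algebras"
begin

section \<open>Periodic distributions\<close>

definition fderiv :: "(real \<Rightarrow> complex) \<Rightarrow> real \<Rightarrow> complex" where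
  "fderiv \<phi> = (\<lambda>x. vector_derivative \<phi> (at x))"

definition test_functions :: "(real \<Rightarrow> complex) set" where
  "test_functions =
     {\<phi>. (\<forall>x. \<phi> (x + 2) = \<phi> x) \<and> (\<forall>j x. (fderiv ^^ j) \<phi> differentiable (at x))}"

type_synonym functional = "(real \<Rightarrow> complex) \<Rightarrow> complex"

text \<open>A 2-periodic distribution is a linear functional on the smooth 2-periodic functions that
  is continuous for the seminorms \<open>sup \<bar>\<phi>\<^sup>(\<^sup>j\<^sup>)\<bar>\<close>. Off the test functions it is given the value 0,
  so that equality of distributions is equality of HOL functions. A function \<open>g\<close> is identified
  with \<open>\<phi> \<mapsto> 1/2 \<integral> g \<phi>\<close> over \<open>[-1,1]\<close>; the sesquilinear pairing of the distribution \<open>f\<close> with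
  \<open>h\<close> is therefore \<open>f\<close> applied to the complex conjugate of \<open>h\<close>.\<close>

definition periodic_distributions :: "functional set" where
  "periodic_distributions =
     {f. (\<forall>\<phi>\<in>test_functions. \<forall>\<psi>\<in>test_functions. f (\<lambda>x. \<phi> x + \<psi> x) = f \<phi> + f \<psi>)
       \<and> (\<forall>c. \<forall>\<phi>\<in>test_functions. f (\<lambda>x. c * \<phi> x) = c * f \<phi>)
       \<and> (\<exists>N C. \<forall>\<phi>\<in>test_functions.
             norm (f \<phi>) \<le> C * (\<Sum>j\<le>N. SUP x. norm ((fderiv ^^ j) \<phi> x)))
       \<and> (\<forall>\<phi>. \<phi> \<notin> test_functions \<longrightarrow> f \<phi> = 0)}"

definition pairing :: "functional \<Rightarrow> (real \<Rightarrow> complex) \<Rightarrow> complex" where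
  "pairing f h = f (\<lambda>x. cnj (h x))"

definition fexp :: "int \<Rightarrow> real \<Rightarrow> complex" where
  "fexp k x = exp (\<i> * of_int k * of_real pi * of_real x)"

definition fcoeff :: "functional \<Rightarrow> int \<Rightarrow> complex" where
  "fcoeff f k = pairing f (fexp k)"

text \<open>The distribution \<open>\<Sum>k. c k e\<^sup>i\<^sup>k\<^sup>\<pi>\<^sup>x\<close>, the series converging weakly.\<close>

definition fourier_series :: "(int \<Rightarrow> complex) \<Rightarrow> functional" where
  "fourier_series c = (\<lambda>\<phi>. if \<phi> \<in> test_functions
     then \<Sum>\<^sub>\<infinity>k\<in>UNIV. c k * (1/2 * integral {-1..1} (\<lambda>x. fexp k x * \<phi> x)) else 0)"

definition dist_deriv :: "functional \<Rightarrow> functional" where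
  "dist_deriv f = (\<lambda>\<phi>. if \<phi> \<in> test_functions then - f (fderiv \<phi>) else 0)"

definition dist_mult :: "functional \<Rightarrow> functional \<Rightarrow> functional" where
  "dist_mult V f = fourier_series (\<lambda>k. \<Sum>\<^sub>\<infinity>j\<in>UNIV. fcoeff V (k - j) * fcoeff f j)"

definition dist_scale :: "complex \<Rightarrow> functional \<Rightarrow> functional" where
  "dist_scale c f = (\<lambda>\<phi>. c * f \<phi>)"

interpretation dist: vector_space dist_scale
  by unfold_locales (auto simp: dist_scale_def fun_eq_iff algebra_simps)


section \<open>Sobolev and sequence spaces\<close>

definition Hper :: "real \<Rightarrow> functional set" where
  "Hper s = {f \<in> periodic_distributions. f = fourier_series (fcoeff f) \<and>
     (\<lambda>k. (1 + \<bar>real_of_int k\<bar>) powr (2 * s) * (norm (fcoeff f k))\<^sup>2) summable_on UNIV}"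

text \<open>Sequences indexed by \<open>n \<ge> 1\<close>: the value at 0 plays no role.\<close>

definition hseq :: "real \<Rightarrow> (nat \<Rightarrow> complex) set" where
  "hseq s = {x. (\<lambda>n. (1 + real n) powr (2 * s) * (norm (x n))\<^sup>2) summable_on {1..}}"


section \<open>The operator and its eigenvalues\<close>

definition Lop :: "nat \<Rightarrow> functional \<Rightarrow> functional \<Rightarrow> functional" where
  "Lop m V f = dist_scale ((-1) ^ m) ((dist_deriv ^^ (2 * m)) f) + dist_mult V f"

definition Ldom :: "nat \<Rightarrow> real \<Rightarrow> functional set" where
  "Ldom m \<alpha> = Hper (real m * (2 - \<alpha>))"

text \<open>The kernel of \<open>(L - \<mu>)\<^sup>n\<close> on the natural domain of the power of the unbounded operator.\<close>

primrec power_kernel ::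
    "nat \<Rightarrow> real \<Rightarrow> functional \<Rightarrow> complex \<Rightarrow> nat \<Rightarrow> functional set" where
  "power_kernel m \<alpha> V \<mu> 0 = {0}"
| "power_kernel m \<alpha> V \<mu> (Suc n) =
     {f \<in> Ldom m \<alpha>. Lop m V f - dist_scale \<mu> f \<in> power_kernel m \<alpha> V \<mu> n}"

definition root_space :: "nat \<Rightarrow> real \<Rightarrow> functional \<Rightarrow> complex \<Rightarrow> functional set" where
  "root_space m \<alpha> V \<mu> = (\<Union>n. power_kernel m \<alpha> V \<mu> n)"

text \<open>The root space has finite dimension \<open>d\<close>. This is not stated through the library's \<open>dim\<close>,
  which is 0 on infinite-dimensional spaces. Multiplicity 0 means that \<open>\<mu>\<close> is not an
  eigenvalue.\<close>

definition has_algebraic_multiplicity ::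
    "nat \<Rightarrow> real \<Rightarrow> functional \<Rightarrow> complex \<Rightarrow> nat \<Rightarrow> bool" where
  "has_algebraic_multiplicity m \<alpha> V \<mu> d \<longleftrightarrow>
     (\<exists>B. finite B \<and> dist.independent B \<and> dist.span B = root_space m \<alpha> V \<mu> \<and> card B = d)"

definition ordered_periodic_eigenvalues ::
    "nat \<Rightarrow> real \<Rightarrow> functional \<Rightarrow> (nat \<Rightarrow> complex) \<Rightarrow> bool" where
  "ordered_periodic_eigenvalues m \<alpha> V ev \<longleftrightarrow>
     (\<forall>\<mu>. has_algebraic_multiplicity m \<alpha> V \<mu> (card {k. ev k = \<mu>})) \<and>
     filterlim (\<lambda>k. Re (ev k)) at_top sequentially \<and>
     (\<forall>k. Re (ev k) < Re (ev (Suc k)) \<or>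
          Re (ev k) = Re (ev (Suc k)) \<and> Im (ev k) \<le> Im (ev (Suc k)))"

end

theory Submission
  imports Defs
begin

text \<open>On the Fourier side \<open>L\<^sub>m\<close> is the diagonal matrix with entries \<open>mu k = (\<pi> k)\<^sup>2\<^sup>m\<close> plus the
  convolution with \<open>fcoeff V\<close>, a relatively Hilbert--Schmidt and symmetric perturbation, so the given
  eigenvalues obey the min-max principle. The modes \<open>\<plusminus>n\<close> carry the block with diagonal entries
  \<open>mu n + fcoeff V 0\<close> and off-diagonal entries \<open>fcoeff V (\<plusminus>2n)\<close>. Explicit trial subspaces, spanned by
  \<open>\<bar>k\<bar> < n\<close> and one or both eigenvectors of this block, give
  \<open>\<bar>\<gamma>\<^sub>n - 2 \<bar>fcoeff V (2n)\<bar>\<bar> \<le> 8 R n\<close> for large \<open>n\<close>, where \<open>R n\<close> is the sum over \<open>j \<noteq> \<plusminus>n\<close> of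
  \<open>\<bar>fcoeff V (n - j)\<bar>\<^sup>2 / \<bar>mu j - mu n\<bar>\<close>; the resolvent never enters. If \<open>fcoeff V\<close> lies in the
  weighted space with exponent \<open>-(m - e/2)\<close>, \<open>0 < e \<le> 1\<close>, then \<open>R\<close> lies in that with exponent
  \<open>-(1 - e)\<close>. This settles one direction directly; for the other, each application at least doubles
  \<open>e\<close> (up to 1) until the exponent \<open>-m \<beta>\<close> is reached.\<close>

text \<open>The spectrum is known only through dimensions of root spaces of distributions, and
  min-max has to be drawn from that. Symmetry makes root spaces eigenspaces; elliptic regularity
  lets every eigenvector in the form domain count towards a multiplicity. Upper bounds need no
  eigenfunction expansion: minimizing \<open>Q\<close> orthogonally to finitely many eigenvectors
  produces another eigenvector, so too small a Rayleigh quotient there contradicts the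
  multiplicities.

  The indices match because the \<open>2 n - 1\<close> modes with \<bar>k\<bar> < n account for the
  indices 0 to \<open>2 n - 2\<close>, leaving \<open>2 n - 1\<close> and \<open>2 n\<close> to
  \<plusminus>n. Each of the two eigenvalues is located within \<open>4 R n\<close>, hence the 8.

  The doubling: if \<open>m \<beta> < 1 - e\<close>, the error \<open>R\<close> limits what the gaps
  reveal, and \<open>fcoeff V\<close> is only seen to have exponent \<open>-(1 - e)\<close>; but
  \<open>1 - e \<le> m - (2 e) / 2\<close> because \<open>m \<ge> 1\<close>. Once
  \<open>1 - e \<le> m \<beta>\<close>, the error is harmless.\<close>

no_notation Infinite_Set_Sum.abs_summable_on (infix "abs'_summable'_on" 50)

section \<open>Infinite sums and homogeneous linear systems\<close>

lemma infsum_Cauchy_Schwarz: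
  fixes a b :: "'a \<Rightarrow> real"
  assumes a: "(\<lambda>x. (a x)\<^sup>2) summable_on A" and b: "(\<lambda>x. (b x)\<^sup>2) summable_on A"
  shows "(\<lambda>x. a x * b x) summable_on A"
    and "(\<lambda>x. \<bar>a x * b x\<bar>) summable_on A"
    and "(\<Sum>\<^sub>\<infinity>x\<in>A. \<bar>a x * b x\<bar>)\<^sup>2 \<le> (\<Sum>\<^sub>\<infinity>x\<in>A. (a x)\<^sup>2) * (\<Sum>\<^sub>\<infinity>x\<in>A. (b x)\<^sup>2)"
proof -
  have s: "(\<lambda>x. (a x)\<^sup>2 + (b x)\<^sup>2) summable_on A"
    by (intro summable_on_add a b)
  have le: "\<bar>a x * b x\<bar> \<le> (a x)\<^sup>2 + (b x)\<^sup>2" for x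
  proof -
    have "2 * (\<bar>a x\<bar> * \<bar>b x\<bar>) \<le> (a x)\<^sup>2 + (b x)\<^sup>2"
      using sum_squares_bound[of "\<bar>a x\<bar>" "\<bar>b x\<bar>"] by (simp add: mult.assoc)
    moreover have "0 \<le> \<bar>a x\<bar> * \<bar>b x\<bar>"
      by simp
    ultimately show ?thesis
      unfolding abs_mult by linarith
  qed
  show abs: "(\<lambda>x. \<bar>a x * b x\<bar>) summable_on A"
    by (rule summable_on_comparison_test[OF s]) (use le in auto)
  then show "(\<lambda>x. a x * b x) summable_on A"
    using summable_on_iff_abs_summable_on_real[of "\<lambda>x. a x * b x" A] by simp
  have "(\<Sum>\<^sub>\<infinity>x\<in>A. \<bar>a x * b x\<bar>) \<le> sqrt ((\<Sum>\<^sub>\<infinity>x\<in>A. (a x)\<^sup>2) * (\<Sum>\<^sub>\<infinity>x\<in>A. (b x)\<^sup>2))"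
  proof (rule infsum_le_finite_sums[OF abs])
    fix F assume F: "finite F" "F \<subseteq> A"
    have "(\<Sum>x\<in>F. \<bar>a x * b x\<bar>)\<^sup>2 = (\<Sum>x\<in>F. \<bar>a x\<bar> * \<bar>b x\<bar>)\<^sup>2"
      by (simp add: abs_mult)
    also have "\<dots> \<le> (\<Sum>x\<in>F. \<bar>a x\<bar>\<^sup>2) * (\<Sum>x\<in>F. \<bar>b x\<bar>\<^sup>2)"
      by (rule Cauchy_Schwarz_ineq_sum)
    also have "\<dots> \<le> (\<Sum>\<^sub>\<infinity>x\<in>A. (a x)\<^sup>2) * (\<Sum>\<^sub>\<infinity>x\<in>A. (b x)\<^sup>2)"
      using F a b by (intro mult_mono) (auto intro!: finite_sum_le_infsum sum_nonneg infsum_nonneg)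
    finally show "(\<Sum>x\<in>F. \<bar>a x * b x\<bar>) \<le> sqrt ((\<Sum>\<^sub>\<infinity>x\<in>A. (a x)\<^sup>2) * (\<Sum>\<^sub>\<infinity>x\<in>A. (b x)\<^sup>2))"
      by (rule real_le_rsqrt)
  qed
  then have "(\<Sum>\<^sub>\<infinity>x\<in>A. \<bar>a x * b x\<bar>)\<^sup>2 \<le> (sqrt ((\<Sum>\<^sub>\<infinity>x\<in>A. (a x)\<^sup>2) * (\<Sum>\<^sub>\<infinity>x\<in>A. (b x)\<^sup>2)))\<^sup>2"
    by (intro power_mono) (auto intro!: infsum_nonneg)
  then show "(\<Sum>\<^sub>\<infinity>x\<in>A. \<bar>a x * b x\<bar>)\<^sup>2 \<le> (\<Sum>\<^sub>\<infinity>x\<in>A. (a x)\<^sup>2) * (\<Sum>\<^sub>\<infinity>x\<in>A. (b x)\<^sup>2)"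
    by (simp add: infsum_nonneg)
qed

lemma has_sum_product_nonneg:
  fixes f :: "'a \<Rightarrow> real" and g :: "'b \<Rightarrow> real"
  assumes f: "f summable_on A" and g: "g summable_on B"
    and nn: "\<And>x. x \<in> A \<Longrightarrow> 0 \<le> f x" "\<And>y. y \<in> B \<Longrightarrow> 0 \<le> g y"
  shows "((\<lambda>(x, y). f x * g y) has_sum infsum f A * infsum g B) (A \<times> B)"
proof (rule has_sum_SigmaI)
  show "((\<lambda>y. case (x, y) of (x, y) \<Rightarrow> f x * g y) has_sum f x * infsum g B) B" if "x \<in> A" for x
    using g by (auto intro!: has_sum_cmult_right)
  show "((\<lambda>x. f x * infsum g B) has_sum infsum f A * infsum g B) A"
    using f by (auto intro!: has_sum_cmult_left)
  show "(\<lambda>(x, y). f x * g y) summable_on A \<times> B"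
  proof (rule summable_on_SigmaI)
    show "((\<lambda>y. case (x, y) of (x, y) \<Rightarrow> f x * g y) has_sum f x * infsum g B) B" if "x \<in> A" for x
      using g by (auto intro!: has_sum_cmult_right)
    show "(\<lambda>x. f x * infsum g B) summable_on A"
      using f by (rule summable_on_cmult_left)
  qed (use nn in auto)
qed

text \<open>Fubini for a product of two sums, carried over by the shears
  \<open>(i, j) \<mapsto> (i - j, j)\<close> and \<open>(i, j) \<mapsto> (i - j, i)\<close>. Kernels
  built from \<open>V (i - j)\<close> and a weight in one index are bounded this way.\<close>

lemma has_sum_convolution_nonneg:
  fixes v t :: "int \<Rightarrow> real"
  assumes v: "v summable_on UNIV" and t: "t summable_on UNIV"
    and nn: "\<And>k. 0 \<le> v k" "\<And>k. 0 \<le> t k"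
  shows "((\<lambda>(i, j). v (i - j) * t j) has_sum infsum v UNIV * infsum t UNIV) UNIV"
    and "((\<lambda>(i, j). v (i - j) * t i) has_sum infsum v UNIV * infsum t UNIV) UNIV"
proof -
  have p: "((\<lambda>(x, y). v x * t y) has_sum infsum v UNIV * infsum t UNIV) (UNIV \<times> UNIV)"
    by (rule has_sum_product_nonneg) (use assms in auto)
  have b1: "bij (\<lambda>(i, j). (i - j, j) :: int \<times> int)"
    by (rule bij_betw_byWitness[where f' = "\<lambda>(i, j). (i + j, j)"]) auto
  have b2: "bij (\<lambda>(i, j). (i - j, i) :: int \<times> int)"
    by (rule bij_betw_byWitness[where f' = "\<lambda>(i, j). (j, j - i)"]) auto
  show "((\<lambda>(i, j). v (i - j) * t j) has_sum infsum v UNIV * infsum t UNIV) UNIV"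
    using has_sum_reindex_bij_betw[OF b1, of "\<lambda>(x, y). v x * t y"] p
    by (simp add: case_prod_unfold)
  show "((\<lambda>(i, j). v (i - j) * t i) has_sum infsum v UNIV * infsum t UNIV) UNIV"
    using has_sum_reindex_bij_betw[OF b2, of "\<lambda>(x, y). v x * t y"] p
    by (simp add: case_prod_unfold)
qed

lemma summable_on_int_if_nat:
  fixes f :: "int \<Rightarrow> real"
  assumes "\<And>k. 0 \<le> f k" "summable (\<lambda>n. f (int n))" "summable (\<lambda>n. f (- int n))"
  shows "f summable_on UNIV"
proof -
  have n: "(\<lambda>n. f (int n)) summable_on UNIV" "(\<lambda>n. f (- int n)) summable_on UNIV"
    using assms by (auto simp: summable_on_UNIV_nonneg_real_iff)
  have 1: "f summable_on range int"
    using n(1) by (subst summable_on_reindex) (auto simp: o_def)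
  have 2: "f summable_on range (\<lambda>n. - int n)"
    using n(2) by (subst summable_on_reindex) (auto simp: o_def inj_on_def)
  have "UNIV = range int \<union> range (\<lambda>n. - int n)"
    by (auto simp: image_iff) (metis int_cases2)
  then show ?thesis
    using summable_on_union[OF 1 2] by simp
qed

lemma summable_on_inverse_square_int:
  "(\<lambda>k. 1 / (real_of_int k)\<^sup>2) summable_on UNIV"
  by (rule summable_on_int_if_nat)
    (use inverse_power_summable[of 2, where 'a = real] in \<open>auto simp: divide_inverse power_inverse\<close>)

section \<open>Polynomial weights on the integers\<close>

definition wt :: "int \<Rightarrow> real" where
  "wt k = 1 + \<bar>real_of_int k\<bar>"

lemma wt_ge_1 [simp]: "1 \<le> wt k" and wt_pos [simp]: "0 < wt k" and wt_nonneg [simp]: "0 \<le> wt k"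
  and wt_nz [simp]: "wt k \<noteq> 0"
  by (auto simp: wt_def)

lemma wt_minus [simp]: "wt (- k) = wt k"
  by (simp add: wt_def)

lemma wt_diff_le: "wt (i - j) \<le> wt i + wt j"
  by (simp add: wt_def)

lemma wt_diff_le_max: "wt (i - j) \<le> 2 * max (wt i) (wt j)"
  using wt_diff_le[of i j] by (auto simp: max_def)

lemma one_le_wt_power: "1 \<le> wt k ^ n"
  by (intro one_le_power) simp

lemma summable_on_wt:
  assumes "m \<ge> 1"
  shows "(\<lambda>k. 1 / wt k ^ (2 * m)) summable_on UNIV"
proof -
  \<comment> \<open>By the convention \<open>x / 0 = 0\<close> the inverse square contributes 0 at
    \<open>k = 0\<close>, so the value 1 needed there is added by hand.\<close>
  have "(\<lambda>k. 1 / (real_of_int k)\<^sup>2 + (if k = 0 then 1 else 0)) summable_on UNIV"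
    by (intro summable_on_add summable_on_inverse_square_int finite_nonzero_values_imp_summable_on) auto
  then show ?thesis
  proof (rule summable_on_comparison_test)
    fix k :: int
    have "wt k ^ 2 \<le> wt k ^ (2 * m)"
      using assms by (intro power_increasing) auto
    moreover have "(real_of_int k)\<^sup>2 \<le> wt k ^ 2"
      by (rule abs_le_square_iff[THEN iffD1]) (auto simp: wt_def)
    ultimately have *: "(real_of_int k)\<^sup>2 \<le> wt k ^ (2 * m)"
      by linarith
    show "1 / wt k ^ (2 * m) \<le> 1 / (real_of_int k)\<^sup>2 + (if k = 0 then 1 else 0)"
    proof (cases "k = 0")
      case False
      then show ?thesis
        using * by (simp add: frac_le)
    qed (simp add: wt_def)
  qed auto
qed

text \<open>Gaussian elimination with pivot \<open>a i0 j0\<close>; the coefficient of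
  \<open>i0\<close> is recovered from equation \<open>j0\<close>. This is the dimension count behind
  both halves of min-max and behind the orthonormal bases.\<close>

lemma homogeneous_system_nontrivial:
  fixes a :: "'a \<Rightarrow> 'b \<Rightarrow> 'c :: field"
  assumes "finite I" "finite J" "card J < card I"
  shows "\<exists>c. (\<exists>i\<in>I. c i \<noteq> 0) \<and> (\<forall>j\<in>J. (\<Sum>i\<in>I. c i * a i j) = 0)"
  using assms(2,1,3)
proof (induction J arbitrary: I a rule: finite_induct)
  case empty
  then obtain i where "i \<in> I"
    by fastforce
  then show ?case
    by (intro exI[of _ "\<lambda>_. 1"]) auto
next
  case (insert j0 J)
  show ?case
  proof (cases "\<forall>i\<in>I. a i j0 = 0")
    case True
    obtain c where "\<exists>i\<in>I. c i \<noteq> 0" "\<forall>j\<in>J. (\<Sum>i\<in>I. c i * a i j) = 0"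
      using insert.IH[of I a] insert.prems insert.hyps by auto
    then show ?thesis
      using True by (intro exI[of _ c]) auto
  next
    case False
    then obtain i0 where i0: "i0 \<in> I" "a i0 j0 \<noteq> 0"
      by auto
    define b where "b i j = a i j - a i j0 / a i0 j0 * a i0 j" for i j
    have "card J < card (I - {i0})"
      using insert.prems insert.hyps i0 by simp
    then obtain c where c: "\<exists>i\<in>I - {i0}. c i \<noteq> 0"
        "\<forall>j\<in>J. (\<Sum>i\<in>I - {i0}. c i * b i j) = 0"
      using insert.IH[of "I - {i0}" b] insert.prems by auto
    define d where "d = c(i0 := - (\<Sum>i\<in>I - {i0}. c i * a i j0) / a i0 j0)"
    have split: "(\<Sum>i\<in>I. d i * a i j) = d i0 * a i0 j + (\<Sum>i\<in>I - {i0}. c i * a i j)" for j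
    proof -
      have "(\<Sum>i\<in>I. d i * a i j) = d i0 * a i0 j + (\<Sum>i\<in>I - {i0}. d i * a i j)"
        using i0 insert.prems by (intro sum.remove) auto
      also have "(\<Sum>i\<in>I - {i0}. d i * a i j) = (\<Sum>i\<in>I - {i0}. c i * a i j)"
        by (rule sum.cong) (auto simp: d_def)
      finally show ?thesis .
    qed
    have "(\<Sum>i\<in>I. d i * a i j) = (\<Sum>i\<in>I - {i0}. c i * b i j)" for j
      unfolding split using i0
      by (simp add: d_def b_def algebra_simps sum_subtractf sum_distrib_left sum_distrib_right
          sum_divide_distrib)
    moreover have "b i j0 = 0" for i
      using i0 by (simp add: b_def)
    ultimately have "\<forall>j\<in>insert j0 J. (\<Sum>i\<in>I. d i * a i j) = 0"
      using c(2) by simp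
    moreover have "\<exists>i\<in>I. d i \<noteq> 0"
      using c(1) by (auto simp: d_def)
    ultimately show ?thesis
      by blast
  qed
qed

section \<open>Hilbert--Schmidt kernels\<close>

text \<open>Cauchy-Schwarz on \<open>S \<times> S\<close> with the weights divided evenly: the
  kernel carries \<open>1 / sqrt (P k P j)\<close>, each vector carries \<open>sqrt P\<close>. It is
  applied with \<open>P = wt ^ (2 m)\<close> for coercivity and with \<open>P = gap n\<close> near
  \<open>mu n\<close>.\<close>

lemma hilbert_schmidt_form:
  fixes A :: "'a \<Rightarrow> 'a \<Rightarrow> complex" and P :: "'a \<Rightarrow> real" and f g :: "'a \<Rightarrow> complex"
  assumes K: "(\<lambda>(k, j). (cmod (A k j))\<^sup>2 / (P k * P j)) summable_on S \<times> S"
    and P: "\<And>k. k \<in> S \<Longrightarrow> P k > 0"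
    and f: "(\<lambda>k. P k * (cmod (f k))\<^sup>2) summable_on S"
    and g: "(\<lambda>k. P k * (cmod (g k))\<^sup>2) summable_on S"
  shows "(\<lambda>(k, j). A k j * f j * cnj (g k)) abs_summable_on S \<times> S"
    and "(\<Sum>\<^sub>\<infinity>(k, j)\<in>S \<times> S. cmod (A k j * f j * cnj (g k)))\<^sup>2 \<le>
      (\<Sum>\<^sub>\<infinity>(k, j)\<in>S \<times> S. (cmod (A k j))\<^sup>2 / (P k * P j)) *
      ((\<Sum>\<^sub>\<infinity>k\<in>S. P k * (cmod (f k))\<^sup>2) * (\<Sum>\<^sub>\<infinity>k\<in>S. P k * (cmod (g k))\<^sup>2))"
proof -
  define a where "a = (\<lambda>(k, j). cmod (A k j) / (sqrt (P k) * sqrt (P j)))"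
  define b where "b = (\<lambda>(k, j). (sqrt (P k) * cmod (g k)) * (sqrt (P j) * cmod (f j)))"
  have a2: "(a x)\<^sup>2 = (case x of (k, j) \<Rightarrow> (cmod (A k j))\<^sup>2 / (P k * P j))" if "x \<in> S \<times> S" for x
    using that P by (auto simp: a_def power_divide power_mult_distrib less_imp_le)
  have b2: "(b x)\<^sup>2 = (case x of (k, j) \<Rightarrow> (P k * (cmod (g k))\<^sup>2) * (P j * (cmod (f j))\<^sup>2))"
    if "x \<in> S \<times> S" for x
    using that P by (auto simp: b_def power_mult_distrib less_imp_le)
  have ab: "\<bar>a x * b x\<bar> = (case x of (k, j) \<Rightarrow> cmod (A k j * f j * cnj (g k)))"
    if "x \<in> S \<times> S" for x
    using that P
    by (auto simp: a_def b_def norm_mult abs_mult less_imp_le less_imp_neq[THEN not_sym])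
  have sb: "((\<lambda>(k, j). (P k * (cmod (g k))\<^sup>2) * (P j * (cmod (f j))\<^sup>2)) has_sum
      (\<Sum>\<^sub>\<infinity>k\<in>S. P k * (cmod (g k))\<^sup>2) * (\<Sum>\<^sub>\<infinity>k\<in>S. P k * (cmod (f k))\<^sup>2)) (S \<times> S)"
    using P by (intro has_sum_product_nonneg f g) (auto simp: less_imp_le)
  have A: "(\<lambda>x. (a x)\<^sup>2) summable_on S \<times> S"
    using K a2 by (subst summable_on_cong) auto
  have B: "(\<lambda>x. (b x)\<^sup>2) summable_on S \<times> S"
    using sb b2 by (subst summable_on_cong) (auto simp: summable_on_def)
  have eq: "(\<lambda>x. cmod (case x of (k, j) \<Rightarrow> A k j * f j * cnj (g k))) =
      (\<lambda>(k, j). cmod (A k j * f j * cnj (g k)))"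
    by auto
  show "(\<lambda>(k, j). A k j * f j * cnj (g k)) abs_summable_on S \<times> S"
    unfolding eq by (rule iffD1[OF summable_on_cong[OF ab] infsum_Cauchy_Schwarz(2)[OF A B]])
  have "(\<Sum>\<^sub>\<infinity>(k, j)\<in>S \<times> S. cmod (A k j * f j * cnj (g k))) = (\<Sum>\<^sub>\<infinity>x\<in>S \<times> S. \<bar>a x * b x\<bar>)"
    by (rule infsum_cong) (use ab in auto)
  moreover have "(\<Sum>\<^sub>\<infinity>(k, j)\<in>S \<times> S. (cmod (A k j))\<^sup>2 / (P k * P j)) = (\<Sum>\<^sub>\<infinity>x\<in>S \<times> S. (a x)\<^sup>2)"
    by (rule infsum_cong) (use a2 in auto)
  moreover have "(\<Sum>\<^sub>\<infinity>x\<in>S \<times> S. (b x)\<^sup>2) =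
      (\<Sum>\<^sub>\<infinity>k\<in>S. P k * (cmod (f k))\<^sup>2) * (\<Sum>\<^sub>\<infinity>k\<in>S. P k * (cmod (g k))\<^sup>2)"
    using infsum_cong[of "S \<times> S", OF b2] infsumI[OF sb] by (simp add: mult.commute)
  ultimately show "(\<Sum>\<^sub>\<infinity>(k, j)\<in>S \<times> S. cmod (A k j * f j * cnj (g k)))\<^sup>2 \<le>
      (\<Sum>\<^sub>\<infinity>(k, j)\<in>S \<times> S. (cmod (A k j))\<^sup>2 / (P k * P j)) *
      ((\<Sum>\<^sub>\<infinity>k\<in>S. P k * (cmod (f k))\<^sup>2) * (\<Sum>\<^sub>\<infinity>k\<in>S. P k * (cmod (g k))\<^sup>2))"
    using infsum_Cauchy_Schwarz(3)[OF A B] by simp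
qed

lemma weighted_product_abs_summable:
  fixes a f :: "'a \<Rightarrow> complex"
  assumes R: "\<And>j. R j > 0"
    and a: "(\<lambda>j. (cmod (a j))\<^sup>2 / R j) summable_on S"
    and f: "(\<lambda>j. R j * (cmod (f j))\<^sup>2) summable_on S"
  shows "(\<lambda>j. a j * f j) abs_summable_on S"
    and "(\<Sum>\<^sub>\<infinity>j\<in>S. cmod (a j * f j))\<^sup>2 \<le>
      (\<Sum>\<^sub>\<infinity>j\<in>S. (cmod (a j))\<^sup>2 / R j) * (\<Sum>\<^sub>\<infinity>j\<in>S. R j * (cmod (f j))\<^sup>2)"
    and "(cmod (\<Sum>\<^sub>\<infinity>j\<in>S. a j * f j))\<^sup>2 \<le>
      (\<Sum>\<^sub>\<infinity>j\<in>S. (cmod (a j))\<^sup>2 / R j) * (\<Sum>\<^sub>\<infinity>j\<in>S. R j * (cmod (f j))\<^sup>2)"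
proof -
  have e: "(cmod (a j) / sqrt (R j))\<^sup>2 = (cmod (a j))\<^sup>2 / R j"
    "(sqrt (R j) * cmod (f j))\<^sup>2 = R j * (cmod (f j))\<^sup>2"
    "\<bar>cmod (a j) / sqrt (R j) * (sqrt (R j) * cmod (f j))\<bar> = cmod (a j * f j)" for j
    using R[of j] by (auto simp: power_divide power_mult_distrib norm_mult less_imp_le abs_mult)
  note cs = infsum_Cauchy_Schwarz[of "\<lambda>j. cmod (a j) / sqrt (R j)" S "\<lambda>j. sqrt (R j) * cmod (f j)",
      unfolded e, OF a f]
  show abs: "(\<lambda>j. a j * f j) abs_summable_on S"
    by (rule cs(2))
  show le: "(\<Sum>\<^sub>\<infinity>j\<in>S. cmod (a j * f j))\<^sup>2 \<le>
      (\<Sum>\<^sub>\<infinity>j\<in>S. (cmod (a j))\<^sup>2 / R j) * (\<Sum>\<^sub>\<infinity>j\<in>S. R j * (cmod (f j))\<^sup>2)"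
    by (rule cs(3))
  have "(cmod (\<Sum>\<^sub>\<infinity>j\<in>S. a j * f j))\<^sup>2 \<le> (\<Sum>\<^sub>\<infinity>j\<in>S. cmod (a j * f j))\<^sup>2"
    by (intro power_mono norm_infsum_bound abs) auto
  with le show "(cmod (\<Sum>\<^sub>\<infinity>j\<in>S. a j * f j))\<^sup>2 \<le>
      (\<Sum>\<^sub>\<infinity>j\<in>S. (cmod (a j))\<^sup>2 / R j) * (\<Sum>\<^sub>\<infinity>j\<in>S. R j * (cmod (f j))\<^sup>2)"
    by linarith
qed

text \<open>Source and target weights are separate because elliptic regularity needs the target
  weight \<open>wt powr (2 m \<alpha>)\<close>, smaller than the \<open>wt ^ (2 m)\<close> of the
  form theory.\<close>

lemma hilbert_schmidt_operator:
  fixes A :: "'a \<Rightarrow> 'b \<Rightarrow> complex" and f :: "'b \<Rightarrow> complex"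
  assumes K: "(\<lambda>(k, j). (cmod (A k j))\<^sup>2 / (P k * R j)) summable_on UNIV"
    and P: "\<And>k. P k > 0" and R: "\<And>j. R j > 0"
    and f: "(\<lambda>j. R j * (cmod (f j))\<^sup>2) summable_on UNIV"
  shows "(\<lambda>j. (cmod (A k j))\<^sup>2 / R j) summable_on UNIV"
    and "(\<lambda>j. A k j * f j) abs_summable_on UNIV"
    and "(\<lambda>k. (cmod (\<Sum>\<^sub>\<infinity>j. A k j * f j))\<^sup>2 / P k) summable_on UNIV"
proof -
  have K': "(\<lambda>(k, j). (cmod (A k j))\<^sup>2 / (P k * R j)) summable_on UNIV \<times> UNIV"
    using K by simp
  have row: "(\<lambda>j. (cmod (A k j))\<^sup>2 / R j) summable_on UNIV" for k
  proof -
    have "(\<lambda>j. (cmod (A k j))\<^sup>2 / (P k * R j)) summable_on UNIV"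
      using summable_on_SigmaD1[OF K', of k] by simp
    then have "(\<lambda>j. P k * ((cmod (A k j))\<^sup>2 / (P k * R j))) summable_on UNIV"
      by (rule summable_on_cmult_right)
    then show ?thesis
      using P[of k] by simp
  qed
  then show "(\<lambda>j. (cmod (A k j))\<^sup>2 / R j) summable_on UNIV" .
  show "(\<lambda>j. A k j * f j) abs_summable_on UNIV"
    by (rule weighted_product_abs_summable(1)[OF R row f])
  let ?F = "\<Sum>\<^sub>\<infinity>j. R j * (cmod (f j))\<^sup>2"
  have "(\<lambda>k. \<Sum>\<^sub>\<infinity>j. (cmod (A k j))\<^sup>2 / (P k * R j)) summable_on UNIV"
    using summable_on_SigmaD[OF K'] summable_on_SigmaD1[OF K']
    using summable_on_Sigma_banach[OF K'] by simp
  then have "(\<lambda>k. (\<Sum>\<^sub>\<infinity>j. (cmod (A k j))\<^sup>2 / (P k * R j)) * ?F) summable_on UNIV"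
    by (rule summable_on_cmult_left)
  then show "(\<lambda>k. (cmod (\<Sum>\<^sub>\<infinity>j. A k j * f j))\<^sup>2 / P k) summable_on UNIV"
  proof (rule summable_on_comparison_test)
    fix k
    have "(\<Sum>\<^sub>\<infinity>j. (cmod (A k j))\<^sup>2 / (P k * R j)) = (\<Sum>\<^sub>\<infinity>j. inverse (P k) * ((cmod (A k j))\<^sup>2 / R j))"
      using P[of k] by (intro infsum_cong) (auto simp: field_simps)
    also have "\<dots> = inverse (P k) * (\<Sum>\<^sub>\<infinity>j. (cmod (A k j))\<^sup>2 / R j)"
      by (rule infsum_cmult_right')
    finally have e: "(\<Sum>\<^sub>\<infinity>j. (cmod (A k j))\<^sup>2 / (P k * R j)) * ?F =
        inverse (P k) * ((\<Sum>\<^sub>\<infinity>j. (cmod (A k j))\<^sup>2 / R j) * ?F)"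
      by simp
    have "inverse (P k) * (cmod (\<Sum>\<^sub>\<infinity>j. A k j * f j))\<^sup>2 \<le>
        inverse (P k) * ((\<Sum>\<^sub>\<infinity>j. (cmod (A k j))\<^sup>2 / R j) * ?F)"
      using weighted_product_abs_summable(3)[OF R row f, of k] P[of k]
      by (intro mult_left_mono) (auto simp: less_imp_le)
    then show "(cmod (\<Sum>\<^sub>\<infinity>j. A k j * f j))\<^sup>2 / P k \<le> (\<Sum>\<^sub>\<infinity>j. (cmod (A k j))\<^sup>2 / (P k * R j)) * ?F"
      unfolding e by (simp add: divide_inverse mult.commute)
  qed (use P in \<open>auto simp: less_imp_le\<close>)
qed

lemma product_abs_summable:
  fixes f g :: "'a \<Rightarrow> complex"
  assumes f: "(\<lambda>k. (cmod (f k))\<^sup>2) summable_on S" and g: "(\<lambda>k. (cmod (g k))\<^sup>2) summable_on S"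
  shows "(\<lambda>k. f k * cnj (g k)) abs_summable_on S"
    and "(cmod (\<Sum>\<^sub>\<infinity>k\<in>S. f k * cnj (g k)))\<^sup>2 \<le>
      (\<Sum>\<^sub>\<infinity>k\<in>S. (cmod (f k))\<^sup>2) * (\<Sum>\<^sub>\<infinity>k\<in>S. (cmod (g k))\<^sup>2)"
  using weighted_product_abs_summable(1,3)[of "\<lambda>_. 1" f S "\<lambda>k. cnj (g k)"] f g by auto

text \<open>The factors \<open>wt k powr (2 * s)\<close> with \<open>s \<le> m\<close> are absorbed by \<open>wt (k - j) \<le> 2 max (wt k) (wt j)\<close>,
  which reduces the kernel to convolutions of summable sequences.\<close>

lemma multiplication_kernel_hilbert_schmidt:
  fixes V :: "int \<Rightarrow> complex"
  assumes m: "m \<ge> 1" and s: "0 \<le> s" "s \<le> real m"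
    and V: "(\<lambda>k. wt k powr (- (2 * s)) * (cmod (V k))\<^sup>2) summable_on UNIV"
  shows "(\<lambda>(k, j). (cmod (V (k - j)))\<^sup>2 / (wt k powr (2 * s) * wt j ^ (2 * m))) summable_on UNIV"
proof -
  let ?v = "\<lambda>k. wt k powr (- (2 * s)) * (cmod (V k))\<^sup>2"
  let ?t = "\<lambda>k. 1 / wt k ^ (2 * m)"
  have "(\<lambda>(k, j). ?v (k - j) * ?t j) summable_on UNIV" "(\<lambda>(k, j). ?v (k - j) * ?t k) summable_on UNIV"
    using has_sum_convolution_nonneg[OF V summable_on_wt[OF m]] by (auto simp: summable_on_def)
  from summable_on_add[OF this]
  have "(\<lambda>x. 4 ^ m * ((case x of (k, j) \<Rightarrow> ?v (k - j) * ?t j) + (case x of (k, j) \<Rightarrow> ?v (k - j) * ?t k)))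
      summable_on UNIV"
    by (rule summable_on_cmult_right)
  then show ?thesis
  proof (rule summable_on_comparison_test)
    fix x :: "int \<times> int"
    obtain k j where x: "x = (k, j)"
      by fastforce
    have *: "wt (k - j) powr (2 * s) / (wt k powr (2 * s) * wt j ^ (2 * m)) \<le> 4 ^ m * (?t j + ?t k)"
    proof -
      have 4: "(2 :: real) powr (2 * s) \<le> 4 ^ m"
      proof -
        have "(2 :: real) powr (2 * s) \<le> 2 powr (2 * real m)"
          using s by (intro powr_mono) auto
        also have "\<dots> = 4 ^ m"
          by (simp add: powr_powr[symmetric] powr_realpow)
        finally show ?thesis .
      qed
      have le: "wt (k - j) powr (2 * s) \<le> 4 ^ m * (max (wt k) (wt j)) powr (2 * s)"
      proof -
        have "wt (k - j) powr (2 * s) \<le> (2 * max (wt k) (wt j)) powr (2 * s)"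
          using s wt_diff_le_max by (intro powr_mono2) auto
        also have "\<dots> = 2 powr (2 * s) * (max (wt k) (wt j)) powr (2 * s)"
          by (rule powr_mult)
        also have "\<dots> \<le> 4 ^ m * (max (wt k) (wt j)) powr (2 * s)"
          using 4 by (rule mult_right_mono) auto
        finally show ?thesis .
      qed
      show ?thesis
      proof (cases "wt j \<le> wt k")
        case True
        then have "wt (k - j) powr (2 * s) \<le> 4 ^ m * wt k powr (2 * s)"
          using le by (simp add: max_def split: if_splits)
        then have "wt (k - j) powr (2 * s) / (wt k powr (2 * s) * wt j ^ (2 * m)) \<le>
            4 ^ m * wt k powr (2 * s) / (wt k powr (2 * s) * wt j ^ (2 * m))"
          by (rule divide_right_mono) auto
        also have "\<dots> = 4 ^ m * ?t j"
          by simp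
        also have "\<dots> \<le> 4 ^ m * (?t j + ?t k)"
          by (intro mult_left_mono) auto
        finally show ?thesis .
      next
        case False
        then have "wt (k - j) powr (2 * s) \<le> 4 ^ m * wt j powr (2 * s)"
          using le by (simp add: max_def)
        then have "wt (k - j) powr (2 * s) / (wt k powr (2 * s) * wt j ^ (2 * m)) \<le>
            4 ^ m * (wt j powr (2 * s) / (wt k powr (2 * s) * wt j ^ (2 * m)))"
          by (subst times_divide_eq_right, intro divide_right_mono) auto
        also have "\<dots> \<le> 4 ^ m * ?t k"
        proof -
          \<comment> \<open>Here \<open>wt k < wt j\<close>: the surplus power
            \<open>2 m - 2 s\<close>, nonnegative because \<open>s \<le> m\<close>, may be moved
            from \<open>wt j\<close> to the smaller \<open>wt k\<close>.\<close>
          have "wt k powr (2 * real m - 2 * s) \<le> wt j powr (2 * real m - 2 * s)"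
            using False s by (intro powr_mono2) auto
          moreover have "wt i powr (2 * real m - 2 * s) = wt i ^ (2 * m) / wt i powr (2 * s)" for i
            using powr_realpow[of "wt i" "2 * m"] by (simp add: powr_diff)
          ultimately have "wt k ^ (2 * m) / wt k powr (2 * s) \<le> wt j ^ (2 * m) / wt j powr (2 * s)"
            by simp
          then have "wt j powr (2 * s) / (wt k powr (2 * s) * wt j ^ (2 * m)) \<le> ?t k"
            by (simp add: field_simps)
          then show ?thesis
            by (intro mult_left_mono) auto
        qed
        also have "\<dots> \<le> 4 ^ m * (?t j + ?t k)"
          by (intro mult_left_mono) auto
        finally show ?thesis .
      qed
    qed
    have "(cmod (V (k - j)))\<^sup>2 / (wt k powr (2 * s) * wt j ^ (2 * m)) =
        ?v (k - j) * (wt (k - j) powr (2 * s) / (wt k powr (2 * s) * wt j ^ (2 * m)))"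
      by (simp add: powr_minus field_simps)
    also have "\<dots> \<le> ?v (k - j) * (4 ^ m * (?t j + ?t k))"
      using * by (rule mult_left_mono) auto
    finally show "(case x of (k, j) \<Rightarrow> (cmod (V (k - j)))\<^sup>2 / (wt k powr (2 * s) * wt j ^ (2 * m))) \<le>
       4 ^ m * ((case x of (k, j) \<Rightarrow> ?v (k - j) * ?t j) + (case x of (k, j) \<Rightarrow> ?v (k - j) * ?t k))"
      by (simp add: x algebra_simps)
  qed (auto simp: case_prod_unfold)
qed

section \<open>The quadratic form on Fourier coefficients\<close>

definition ip :: "(int \<Rightarrow> complex) \<Rightarrow> (int \<Rightarrow> complex) \<Rightarrow> complex" where
  "ip f g = (\<Sum>\<^sub>\<infinity>k. f k * cnj (g k))"

definition nrm2 :: "(int \<Rightarrow> complex) \<Rightarrow> real" where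
  "nrm2 f = (\<Sum>\<^sub>\<infinity>k. (cmod (f k))\<^sup>2)"

definition unit_seq :: "int \<Rightarrow> int \<Rightarrow> complex" where
  "unit_seq k = (\<lambda>j. if j = k then 1 else 0)"

lemma has_sum_single:
  fixes f :: "'a \<Rightarrow> 'b :: {comm_monoid_add, topological_space}"
  assumes "\<And>x. x \<noteq> a \<Longrightarrow> f x = 0"
  shows "(f has_sum f a) UNIV"
  using has_sum_cong_neutral[of "{a}" UNIV f f "f a"] assms has_sum_finite[of "{a}" f] by auto

lemma has_sum_if_finite:
  assumes "finite F"
  shows "((\<lambda>x. if x \<in> F then f x else 0) has_sum sum f F) UNIV"
proof -
  have "((\<lambda>x. if x \<in> F then f x else 0) has_sum sum f F) UNIV \<longleftrightarrow> (f has_sum sum f F) F"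
    by (rule has_sum_cong_neutral) auto
  then show ?thesis
    using assms has_sum_finite by blast
qed

lemma infsum_single:
  fixes f :: "'a \<Rightarrow> 'b :: {comm_monoid_add, t2_space}"
  assumes "\<And>x. x \<noteq> a \<Longrightarrow> f x = 0"
  shows "infsum f UNIV = f a"
  using has_sum_single[of a f] assms by (simp add: infsumI)

lemma ip_unit_right [simp]: "ip f (unit_seq k) = f k"
  unfolding ip_def by (subst infsum_single[of k]) (auto simp: unit_seq_def)

lemma ip_cnj: "ip g f = cnj (ip f g)"
  unfolding ip_def by (simp flip: infsum_cnj add: mult.commute)

lemma ip_self: "ip f f = of_real (nrm2 f)" if "(\<lambda>k. (cmod (f k))\<^sup>2) summable_on UNIV"
proof -
  have "ip f f = (\<Sum>\<^sub>\<infinity>k. of_real ((cmod (f k))\<^sup>2))"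
    unfolding ip_def complex_norm_square ..
  also have "\<dots> = of_real (nrm2 f)"
    unfolding nrm2_def by (intro infsumI has_sum_of_real has_sum_infsum that)
  finally show ?thesis .
qed

lemma nrm2_nonneg [simp]: "0 \<le> nrm2 f"
  unfolding nrm2_def by (rule infsum_nonneg) auto

lemma nrm2_eq_0D:
  assumes "(\<lambda>k. (cmod (f k))\<^sup>2) summable_on UNIV" "nrm2 f = 0"
  shows "f = (\<lambda>_. 0)"
proof
  fix k
  have "(cmod (f k))\<^sup>2 \<le> nrm2 f"
    unfolding nrm2_def using finite_sum_le_infsum[OF assms(1), of "{k}"] by auto
  then show "f k = 0"
    using assms(2) by simp
qed

lemma infsum_lincomb:
  fixes F :: "'a \<Rightarrow> 'b \<Rightarrow> complex"
  assumes "finite I" "\<And>i. i \<in> I \<Longrightarrow> (\<lambda>k. F i k * h k) summable_on S"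
  shows "((\<lambda>k. (\<Sum>i\<in>I. c i * F i k) * h k) has_sum (\<Sum>i\<in>I. c i * (\<Sum>\<^sub>\<infinity>k\<in>S. F i k * h k))) S"
proof -
  have "((\<lambda>k. \<Sum>i\<in>I. c i * (F i k * h k)) has_sum (\<Sum>i\<in>I. c i * (\<Sum>\<^sub>\<infinity>k\<in>S. F i k * h k))) S"
    using assms
  proof (induction I rule: finite_induct)
    case (insert x I)
    then show ?case
      by (simp, intro has_sum_add has_sum_cmult_right) auto
  qed auto
  then show ?thesis
    by (simp add: sum_distrib_right mult.assoc)
qed

lemma square_add_le: "(x + y)\<^sup>2 \<le> 2 * x\<^sup>2 + 2 * y\<^sup>2" for x y :: real
  using sum_squares_bound[of x y] by (simp add: power2_sum)

lemma norm_add_square_le: "(norm (x + y))\<^sup>2 \<le> 2 * (norm x)\<^sup>2 + 2 * (norm y)\<^sup>2"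
  for x y :: "'a :: real_normed_vector"
proof -
  have "(norm (x + y))\<^sup>2 \<le> (norm x + norm y)\<^sup>2"
    by (intro power_mono norm_triangle_ineq) auto
  then show ?thesis
    using square_add_le[of "norm x" "norm y"] by linarith
qed

lemma two_abs_le_add_if_square_le:
  fixes x y :: real
  assumes "x\<^sup>2 \<le> a * b" "0 \<le> a" "0 \<le> b"
  shows "2 * \<bar>x\<bar> \<le> a + b"
proof -
  have "\<bar>x\<bar> \<le> sqrt (a * b)"
    using assms by (intro real_le_rsqrt) auto
  also have "2 * sqrt (a * b) \<le> a + b"
    using arith_geo_mean_sqrt[of a b] assms by simp
  finally show ?thesis
    by simp
qed

text \<open>Here \<open>V\<close> is the sequence of Fourier coefficients of the potential. The form domain \<open>X\<close> is
  \<open>h\<^sup>m(\<int>)\<close>, and \<open>Q\<close> is the sesquilinear form of \<open>L\<^sub>m\<close>.\<close>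

locale hill_form =
  fixes m :: nat and V :: "int \<Rightarrow> complex"
  assumes m_ge_1: "1 \<le> m" and V_minus: "\<And>k. V (- k) = cnj (V k)"
    and V_weak: "(\<lambda>k. wt k powr (- (2 * real m)) * (cmod (V k))\<^sup>2) summable_on UNIV"
begin

definition mu :: "int \<Rightarrow> real" where
  "mu k = (pi * of_int k) ^ (2 * m)"

definition X :: "(int \<Rightarrow> complex) set" where
  "X = {f. (\<lambda>k. wt k ^ (2 * m) * (cmod (f k))\<^sup>2) summable_on UNIV}"

definition NX :: "(int \<Rightarrow> complex) \<Rightarrow> real" where
  "NX f = (\<Sum>\<^sub>\<infinity>k. wt k ^ (2 * m) * (cmod (f k))\<^sup>2)"

definition conv :: "(int \<Rightarrow> complex) \<Rightarrow> int \<Rightarrow> complex" where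
  "conv f k = (\<Sum>\<^sub>\<infinity>j. V (k - j) * f j)"

definition oper :: "(int \<Rightarrow> complex) \<Rightarrow> int \<Rightarrow> complex" where
  "oper f k = of_real (mu k) * f k + conv f k"

definition Q :: "(int \<Rightarrow> complex) \<Rightarrow> (int \<Rightarrow> complex) \<Rightarrow> complex" where
  "Q f g = ip (oper f) g"

text \<open>The endpoint \<open>s = m\<close> of the kernel estimate. It makes the potential a
  Hilbert-Schmidt form on \<open>X\<close>, from which boundedness and an arbitrarily small relative
  bound both follow.\<close>

lemma kernel_HS: "(\<lambda>(k, j). (cmod (V (k - j)))\<^sup>2 / (wt k ^ (2 * m) * wt j ^ (2 * m))) summable_on UNIV"
proof -
  have "wt k powr (2 * real m) = wt k ^ (2 * m)" for k
    using powr_realpow[of "wt k" "2 * m"] by simp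
  then show ?thesis
    using multiplication_kernel_hilbert_schmidt[OF m_ge_1 _ _ V_weak] by simp
qed

lemma mu_nonneg [simp]: "0 \<le> mu k"
  by (simp add: mu_def power_mult)

lemma mu_abs: "mu k = (pi * \<bar>of_int k\<bar>) ^ (2 * m)"
  by (simp add: mu_def power_mult power_mult_distrib)

lemma mu_le_wt: "mu k \<le> pi ^ (2 * m) * wt k ^ (2 * m)"
proof -
  have "mu k \<le> (pi * wt k) ^ (2 * m)"
    unfolding mu_abs by (intro power_mono mult_left_mono) (auto simp: wt_def)
  then show ?thesis
    by (simp add: power_mult_distrib)
qed

text \<open>For \<open>k \<noteq> 0\<close> one has \<open>1 + \<bar>k\<bar> \<le> 2 \<bar>k\<bar>
  \<le> \<pi> \<bar>k\<bar>\<close>; the summand 1 pays for \<open>k = 0\<close>. This is the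
  ellipticity of the unperturbed operator.\<close>

lemma wt_le_mu: "wt k ^ (2 * m) \<le> mu k + 1"
proof (cases "k = 0")
  case True
  then show ?thesis
    by (simp add: wt_def)
next
  case False
  then have "wt k \<le> 2 * \<bar>of_int k\<bar>"
    by (simp add: wt_def)
  also have "\<dots> \<le> pi * \<bar>of_int k\<bar>"
    using pi_ge_two by (intro mult_right_mono) auto
  finally have "wt k ^ (2 * m) \<le> (pi * \<bar>of_int k\<bar>) ^ (2 * m)"
    by (intro power_mono) auto
  then show ?thesis
    unfolding mu_abs by simp
qed

lemma XD: "f \<in> X \<Longrightarrow> (\<lambda>k. wt k ^ (2 * m) * (cmod (f k))\<^sup>2) summable_on UNIV"
  by (simp add: X_def)

lemma X_l2:
  assumes "f \<in> X"
  shows "(\<lambda>k. (cmod (f k))\<^sup>2) summable_on UNIV"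
proof (rule summable_on_comparison_test[OF XD[OF assms]])
  fix k
  have "1 \<le> wt k ^ (2 * m)"
    by (rule one_le_wt_power)
  then show "(cmod (f k))\<^sup>2 \<le> wt k ^ (2 * m) * (cmod (f k))\<^sup>2"
    by (simp add: mult_le_cancel_right1)
qed auto

lemma X_ip: "f \<in> X \<Longrightarrow> g \<in> X \<Longrightarrow> (\<lambda>k. f k * cnj (g k)) summable_on UNIV"
  by (rule abs_summable_summable, rule product_abs_summable(1)) (auto intro: X_l2)

lemma X_add:
  assumes "f \<in> X" "g \<in> X"
  shows "(\<lambda>k. f k + g k) \<in> X"
  unfolding X_def mem_Collect_eq
proof (rule summable_on_comparison_test)
  show "(\<lambda>k. 2 * (wt k ^ (2 * m) * (cmod (f k))\<^sup>2) + 2 * (wt k ^ (2 * m) * (cmod (g k))\<^sup>2)) summable_on UNIV"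
    by (intro summable_on_add summable_on_cmult_right XD assms)
  fix k
  have "wt k ^ (2 * m) * (cmod (f k + g k))\<^sup>2 \<le>
      wt k ^ (2 * m) * (2 * (cmod (f k))\<^sup>2 + 2 * (cmod (g k))\<^sup>2)"
    by (intro mult_left_mono norm_add_square_le) auto
  then show "wt k ^ (2 * m) * (cmod (f k + g k))\<^sup>2 \<le>
      2 * (wt k ^ (2 * m) * (cmod (f k))\<^sup>2) + 2 * (wt k ^ (2 * m) * (cmod (g k))\<^sup>2)"
    by (simp add: algebra_simps)
qed auto

lemma X_scale:
  assumes "f \<in> X"
  shows "(\<lambda>k. c * f k) \<in> X"
proof -
  have "(\<lambda>k. (cmod c)\<^sup>2 * (wt k ^ (2 * m) * (cmod (f k))\<^sup>2)) summable_on UNIV"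
    by (intro summable_on_cmult_right XD assms)
  then show ?thesis
    by (simp add: X_def norm_mult power_mult_distrib mult_ac)
qed

lemma X_zero: "(\<lambda>_. 0) \<in> X"
  by (simp add: X_def)

lemma X_sum:
  assumes "finite I" "\<And>i. i \<in> I \<Longrightarrow> F i \<in> X"
  shows "(\<lambda>k. \<Sum>i\<in>I. c i * F i k) \<in> X"
  using assms
proof (induction I rule: finite_induct)
  case (insert x I)
  then show ?case
    using X_add[OF X_scale, of "F x" "\<lambda>k. \<Sum>i\<in>I. c i * F i k" "c x"] by simp
qed (simp add: X_zero)

lemma X_diff: "f \<in> X \<Longrightarrow> g \<in> X \<Longrightarrow> (\<lambda>k. f k - g k) \<in> X"
  using X_add[of f "\<lambda>k. (- 1) * g k"] X_scale[of g "- 1"] by simp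

lemma X_finite_support:
  assumes "finite {k. f k \<noteq> 0}"
  shows "f \<in> X"
  unfolding X_def mem_Collect_eq
  by (rule finite_nonzero_values_imp_summable_on) (rule finite_subset[OF _ assms], auto)

lemma X_unit: "unit_seq k \<in> X"
  by (rule X_finite_support) (auto simp: unit_seq_def)

lemma X_restrict:
  assumes "f \<in> X"
  shows "(\<lambda>k. if k \<in> S then f k else 0) \<in> X"
  unfolding X_def mem_Collect_eq
  by (rule summable_on_comparison_test[OF XD[OF assms]]) auto

lemma conv_abs_summable: "f \<in> X \<Longrightarrow> (\<lambda>j. V (k - j) * f j) abs_summable_on UNIV"
  by (rule hilbert_schmidt_operator(2)[OF kernel_HS]) (auto intro: XD)

lemma conv_summable: "f \<in> X \<Longrightarrow> (\<lambda>j. V (k - j) * f j) summable_on UNIV"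
  by (rule abs_summable_summable[OF conv_abs_summable])

lemma conv_dual:
  assumes "f \<in> X"
  shows "(\<lambda>k. (cmod (conv f k))\<^sup>2 / wt k ^ (2 * m)) summable_on UNIV"
  unfolding conv_def by (rule hilbert_schmidt_operator(3)[OF kernel_HS]) (auto intro: XD assms)

lemma mu_dual:
  assumes "f \<in> X"
  shows "(\<lambda>k. (cmod (of_real (mu k) * f k))\<^sup>2 / wt k ^ (2 * m)) summable_on UNIV"
proof (rule summable_on_comparison_test)
  show "(\<lambda>k. (pi ^ (2 * m))\<^sup>2 * (wt k ^ (2 * m) * (cmod (f k))\<^sup>2)) summable_on UNIV"
    by (intro summable_on_cmult_right XD assms)
  fix k
  have "(cmod (of_real (mu k) * f k))\<^sup>2 \<le> (pi ^ (2 * m) * wt k ^ (2 * m) * cmod (f k))\<^sup>2"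
    unfolding norm_mult by (intro power_mono mult_right_mono) (auto intro: mu_le_wt)
  then have "(cmod (of_real (mu k) * f k))\<^sup>2 / wt k ^ (2 * m) \<le>
      (pi ^ (2 * m) * wt k ^ (2 * m) * cmod (f k))\<^sup>2 / wt k ^ (2 * m)"
    by (rule divide_right_mono) auto
  then show "(cmod (of_real (mu k) * f k))\<^sup>2 / wt k ^ (2 * m) \<le>
      (pi ^ (2 * m))\<^sup>2 * (wt k ^ (2 * m) * (cmod (f k))\<^sup>2)"
    by (simp add: power_mult_distrib power2_eq_square[of "wt k ^ (2 * m)"])
qed auto

text \<open>\<open>oper\<close> maps \<open>X\<close> into its dual, the weighted space with
  exponent \<open>- m\<close>. So \<open>Q f g\<close> is a duality pairing; \<open>oper f\<close>
  itself need not be square summable.\<close>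

lemma oper_dual:
  assumes "f \<in> X"
  shows "(\<lambda>k. (cmod (oper f k))\<^sup>2 / wt k ^ (2 * m)) summable_on UNIV"
proof (rule summable_on_comparison_test)
  show "(\<lambda>k. 2 * ((cmod (of_real (mu k) * f k))\<^sup>2 / wt k ^ (2 * m)) +
      2 * ((cmod (conv f k))\<^sup>2 / wt k ^ (2 * m))) summable_on UNIV"
    by (intro summable_on_add summable_on_cmult_right conv_dual mu_dual assms)
  fix k
  have "(cmod (oper f k))\<^sup>2 / wt k ^ (2 * m) \<le>
      (2 * (cmod (of_real (mu k) * f k))\<^sup>2 + 2 * (cmod (conv f k))\<^sup>2) / wt k ^ (2 * m)"
    unfolding oper_def by (intro divide_right_mono norm_add_square_le) auto
  then show "(cmod (oper f k))\<^sup>2 / wt k ^ (2 * m) \<le>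
      2 * ((cmod (of_real (mu k) * f k))\<^sup>2 / wt k ^ (2 * m)) + 2 * ((cmod (conv f k))\<^sup>2 / wt k ^ (2 * m))"
    by (simp add: add_divide_distrib)
qed auto

lemma dual_pairing_summable:
  assumes "(\<lambda>k. (cmod (a k))\<^sup>2 / wt k ^ (2 * m)) summable_on UNIV" "g \<in> X"
  shows "(\<lambda>k. a k * cnj (g k)) summable_on UNIV"
  by (rule abs_summable_summable, rule weighted_product_abs_summable(1)[OF _ assms(1)])
    (use XD[OF assms(2)] in auto)

lemma Q_summable: "f \<in> X \<Longrightarrow> g \<in> X \<Longrightarrow> (\<lambda>k. oper f k * cnj (g k)) summable_on UNIV"
  by (rule dual_pairing_summable[OF oper_dual])

lemma oper_sum:
  assumes "finite I" "\<And>i. i \<in> I \<Longrightarrow> F i \<in> X"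
  shows "oper (\<lambda>k. \<Sum>i\<in>I. c i * F i k) k = (\<Sum>i\<in>I. c i * oper (F i) k)"
proof -
  have "conv (\<lambda>k. \<Sum>i\<in>I. c i * F i k) k = (\<Sum>i\<in>I. c i * conv (F i) k)"
  proof -
    have "(\<lambda>j. F i j * V (k - j)) summable_on UNIV" if "i \<in> I" for i
      using conv_summable[OF assms(2)[OF that], of k] by (simp add: mult.commute)
    from infsumI[OF infsum_lincomb[OF assms(1) this, where c = c]] show ?thesis
      by (simp add: conv_def mult.commute[of "V _"])
  qed
  then show ?thesis
    by (simp add: oper_def sum.distrib distrib_left sum_distrib_left mult_ac)
qed

lemma Q_sum_left:
  assumes "finite I" "\<And>i. i \<in> I \<Longrightarrow> F i \<in> X" "g \<in> X"
  shows "Q (\<lambda>k. \<Sum>i\<in>I. c i * F i k) g = (\<Sum>i\<in>I. c i * Q (F i) g)"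
proof -
  have "oper (\<lambda>k. \<Sum>i\<in>I. c i * F i k) = (\<lambda>k. \<Sum>i\<in>I. c i * oper (F i) k)"
    by (rule ext) (rule oper_sum[OF assms(1,2)])
  then show ?thesis
    unfolding Q_def ip_def
    by (simp, intro infsumI infsum_lincomb) (use assms Q_summable in auto)
qed

lemma ip_sum_left:
  assumes "finite I" "\<And>i. i \<in> I \<Longrightarrow> F i \<in> X" "g \<in> X"
  shows "ip (\<lambda>k. \<Sum>i\<in>I. c i * F i k) g = (\<Sum>i\<in>I. c i * ip (F i) g)"
  unfolding ip_def
  by (intro infsumI infsum_lincomb) (use assms X_ip in auto)

lemma pair_abs_summable:
  assumes "f \<in> X" "g \<in> X"
  shows "(\<lambda>(k, j). V (k - j) * f j * cnj (g k)) abs_summable_on UNIV"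
  using hilbert_schmidt_form(1)[of "\<lambda>k j. V (k - j)" "\<lambda>k. wt k ^ (2 * m)" UNIV f g] kernel_HS assms
  by (simp add: XD)

lemma mu_summable:
  assumes "f \<in> X" "g \<in> X"
  shows "(\<lambda>k. of_real (mu k) * f k * cnj (g k)) summable_on UNIV"
  by (rule dual_pairing_summable[OF mu_dual[OF assms(1)] assms(2)])

lemma mu_form_has_sum:
  assumes "f \<in> X"
  shows "((\<lambda>k. mu k * (cmod (f k))\<^sup>2) has_sum Re (\<Sum>\<^sub>\<infinity>k. of_real (mu k) * f k * cnj (f k))) UNIV"
proof -
  have "((\<lambda>k. Re (of_real (mu k) * f k * cnj (f k))) has_sum
      Re (\<Sum>\<^sub>\<infinity>k. of_real (mu k) * f k * cnj (f k))) UNIV"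
    by (intro has_sum_Re has_sum_infsum mu_summable assms)
  moreover have "Re (of_real (mu k) * f k * cnj (f k)) = mu k * (cmod (f k))\<^sup>2" for k
    by (simp add: mult.assoc complex_norm_square[symmetric] del: of_real_power)
  ultimately show ?thesis
    by simp
qed

text \<open>The potential part is put into the shape of an absolutely convergent double sum, since
  its symmetry and its Hilbert-Schmidt bounds are visible only there.\<close>

lemma Q_split:
  assumes "f \<in> X" "g \<in> X"
  shows "Q f g = (\<Sum>\<^sub>\<infinity>k. of_real (mu k) * f k * cnj (g k)) +
    (\<Sum>\<^sub>\<infinity>(k, j). V (k - j) * f j * cnj (g k))"
    and "(\<Sum>\<^sub>\<infinity>(k, j). V (k - j) * f j * cnj (g k)) = (\<Sum>\<^sub>\<infinity>k. conv f k * cnj (g k))"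
proof -
  have s: "(\<lambda>(k, j). V (k - j) * f j * cnj (g k)) summable_on UNIV \<times> UNIV"
    using abs_summable_summable[OF pair_abs_summable[OF assms]] by simp
  have "(\<Sum>\<^sub>\<infinity>(k, j). V (k - j) * f j * cnj (g k)) = (\<Sum>\<^sub>\<infinity>k. \<Sum>\<^sub>\<infinity>j. V (k - j) * f j * cnj (g k))"
    using infsum_Sigma'_banach[OF s] by simp
  also have "\<dots> = (\<Sum>\<^sub>\<infinity>k. conv f k * cnj (g k))"
    unfolding conv_def by (subst infsum_cmult_left') simp
  finally show e: "(\<Sum>\<^sub>\<infinity>(k, j). V (k - j) * f j * cnj (g k)) = (\<Sum>\<^sub>\<infinity>k. conv f k * cnj (g k))" .
  have c: "(\<lambda>k. conv f k * cnj (g k)) summable_on UNIV"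
    by (intro dual_pairing_summable conv_dual assms)
  show "Q f g = (\<Sum>\<^sub>\<infinity>k. of_real (mu k) * f k * cnj (g k)) +
      (\<Sum>\<^sub>\<infinity>(k, j). V (k - j) * f j * cnj (g k))"
    unfolding e Q_def ip_def using infsum_add[OF mu_summable[OF assms] c]
    by (simp add: oper_def distrib_right)
qed

text \<open>Transposing the double sum replaces \<open>V (k - j)\<close> by
  \<open>V (j - k)\<close>, which is its conjugate because the potential is real.\<close>

lemma Q_cnj:
  assumes "f \<in> X" "g \<in> X"
  shows "Q g f = cnj (Q f g)"
proof -
  have "cnj (\<Sum>\<^sub>\<infinity>(k, j). V (k - j) * f j * cnj (g k)) =
      (\<Sum>\<^sub>\<infinity>(k, j). cnj (V (k - j)) * cnj (f j) * g k)"
    unfolding infsum_cnj[symmetric] by (intro infsum_cong) auto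
  also have "\<dots> = (\<Sum>\<^sub>\<infinity>(j, k). cnj (V (k - j)) * cnj (f j) * g k)"
  proof -
    have "bij (\<lambda>(k, j). (j, k) :: int \<times> int)"
      by (rule bij_betw_byWitness[where f' = "\<lambda>(k, j). (j, k)"]) auto
    from infsum_reindex_bij_betw[OF this, of "\<lambda>(k, j). cnj (V (k - j)) * cnj (f j) * g k"]
    show ?thesis
      by (simp add: case_prod_unfold)
  qed
  also have "\<dots> = (\<Sum>\<^sub>\<infinity>(j, k). V (j - k) * g k * cnj (f j))"
    by (intro infsum_cong) (auto simp: V_minus[symmetric])
  finally have "cnj (\<Sum>\<^sub>\<infinity>(k, j). V (k - j) * f j * cnj (g k)) =
      (\<Sum>\<^sub>\<infinity>(j, k). V (j - k) * g k * cnj (f j))" .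
  moreover have "cnj (\<Sum>\<^sub>\<infinity>k. of_real (mu k) * f k * cnj (g k)) =
      (\<Sum>\<^sub>\<infinity>k. of_real (mu k) * g k * cnj (f k))"
    unfolding infsum_cnj[symmetric] by (intro infsum_cong) auto
  ultimately show ?thesis
    by (simp add: Q_split[OF assms] Q_split[OF assms(2,1)] del: infsum_cnj)
qed

lemma Q_self_real: "f \<in> X \<Longrightarrow> Q f f = of_real (Re (Q f f))"
  using Q_cnj[of f f] by (simp add: complex_eq_iff)

lemma Q_unit [simp]: "Q f (unit_seq k) = oper f k"
  by (simp add: Q_def)

lemma NX_nonneg [simp]: "0 \<le> NX f"
  unfolding NX_def by (rule infsum_nonneg) auto

text \<open>A square-summable kernel is a finite part plus a remainder of small Hilbert-Schmidt
  norm. The finite part is bounded on square-summable sequences and goes into \<open>C\<close>; the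
  remainder has squared norm at most 1/16 and so consumes at most a quarter of
  \<open>NX f\<close>.\<close>

lemma coercive: "\<exists>C. \<forall>f\<in>X. NX f \<le> 2 * Re (Q f f) + C * nrm2 f"
proof -
  let ?K = "\<lambda>(k, j). (cmod (V (k - j)))\<^sup>2 / (wt k ^ (2 * m) * wt j ^ (2 * m))"
  obtain F where F: "finite F" "norm (sum ?K F - infsum ?K UNIV) \<le> 1 / 16"
    using infsum_finite_approximation[OF kernel_HS, of "1/16"] by (auto simp: dist_norm)
  define A where "A k j = (if (k, j) \<in> F then 0 else V (k - j))" for k j
  have split: "?K = (\<lambda>x. (case x of (k, j) \<Rightarrow> (cmod (A k j))\<^sup>2 / (wt k ^ (2 * m) * wt j ^ (2 * m))) +
      (if x \<in> F then ?K x else 0))"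
    by (auto simp: A_def fun_eq_iff)
  have sA: "(\<lambda>(k, j). (cmod (A k j))\<^sup>2 / (wt k ^ (2 * m) * wt j ^ (2 * m))) summable_on UNIV"
    by (rule summable_on_comparison_test[OF kernel_HS]) (auto simp: A_def)
  have sF: "((\<lambda>x. if x \<in> F then ?K x else 0) has_sum sum ?K F) UNIV"
    by (rule has_sum_if_finite[OF F(1)])
  have "infsum ?K UNIV = (\<Sum>\<^sub>\<infinity>(k, j). (cmod (A k j))\<^sup>2 / (wt k ^ (2 * m) * wt j ^ (2 * m))) + sum ?K F"
    by (subst split, subst infsum_add[OF sA]) (use sF in \<open>auto simp: summable_on_def infsumI\<close>)
  with F(2) have IA: "(\<Sum>\<^sub>\<infinity>(k, j). (cmod (A k j))\<^sup>2 / (wt k ^ (2 * m) * wt j ^ (2 * m))) \<le> 1 / 16"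
    by simp
  \<comment> \<open>The inequality for \<open>NX f\<close> is doubled at the end: the sum is twice
    the bound of the finite part, and the leading 2 is twice the summand 1 of
    \<open>wt_le_mu\<close>.\<close>
  define C where "C = 2 + 2 * (\<Sum>(k, j)\<in>F. cmod (V (k - j)))"
  have "NX f \<le> 2 * Re (Q f f) + C * nrm2 f" if f: "f \<in> X" for f
  proof -
    have pt: "(cmod (f k))\<^sup>2 \<le> nrm2 f" for k
      unfolding nrm2_def using finite_sum_le_infsum[OF X_l2[OF f], of "{k}"] by auto
    have ptt: "cmod (f j) * cmod (f k) \<le> nrm2 f" for j k
      using sum_squares_bound[of "cmod (f j)" "cmod (f k)"] pt[of k] pt[of j] by simp
    have absA: "(\<lambda>(k, j). A k j * f j * cnj (f k)) abs_summable_on UNIV"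
      using hilbert_schmidt_form(1)[of A "\<lambda>k. wt k ^ (2 * m)" UNIV f f] sA by (simp add: XD f)
    define S where "S = (\<Sum>\<^sub>\<infinity>(k, j). cmod (A k j * f j * cnj (f k)))"
    have "S\<^sup>2 \<le> (\<Sum>\<^sub>\<infinity>(k, j). (cmod (A k j))\<^sup>2 / (wt k ^ (2 * m) * wt j ^ (2 * m))) * (NX f * NX f)"
      using hilbert_schmidt_form(2)[of A "\<lambda>k. wt k ^ (2 * m)" UNIV f f] sA
      by (simp add: XD f S_def NX_def)
    also have "\<dots> \<le> 1 / 16 * (NX f * NX f)"
      using IA by (intro mult_right_mono) auto
    also have "\<dots> = (NX f / 4)\<^sup>2"
      by (simp add: power2_eq_square)
    finally have S: "S \<le> NX f / 4"
      by (rule power2_le_imp_le) simp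
    have sp: "(\<lambda>(k, j). V (k - j) * f j * cnj (f k)) =
        (\<lambda>x. (case x of (k, j) \<Rightarrow> A k j * f j * cnj (f k)) +
          (if x \<in> F then case x of (k, j) \<Rightarrow> V (k - j) * f j * cnj (f k) else 0))"
      by (auto simp: A_def fun_eq_iff)
    have sF: "((\<lambda>x. if x \<in> F then case x of (k, j) \<Rightarrow> V (k - j) * f j * cnj (f k) else 0) has_sum
        (\<Sum>(k, j)\<in>F. V (k - j) * f j * cnj (f k))) UNIV"
      by (rule has_sum_if_finite[OF F(1)])
    have pairs: "(\<Sum>\<^sub>\<infinity>(k, j). V (k - j) * f j * cnj (f k)) =
        (\<Sum>\<^sub>\<infinity>(k, j). A k j * f j * cnj (f k)) + (\<Sum>(k, j)\<in>F. V (k - j) * f j * cnj (f k))"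
      by (subst sp, subst infsum_add[OF abs_summable_summable[OF absA]])
        (use sF in \<open>auto simp: summable_on_def infsumI\<close>)
    have "cmod (\<Sum>\<^sub>\<infinity>(k, j). A k j * f j * cnj (f k)) \<le> S"
      using norm_infsum_bound[OF absA] by (simp add: S_def case_prod_unfold)
    moreover have "cmod (\<Sum>(k, j)\<in>F. V (k - j) * f j * cnj (f k)) \<le>
        (\<Sum>(k, j)\<in>F. cmod (V (k - j)) * nrm2 f)"
    proof (rule sum_norm_le, clarify)
      fix k j
      show "cmod (V (k - j) * f j * cnj (f k)) \<le> cmod (V (k - j)) * nrm2 f"
        using mult_left_mono[OF ptt[of j k], of "cmod (V (k - j))"]
        by (simp add: norm_mult mult.assoc)
    qed
    moreover have "(\<Sum>(k, j)\<in>F. cmod (V (k - j)) * nrm2 f) = (C - 2) / 2 * nrm2 f"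
      by (simp add: C_def sum_distrib_right case_prod_unfold)
    ultimately have V: "cmod (\<Sum>\<^sub>\<infinity>(k, j). V (k - j) * f j * cnj (f k)) \<le> NX f / 4 + (C - 2) / 2 * nrm2 f"
      unfolding pairs using S
        norm_triangle_ineq[of "\<Sum>\<^sub>\<infinity>(k, j). A k j * f j * cnj (f k)"
          "\<Sum>(k, j)\<in>F. V (k - j) * f j * cnj (f k)"]
      by linarith
    let ?M = "\<Sum>\<^sub>\<infinity>k. of_real (mu k) * f k * cnj (f k)"
    have M: "((\<lambda>k. mu k * (cmod (f k))\<^sup>2) has_sum Re ?M) UNIV"
      by (rule mu_form_has_sum) (rule f)
    have "NX f \<le> Re ?M + nrm2 f"
    proof -
      have b: "((\<lambda>k. mu k * (cmod (f k))\<^sup>2 + (cmod (f k))\<^sup>2) has_sum (Re ?M + nrm2 f)) UNIV"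
        unfolding nrm2_def by (intro has_sum_add M has_sum_infsum X_l2 f)
      have a: "((\<lambda>k. wt k ^ (2 * m) * (cmod (f k))\<^sup>2) has_sum NX f) UNIV"
        unfolding NX_def by (intro has_sum_infsum XD f)
      show ?thesis
      proof (rule has_sum_mono[OF a b])
        fix k
        show "wt k ^ (2 * m) * (cmod (f k))\<^sup>2 \<le> mu k * (cmod (f k))\<^sup>2 + (cmod (f k))\<^sup>2"
          using mult_right_mono[OF wt_le_mu[of k], of "(cmod (f k))\<^sup>2"] by (simp add: distrib_right)
      qed
    qed
    moreover have "Re (Q f f) \<ge> Re ?M - cmod (\<Sum>\<^sub>\<infinity>(k, j). V (k - j) * f j * cnj (f k))"
      unfolding Q_split(1)[OF f f] plus_complex.sel
      using abs_Re_le_cmod[of "\<Sum>\<^sub>\<infinity>(k, j). V (k - j) * f j * cnj (f k)"]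
      by linarith
    moreover have "C * nrm2 f = 2 * nrm2 f + 2 * ((C - 2) / 2 * nrm2 f)"
      by (simp add: field_simps)
    ultimately show ?thesis
      using V NX_nonneg[of f] by linarith
  qed
  then show ?thesis
    by blast
qed

end

section \<open>Periodic distributions and their Fourier coefficients\<close>

lemma cnj_fexp: "cnj (fexp k x) = fexp (- k) x"
  by (simp add: fexp_def exp_cnj)

lemma fcoeff_eq: "fcoeff f k = f (fexp (- k))"
  by (simp add: fcoeff_def pairing_def cnj_fexp)

lemma fexp_add: "fexp k x * fexp j x = fexp (k + j) x"
  by (simp add: fexp_def exp_add[symmetric] algebra_simps)

lemma norm_fexp [simp]: "norm (fexp k x) = 1"
  by (simp add: fexp_def norm_exp_eq_Re)

lemma fexp_has_vector_derivative:
  "((\<lambda>x. c * fexp k x) has_vector_derivative (\<i> * of_int k * of_real pi * c) * fexp k x) (at x)"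
proof -
  have "((\<lambda>z. c * exp (\<i> * of_int k * of_real pi * z)) has_field_derivative
      (\<i> * of_int k * of_real pi * c) * exp (\<i> * of_int k * of_real pi * of_real x)) (at (of_real x))"
    by (auto intro!: derivative_eq_intros)
  from has_vector_derivative_real_field[OF this] show ?thesis
    by (simp add: fexp_def)
qed

lemma fderiv_fexp: "fderiv (\<lambda>x. c * fexp k x) = (\<lambda>x. (\<i> * of_int k * of_real pi * c) * fexp k x)"
  unfolding fderiv_def by (rule ext) (rule vector_derivative_at[OF fexp_has_vector_derivative])

lemma fderiv_funpow_fexp: "(fderiv ^^ j) (fexp k) = (\<lambda>x. (\<i> * of_int k * of_real pi) ^ j * fexp k x)"
proof (induction j)
  case (Suc j)
  then show ?case
    by (simp add: fderiv_fexp mult.assoc)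
qed simp

lemma fexp_test [simp]: "fexp k \<in> test_functions"
  unfolding test_functions_def
proof (intro CollectI conjI allI)
  fix x
  have "fexp k (x + 2) = fexp k x * exp (2 * of_int k * of_real pi * \<i>)"
    by (simp add: fexp_def exp_add[symmetric] algebra_simps)
  also have "exp (2 * of_int k * of_real pi * \<i>) = 1"
    using exp_integer_2pi[of "of_int k"] by (simp add: mult_ac)
  finally show "fexp k (x + 2) = fexp k x"
    by simp
  fix j
  show "(fderiv ^^ j) (fexp k) differentiable at x"
    unfolding fderiv_funpow_fexp using fexp_has_vector_derivative[of _ k x]
    by (auto simp: differentiable_def has_vector_derivative_def)
qed

section \<open>Smooth periodic test functions\<close>

lemma test_has_derivative:
  assumes "\<phi> \<in> test_functions"
  shows "(\<phi> has_vector_derivative fderiv \<phi> x) (at x)"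
proof -
  have "(fderiv ^^ 0) \<phi> differentiable at x"
    using assms unfolding test_functions_def by blast
  then show ?thesis
    unfolding fderiv_def by (simp add: vector_derivative_works)
qed

lemma fderiv_test [simp]:
  assumes "\<phi> \<in> test_functions"
  shows "fderiv \<phi> \<in> test_functions"
  unfolding test_functions_def
proof (intro CollectI conjI allI)
  fix x
  have "(\<phi> has_vector_derivative fderiv \<phi> (x + 2)) (at (x + 2))"
    by (rule test_has_derivative[OF assms])
  then have "((\<phi> \<circ> (\<lambda>x. x + 2)) has_vector_derivative 1 *\<^sub>R fderiv \<phi> (x + 2)) (at x)"
    by (intro vector_diff_chain_at) (auto intro!: derivative_eq_intros)
  moreover have "\<phi> \<circ> (\<lambda>x. x + 2) = \<phi>"
    using assms by (auto simp: test_functions_def)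
  ultimately show "fderiv \<phi> (x + 2) = fderiv \<phi> x"
    using vector_derivative_at[of \<phi> "fderiv \<phi> (x + 2)" x] by (simp add: fderiv_def[of \<phi>])
  fix j
  have "(fderiv ^^ Suc j) \<phi> differentiable at x"
    using assms unfolding test_functions_def by blast
  then show "(fderiv ^^ j) (fderiv \<phi>) differentiable at x"
    by (simp add: funpow_swap1)
qed

lemma fderiv_funpow_test: "\<phi> \<in> test_functions \<Longrightarrow> (fderiv ^^ j) \<phi> \<in> test_functions"
  by (induction j) auto

lemma test_continuous: "\<phi> \<in> test_functions \<Longrightarrow> continuous_on S \<phi>"
  using test_has_derivative
  by (intro continuous_at_imp_continuous_on ballI has_vector_derivative_continuous) blast

text \<open>The seminorms are conditionally complete suprema, which carry information only when the
  range is bounded. Periodicity reduces this to the compact interval from 0 to 2.\<close>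

lemma test_bdd:
  assumes "\<phi> \<in> test_functions"
  shows "bdd_above (range (\<lambda>x. norm (\<phi> x)))"
proof -
  have "compact ((\<lambda>x. norm (\<phi> x)) ` {0..2})"
    by (intro compact_continuous_image continuous_on_norm test_continuous assms) auto
  then have "bounded ((\<lambda>x. norm (\<phi> x)) ` {0..2})"
    by (rule compact_imp_bounded)
  then obtain B where "\<forall>x\<in>{0..2}. norm (\<phi> x) \<le> B"
    by (auto simp: bounded_iff)
  then have B: "norm (\<phi> x) \<le> B" if "x \<in> {0..2}" for x
    using that by blast
  have p: "\<phi> (y + 2) = \<phi> y" for y
    using assms unfolding test_functions_def by blast
  have per: "\<phi> (x + 2 * of_int n) = \<phi> x" for x and n :: int
  proof (induction n rule: int_induct[of _ 0])
    case (step1 i)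
    have "\<phi> (x + 2 * of_int (i + 1)) = \<phi> (x + 2 * of_int i + 2)"
      by (simp add: algebra_simps)
    then show ?case
      unfolding p step1 .
  next
    case (step2 i)
    have "\<phi> (x + 2 * of_int i) = \<phi> (x + 2 * of_int (i - 1) + 2)"
      by (simp add: algebra_simps)
    then show ?case
      unfolding p step2 by simp
  qed simp
  have "norm (\<phi> x) \<le> B" for x
  proof -
    let ?y = "x + 2 * of_int (- \<lfloor>x / 2\<rfloor>)"
    have "?y \<in> {0..2}"
      using floor_correct[of "x / 2"] by simp linarith
    then show ?thesis
      using B[of ?y] unfolding per[of x "- \<lfloor>x / 2\<rfloor>"] by simp
  qed
  then show ?thesis
    by (rule bdd_aboveI2)
qed

section \<open>Fourier coefficients of test functions and their decay\<close>

definition fhat :: "int \<Rightarrow> (real \<Rightarrow> complex) \<Rightarrow> complex" where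
  "fhat k \<phi> = 1/2 * integral {-1..1} (\<lambda>x. fexp k x * \<phi> x)"

lemma fourier_series_eq:
  "fourier_series c \<phi> = (if \<phi> \<in> test_functions then \<Sum>\<^sub>\<infinity>k. c k * fhat k \<phi> else 0)"
  by (simp add: fourier_series_def fhat_def)

text \<open>Integration by parts; the boundary terms at -1 and 1 cancel by 2-periodicity.\<close>

lemma fhat_deriv:
  assumes "\<phi> \<in> test_functions"
  shows "fhat k (fderiv \<phi>) = - (\<i> * of_int k * of_real pi) * fhat k \<phi>"
proof -
  have cont: "continuous_on {-1..1} (\<lambda>x. fexp k x * \<psi> x)" if "\<psi> \<in> test_functions" for \<psi>
    by (intro continuous_on_mult test_continuous that fexp_test)
  have "((\<lambda>x. fexp k x * fderiv \<phi> x + (\<i> * of_int k * of_real pi) * fexp k x * \<phi> x) has_integral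
      fexp k 1 * \<phi> 1 - fexp k (-1) * \<phi> (-1)) {-1..1}"
  proof (rule fundamental_theorem_of_calculus)
    fix x
    have "((\<lambda>x. fexp k x * \<phi> x) has_vector_derivative
        fexp k x * fderiv \<phi> x + (\<i> * of_int k * of_real pi) * fexp k x * \<phi> x) (at x)"
      using has_vector_derivative_mult[OF _ test_has_derivative[OF assms, of x],
          of "fexp k" "\<i> * of_int k * of_real pi * fexp k x"]
        fexp_has_vector_derivative[of 1 k x] by simp
    then show "((\<lambda>x. fexp k x * \<phi> x) has_vector_derivative
        fexp k x * fderiv \<phi> x + (\<i> * of_int k * of_real pi) * fexp k x * \<phi> x) (at x within {-1..1})"
      by (rule has_vector_derivative_at_within)
  qed simp
  moreover have "fexp k 1 * \<phi> 1 = fexp k (-1) * \<phi> (-1)"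
  proof -
    have "\<psi> (-1 + 2) = \<psi> (-1)" if "\<psi> \<in> test_functions" for \<psi>
      using that unfolding test_functions_def by blast
    from this[OF assms] this[OF fexp_test, of k] show ?thesis
      by simp
  qed
  ultimately have z: "((\<lambda>x. fexp k x * fderiv \<phi> x + (\<i> * of_int k * of_real pi) * (fexp k x * \<phi> x))
      has_integral 0) {-1..1}"
    by (simp add: mult.assoc)
  have 1: "((\<lambda>x. fexp k x * fderiv \<phi> x) has_integral integral {-1..1} (\<lambda>x. fexp k x * fderiv \<phi> x)) {-1..1}"
    by (intro integrable_integral integrable_continuous_interval cont fderiv_test assms)
  have 2: "((\<lambda>x. fexp k x * \<phi> x) has_integral integral {-1..1} (\<lambda>x. fexp k x * \<phi> x)) {-1..1}"
    by (intro integrable_integral integrable_continuous_interval cont assms)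
  have "integral {-1..1} (\<lambda>x. fexp k x * fderiv \<phi> x) +
      (\<i> * of_int k * of_real pi) * integral {-1..1} (\<lambda>x. fexp k x * \<phi> x) = 0"
    using has_integral_unique[OF has_integral_add[OF 1 has_integral_mult_right[OF 2]] z] by simp
  then show ?thesis
    by (simp add: fhat_def eq_neg_iff_add_eq_0 field_simps)
qed

lemma fhat_funpow_deriv:
  "\<phi> \<in> test_functions \<Longrightarrow> fhat k ((fderiv ^^ n) \<phi>) = (- (\<i> * of_int k * of_real pi)) ^ n * fhat k \<phi>"
  by (induction n) (simp_all add: fhat_deriv fderiv_funpow_test)

lemma norm_fhat_le:
  assumes "\<phi> \<in> test_functions"
  shows "norm (fhat k \<phi>) \<le> (SUP x. norm (\<phi> x))"
proof -
  have "norm (integral {-1..1} (\<lambda>x. fexp k x * \<phi> x)) \<le> (SUP x. norm (\<phi> x)) * (1 - (-1))"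
  proof (rule integral_bound)
    show "continuous_on {- 1..1} (\<lambda>x. fexp k x * \<phi> x)"
      by (intro continuous_on_mult test_continuous fexp_test assms)
    show "norm (fexp k t * \<phi> t) \<le> (SUP x. norm (\<phi> x))" for t
      unfolding norm_mult norm_fexp using cSUP_upper[OF UNIV_I test_bdd[OF assms], of t] by simp
  qed simp
  then show ?thesis
    by (simp add: fhat_def norm_mult)
qed

text \<open>For \<open>k \<noteq> 0\<close> the derivative of order \<open>N\<close> multiplies the
  coefficient by a factor of modulus \<open>(\<pi> \<bar>k\<bar>) ^ N \<ge> wt k ^ N\<close>. At
  \<open>k = 0\<close> differentiation gives nothing and the term \<open>j = 0\<close> of the sum
  takes over.\<close>

lemma fhat_decay:
  assumes "\<phi> \<in> test_functions" "N \<ge> 1"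
  shows "wt k ^ N * norm (fhat k \<phi>) \<le> (\<Sum>j\<le>N. SUP x. norm ((fderiv ^^ j) \<phi> x))"
proof (cases "k = 0")
  case True
  have "norm (fhat k \<phi>) \<le> (SUP x. norm ((fderiv ^^ 0) \<phi> x))"
    using norm_fhat_le[OF assms(1)] by simp
  also have "\<dots> \<le> (\<Sum>j\<le>N. SUP x. norm ((fderiv ^^ j) \<phi> x))"
    by (rule member_le_sum)
      (auto intro!: cSUP_upper2 test_bdd fderiv_funpow_test assms)
  finally show ?thesis
    using True by (simp add: wt_def)
next
  case False
  then have "wt k \<le> 2 * \<bar>of_int k\<bar>"
    by (simp add: wt_def)
  also have "\<dots> \<le> pi * \<bar>of_int k\<bar>"
    using pi_ge_two by (intro mult_right_mono) auto
  finally have "wt k ^ N * norm (fhat k \<phi>) \<le> (pi * \<bar>of_int k\<bar>) ^ N * norm (fhat k \<phi>)"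
    by (intro mult_right_mono power_mono) auto
  also have "\<dots> = norm (fhat k ((fderiv ^^ N) \<phi>))"
    unfolding fhat_funpow_deriv[OF assms(1)] by (simp add: norm_mult norm_power mult_ac)
  also have "\<dots> \<le> (SUP x. norm ((fderiv ^^ N) \<phi> x))"
    by (intro norm_fhat_le fderiv_funpow_test assms)
  also have "\<dots> \<le> (\<Sum>j\<le>N. SUP x. norm ((fderiv ^^ j) \<phi> x))"
    by (rule member_le_sum)
      (auto intro!: cSUP_upper2 test_bdd fderiv_funpow_test assms)
  finally show ?thesis .
qed

text \<open>\<open>fhat\<close> pairs without conjugation, whence the condition
  \<open>k + j = 0\<close>. The constant function has derivative 0, so \<open>fhat_deriv\<close>
  forces its coefficients at nonzero frequencies to vanish.\<close>

lemma fhat_fexp: "fhat k (fexp j) = (if k + j = 0 then 1 else 0)"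
proof (cases "k + j = 0")
  case True
  then have "(\<lambda>x. fexp k x * fexp j x) = (\<lambda>x. 1)"
    unfolding fexp_add by (simp add: fexp_def)
  then show ?thesis
    using True by (simp add: fhat_def content_real scaleR_conv_of_real)
next
  case False
  have e: "fhat k (fexp j) = fhat (k + j) (fexp 0)"
    by (simp add: fhat_def fexp_add)
  have "fderiv (fexp 0) = (\<lambda>x. 0)"
    using fderiv_fexp[of 1 0] by simp
  then have "fhat (k + j) (fderiv (fexp 0)) = 0"
    by (simp add: fhat_def)
  then have "(\<i> * of_int (k + j) * of_real pi) * fhat (k + j) (fexp 0) = 0"
    using fhat_deriv[OF fexp_test, of "k + j" 0] by simp
  then show ?thesis
    using False e by (auto simp: complex_eq_iff)
qed

lemma fcoeff_fourier_series [simp]: "fcoeff (fourier_series c) k = c k"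
  unfolding fcoeff_eq fourier_series_eq fhat_fexp
  by (simp add: infsum_single[of k])

lemma fcoeff_fourier_series_fun: "fcoeff (fourier_series c) = c"
  by (rule ext) simp

text \<open>The coefficient sequences of the elements of some \<open>Hper s\<close>. For other
  sequences a divergent sum in \<open>fourier_series\<close> takes the default 0, and additivity can
  fail.\<close>

definition slow :: "(int \<Rightarrow> complex) \<Rightarrow> bool" where
  "slow c \<longleftrightarrow> (\<exists>s. (\<lambda>k. wt k powr (2 * s) * (norm (c k))\<^sup>2) summable_on UNIV)"

lemma weighted_summable_slow:
  assumes "(\<lambda>k. wt k powr (2 * s) * (norm (c k))\<^sup>2) summable_on UNIV"
  obtains N :: nat where "N \<ge> 1" "(\<lambda>k. norm (c k) / wt k ^ N) summable_on UNIV"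
proof
  \<comment> \<open>\<open>N \<ge> 1 + \<bar>s\<bar>\<close> gives \<open>- N - s \<le> -1\<close>,
    so the second factor of the Cauchy-Schwarz inequality below is square summable.\<close>
  define N where "N = Suc (nat \<lceil>\<bar>s\<bar>\<rceil>)"
  have N: "real N \<ge> 1 + \<bar>s\<bar>"
    unfolding N_def by linarith
  show "N \<ge> 1"
    by (simp add: N_def)
  have 1: "(\<lambda>k. (wt k powr s * norm (c k))\<^sup>2) summable_on UNIV"
    using assms by (simp add: power_mult_distrib powr_power mult.commute)
  have 2: "(\<lambda>k. (wt k powr (- real N - s))\<^sup>2) summable_on UNIV"
  proof (rule summable_on_comparison_test[OF summable_on_wt[of 1]])
    fix k
    have "(wt k powr (- real N - s))\<^sup>2 = wt k powr (2 * (- real N - s))"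
      by (simp add: powr_power mult.commute)
    also have "\<dots> \<le> wt k powr (- 2)"
      using N by (intro powr_mono) auto
    also have "\<dots> = 1 / wt k ^ (2 * 1)"
      by (simp add: powr_minus_divide)
    finally show "(wt k powr (- real N - s))\<^sup>2 \<le> 1 / wt k ^ (2 * 1)" .
  qed auto
  have e: "wt k powr s * norm (c k) * wt k powr (- real N - s) = norm (c k) / wt k ^ N" for k
  proof -
    have "wt k powr s * wt k powr (- real N - s) = wt k powr (- real N)"
      by (simp flip: powr_add)
    also have "\<dots> = 1 / wt k ^ N"
      by (simp add: powr_minus_divide powr_realpow)
    finally have "wt k powr s * wt k powr (- real N - s) = 1 / wt k ^ N" .
    then show ?thesis
      by (metis mult.assoc mult.commute times_divide_eq_right mult.right_neutral)
  qed
  show "(\<lambda>k. norm (c k) / wt k ^ N) summable_on UNIV"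
    using infsum_Cauchy_Schwarz(1)[OF 1 2] unfolding e .
qed

lemma fhat_summable_bound:
  assumes c: "(\<lambda>k. norm (c k) / wt k ^ N) summable_on UNIV" and N: "N \<ge> 1"
    and \<phi>: "\<phi> \<in> test_functions"
  shows "(\<lambda>k. c k * fhat k \<phi>) abs_summable_on UNIV"
    and "norm (\<Sum>\<^sub>\<infinity>k. c k * fhat k \<phi>) \<le>
      (\<Sum>\<^sub>\<infinity>k. norm (c k) / wt k ^ N) * (\<Sum>j\<le>N. SUP x. norm ((fderiv ^^ j) \<phi> x))"
proof -
  let ?S = "\<Sum>j\<le>N. SUP x. norm ((fderiv ^^ j) \<phi> x)"
  have le: "norm (c k * fhat k \<phi>) \<le> norm (c k) / wt k ^ N * ?S" for k
  proof -
    have "norm (c k * fhat k \<phi>) = norm (c k) / wt k ^ N * (wt k ^ N * norm (fhat k \<phi>))"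
      by (simp add: norm_mult)
    also have "\<dots> \<le> norm (c k) / wt k ^ N * ?S"
      by (intro mult_left_mono fhat_decay \<phi> N) auto
    finally show ?thesis .
  qed
  have s: "(\<lambda>k. norm (c k) / wt k ^ N * ?S) summable_on UNIV"
    by (intro summable_on_cmult_left c)
  show abs: "(\<lambda>k. c k * fhat k \<phi>) abs_summable_on UNIV"
    by (rule summable_on_comparison_test[OF s le]) auto
  have "norm (\<Sum>\<^sub>\<infinity>k. c k * fhat k \<phi>) \<le> (\<Sum>\<^sub>\<infinity>k. norm (c k * fhat k \<phi>))"
    by (rule norm_infsum_bound[OF abs])
  also have "\<dots> \<le> (\<Sum>\<^sub>\<infinity>k. norm (c k) / wt k ^ N * ?S)"
    by (intro infsum_mono abs s le)
  also have "\<dots> = (\<Sum>\<^sub>\<infinity>k. norm (c k) / wt k ^ N) * ?S"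
    by (rule infsum_cmult_left')
  finally show "norm (\<Sum>\<^sub>\<infinity>k. c k * fhat k \<phi>) \<le> (\<Sum>\<^sub>\<infinity>k. norm (c k) / wt k ^ N) * ?S" .
qed

lemma slow_summable:
  assumes "slow c" "\<phi> \<in> test_functions"
  shows "(\<lambda>k. c k * fhat k \<phi>) summable_on UNIV"
proof -
  obtain s where "(\<lambda>k. wt k powr (2 * s) * (norm (c k))\<^sup>2) summable_on UNIV"
    using assms by (auto simp: slow_def)
  then obtain N where "N \<ge> 1" "(\<lambda>k. norm (c k) / wt k ^ N) summable_on UNIV"
    by (rule weighted_summable_slow)
  then show ?thesis
    using abs_summable_summable[OF fhat_summable_bound(1)] assms(2) by blast
qed

lemma fhat_add:
  assumes "\<phi> \<in> test_functions" "\<psi> \<in> test_functions"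
  shows "fhat k (\<lambda>x. \<phi> x + \<psi> x) = fhat k \<phi> + fhat k \<psi>"
proof -
  have "(\<lambda>x. fexp k x * \<eta> x) integrable_on {-1..1}" if "\<eta> \<in> test_functions" for \<eta>
    by (intro integrable_continuous_interval continuous_on_mult test_continuous fexp_test that)
  from integral_add[OF this[OF assms(1)] this[OF assms(2)]] show ?thesis
    by (simp add: fhat_def distrib_left)
qed

lemma fhat_scale: "fhat k (\<lambda>x. c * \<phi> x) = c * fhat k \<phi>"
  by (simp add: fhat_def mult.left_commute[of _ c])

lemma fderiv_funpow_add:
  assumes "\<phi> \<in> test_functions" "\<psi> \<in> test_functions"
  shows "(fderiv ^^ j) (\<lambda>x. \<phi> x + \<psi> x) = (\<lambda>x. (fderiv ^^ j) \<phi> x + (fderiv ^^ j) \<psi> x)"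
proof (induction j)
  case (Suc j)
  have "fderiv (\<lambda>x. (fderiv ^^ j) \<phi> x + (fderiv ^^ j) \<psi> x) =
      (\<lambda>x. fderiv ((fderiv ^^ j) \<phi>) x + fderiv ((fderiv ^^ j) \<psi>) x)"
    by (rule ext, subst fderiv_def)
      (intro vector_derivative_at has_vector_derivative_add test_has_derivative fderiv_funpow_test assms)
  then show ?case
    using Suc by simp
qed simp

lemma fderiv_funpow_scale:
  assumes "\<phi> \<in> test_functions"
  shows "(fderiv ^^ j) (\<lambda>x. c * \<phi> x) = (\<lambda>x. c * (fderiv ^^ j) \<phi> x)"
proof (induction j)
  case (Suc j)
  have "fderiv (\<lambda>x. c * (fderiv ^^ j) \<phi> x) = (\<lambda>x. c * fderiv ((fderiv ^^ j) \<phi>) x)"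
    by (rule ext, subst fderiv_def)
      (intro vector_derivative_at has_vector_derivative_mult_right test_has_derivative
        fderiv_funpow_test assms)
  then show ?case
    using Suc by simp
qed simp

lemma test_add:
  assumes "\<phi> \<in> test_functions" "\<psi> \<in> test_functions"
  shows "(\<lambda>x. \<phi> x + \<psi> x) \<in> test_functions"
proof -
  have "(\<lambda>x. (fderiv ^^ j) \<phi> x + (fderiv ^^ j) \<psi> x) differentiable at x" for j x
    using assms by (intro differentiable_add) (auto simp: test_functions_def)
  then show ?thesis
    unfolding test_functions_def fderiv_funpow_add[OF assms] mem_Collect_eq
    using assms by (auto simp: test_functions_def fderiv_funpow_add[OF assms])
qed

lemma test_scale:
  assumes "\<phi> \<in> test_functions"
  shows "(\<lambda>x. c * \<phi> x) \<in> test_functions"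
proof -
  have "(\<lambda>x. c * (fderiv ^^ j) \<phi> x) differentiable at x" for j x
    using assms by (intro differentiable_mult differentiable_const) (auto simp: test_functions_def)
  then show ?thesis
    using assms by (auto simp: test_functions_def fderiv_funpow_scale[OF assms])
qed

text \<open>Together with \<open>HperD\<close> this identifies \<open>Hper s\<close> with a weighted
  sequence space. Continuity as a distribution comes from playing the decay of \<open>fhat\<close>
  against the polynomial growth of \<open>c\<close>.\<close>

lemma fourier_series_Hper:
  assumes c: "(\<lambda>k. wt k powr (2 * s) * (norm (c k))\<^sup>2) summable_on UNIV"
  shows "fourier_series c \<in> Hper s"
proof -
  have sl: "slow c"
    using c by (auto simp: slow_def)
  have "fourier_series c \<in> periodic_distributions"
    unfolding periodic_distributions_def
  proof (intro CollectI conjI ballI allI impI)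
    fix \<phi> \<psi> assume "\<phi> \<in> test_functions" "\<psi> \<in> test_functions"
    then show "fourier_series c (\<lambda>x. \<phi> x + \<psi> x) = fourier_series c \<phi> + fourier_series c \<psi>"
      by (simp add: fourier_series_eq test_add fhat_add distrib_left infsum_add slow_summable sl)
  next
    fix z \<phi> assume "\<phi> \<in> test_functions"
    moreover have "(\<Sum>\<^sub>\<infinity>k. c k * fhat k (\<lambda>x. z * \<phi> x)) = (\<Sum>\<^sub>\<infinity>k. z * (c k * fhat k \<phi>))"
      by (intro infsum_cong) (simp add: fhat_scale)
    ultimately show "fourier_series c (\<lambda>x. z * \<phi> x) = z * fourier_series c \<phi>"
      by (simp add: fourier_series_eq test_scale infsum_cmult_right')
  next
    obtain N where "N \<ge> 1" "(\<lambda>k. norm (c k) / wt k ^ N) summable_on UNIV"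
      using weighted_summable_slow[OF c] .
    then show "\<exists>N C. \<forall>\<phi>\<in>test_functions.
        norm (fourier_series c \<phi>) \<le> C * (\<Sum>j\<le>N. SUP x. norm ((fderiv ^^ j) \<phi> x))"
      by (intro exI[of _ N] exI[of _ "\<Sum>\<^sub>\<infinity>k. norm (c k) / wt k ^ N"])
        (auto simp: fourier_series_eq intro: fhat_summable_bound)
  qed (simp add: fourier_series_eq)
  then show ?thesis
    using c unfolding Hper_def mem_Collect_eq fcoeff_fourier_series by (auto simp: wt_def fcoeff_fourier_series_fun)
qed

lemma HperD:
  assumes "f \<in> Hper s"
  shows "f = fourier_series (fcoeff f)"
    and "(\<lambda>k. wt k powr (2 * s) * (norm (fcoeff f k))\<^sup>2) summable_on UNIV"
  using assms by (auto simp: Hper_def wt_def)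

section \<open>The operations of \<open>L\<^sub>m\<close> on Fourier series\<close>

lemma dist_deriv_fourier_series:
  "dist_deriv (fourier_series c) = fourier_series (\<lambda>k. \<i> * of_int k * of_real pi * c k)"
proof
  fix \<phi>
  show "dist_deriv (fourier_series c) \<phi> = fourier_series (\<lambda>k. \<i> * of_int k * of_real pi * c k) \<phi>"
  proof (cases "\<phi> \<in> test_functions")
    case True
    then show ?thesis
      by (simp add: dist_deriv_def fourier_series_eq fhat_deriv mult_ac flip: infsum_uminus)
  qed (simp add: dist_deriv_def fourier_series_eq)
qed

lemma dist_deriv_funpow_fourier_series:
  "(dist_deriv ^^ n) (fourier_series c) = fourier_series (\<lambda>k. (\<i> * of_int k * of_real pi) ^ n * c k)"
  by (induction n) (simp_all add: dist_deriv_fourier_series mult.assoc)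

lemma dist_scale_fourier_series:
  "dist_scale z (fourier_series c) = fourier_series (\<lambda>k. z * c k)"
  unfolding dist_scale_def fourier_series_eq fun_eq_iff mult.assoc infsum_cmult_right' by simp

lemma fourier_series_add:
  assumes "slow a" "slow b"
  shows "fourier_series a + fourier_series b = fourier_series (\<lambda>k. a k + b k)"
proof
  fix \<phi>
  show "(fourier_series a + fourier_series b) \<phi> = fourier_series (\<lambda>k. a k + b k) \<phi>"
    by (simp add: fourier_series_eq distrib_right infsum_add slow_summable assms)
qed

lemma fcoeff_simps [simp]:
  "fcoeff (f + g) k = fcoeff f k + fcoeff g k"
  "fcoeff (f - g) k = fcoeff f k - fcoeff g k"
  "fcoeff (dist_scale z f) k = z * fcoeff f k"
  "fcoeff 0 k = 0"
  by (auto simp: fcoeff_eq dist_scale_def)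

lemma even_power_symbol:
  "(- 1) ^ m * (\<i> * of_int k * of_real pi) ^ (2 * m) = (of_real ((pi * of_int k) ^ (2 * m)) :: complex)"
proof -
  have "(\<i> * of_int k * of_real pi) ^ (2 * m) = (\<i> * of_real (pi * of_int k)) ^ (2 * m)"
    by (simp add: mult_ac)
  also have "\<dots> = (\<i> ^ 2) ^ m * of_real ((pi * of_int k) ^ (2 * m))"
    by (simp only: power_mult_distrib[of \<i>] power_mult[of \<i>] of_real_power)
  finally have "(- 1) ^ m * (\<i> * of_int k * of_real pi) ^ (2 * m) =
      ((- 1) ^ m * (- 1) ^ m) * (of_real ((pi * of_int k) ^ (2 * m)) :: complex)"
    by (simp only: power2_i mult.assoc)
  also have "(- 1) ^ m * (- 1) ^ m = (1 :: complex)"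
    by (induction m) auto
  finally show ?thesis
    by simp
qed

text \<open>The two summands stay apart, since merging them into one series requires both
  coefficient sequences to be \<open>slow\<close>.\<close>

lemma Lop_fourier_series:
  "Lop m V (fourier_series c) =
    fourier_series (\<lambda>k. of_real ((pi * of_int k) ^ (2 * m)) * c k) +
    fourier_series (\<lambda>k. \<Sum>\<^sub>\<infinity>j. fcoeff V (k - j) * c j)"
proof -
  have e: "(- 1) ^ m * ((\<i> * of_int k * of_real pi) ^ (2 * m) * c k) = of_real ((pi * of_int k) ^ (2 * m)) * c k" for k
    unfolding mult.assoc[symmetric] even_power_symbol ..
  show ?thesis
    unfolding Lop_def dist_deriv_funpow_fourier_series dist_scale_fourier_series dist_mult_def e
      fcoeff_fourier_series ..
qed

section \<open>The variational principle\<close>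

lemma summable_tail:
  fixes f :: "'a \<Rightarrow> real"
  assumes "f summable_on UNIV" "e > 0"
  obtains F where "finite F" "infsum f (- F) \<le> e"
proof -
  obtain F where F: "finite F" "norm (sum f F - infsum f UNIV) \<le> e"
    using infsum_finite_approximation[OF assms] by (auto simp: dist_norm)
  have "infsum f (F \<union> - F) = infsum f F + infsum f (- F)"
    by (intro infsum_Un_disjoint) (use assms(1) F in \<open>auto intro: summable_on_subset_banach\<close>)
  then have "infsum f (- F) \<le> e"
    using F by (simp add: infsum_finite)
  with F(1) show ?thesis
    by (rule that)
qed

text \<open>Uniformly small tails replace a dominating function; on the finite remainder pointwise
  convergence is enough. For sequences bounded in \<open>X\<close> such tail bounds come from the
  weights.\<close>

lemma infsum_tendsto_0:
  fixes P :: "nat \<Rightarrow> 'a \<Rightarrow> real"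
  assumes s: "\<And>n. P n summable_on UNIV" and nn: "\<And>n k. 0 \<le> P n k"
    and lim: "\<And>k. (\<lambda>n. P n k) \<longlonglongrightarrow> 0"
    and tail: "\<And>e. e > 0 \<Longrightarrow> \<exists>F. finite F \<and> (\<forall>n. infsum (P n) (- F) \<le> e)"
  shows "(\<lambda>n. infsum (P n) UNIV) \<longlonglongrightarrow> 0"
proof (rule LIMSEQ_I)
  fix r :: real assume r: "r > 0"
  then obtain F where F: "finite F" "\<And>n. infsum (P n) (- F) \<le> r / 2"
    using tail[of "r / 2"] by auto
  have "(\<lambda>n. \<Sum>k\<in>F. P n k) \<longlonglongrightarrow> (\<Sum>k\<in>F. 0)"
    by (intro tendsto_sum lim)
  then obtain N where N: "norm ((\<Sum>k\<in>F. P n k) - 0) < r / 2" if "n \<ge> N" for n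
    using r LIMSEQ_D[of "\<lambda>n. \<Sum>k\<in>F. P n k" 0 "r / 2"] by auto
  have "norm (infsum (P n) UNIV - 0) < r" if "n \<ge> N" for n
  proof -
    have "infsum (P n) (F \<union> - F) = infsum (P n) F + infsum (P n) (- F)"
      by (intro infsum_Un_disjoint) (use s F in \<open>auto intro: summable_on_subset_banach\<close>)
    then have "infsum (P n) UNIV \<le> (\<Sum>k\<in>F. P n k) + r / 2"
      using F by simp
    moreover have "infsum (P n) UNIV \<ge> 0"
      using nn by (intro infsum_nonneg) auto
    ultimately show ?thesis
      using N[OF that] by simp
  qed
  then show "\<exists>N. \<forall>n\<ge>N. norm (infsum (P n) UNIV - 0) < r"
    by blast
qed

text \<open>Tychonoff for a product of closed discs; the index type is countable, so compactness of
  the product yields convergent subsequences.\<close>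

lemma bounded_pointwise_subsequence:
  fixes f :: "nat \<Rightarrow> int \<Rightarrow> complex"
  assumes "\<And>n k. norm (f n k) \<le> B"
  obtains g r where "strict_mono r" "\<And>k. (\<lambda>n. f (r n) k) \<longlonglongrightarrow> g k"
proof -
  have "compactin (product_topology (\<lambda>_. euclidean) UNIV) (Pi\<^sub>E UNIV (\<lambda>_ :: int. cball (0 :: complex) B))"
    by (subst compactin_PiE) (auto simp: compactin_euclidean_iff)
  then have "compact (Pi UNIV (\<lambda>_ :: int. cball (0 :: complex) B))"
    by (simp add: euclidean_product_topology compactin_euclidean_iff PiE_UNIV_domain)
  then have "seq_compact (Pi UNIV (\<lambda>_ :: int. cball (0 :: complex) B))"
    by (rule compact_imp_seq_compact)
  moreover have "\<forall>n. f n \<in> Pi UNIV (\<lambda>_ :: int. cball (0 :: complex) B)"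
    using assms by auto
  ultimately obtain g r where g: "strict_mono r" "(f \<circ> r) \<longlonglongrightarrow> g"
    unfolding seq_compact_def by blast
  have "(\<lambda>n. (f \<circ> r) n k) \<longlonglongrightarrow> g k" for k
    by (rule continuous_on_tendsto_compose[OF continuous_on_product_coordinates[of k] g(2)]) auto
  then show ?thesis
    using that[OF g(1), of g] by (simp add: o_def)
qed

context hill_form
begin

lemma Q_lin_left:
  assumes "f \<in> X" "g \<in> X" "h \<in> X"
  shows "Q (\<lambda>k. a * f k + b * g k) h = a * Q f h + b * Q g h"
  using Q_sum_left[of UNIV "\<lambda>i. if i then f else g" h "\<lambda>i. if i then a else b"] assms
  by (simp add: UNIV_bool add.commute)

lemma ip_lin_left:
  assumes "f \<in> X" "g \<in> X" "h \<in> X"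
  shows "ip (\<lambda>k. a * f k + b * g k) h = a * ip f h + b * ip g h"
  using ip_sum_left[of UNIV "\<lambda>i. if i then f else g" h "\<lambda>i. if i then a else b"] assms
  by (simp add: UNIV_bool add.commute)

lemma X_lin: "f \<in> X \<Longrightarrow> g \<in> X \<Longrightarrow> (\<lambda>k. a * f k + b * g k) \<in> X"
  using X_add[OF X_scale X_scale] by blast

lemma Q_expand:
  assumes "f \<in> X" "g \<in> X"
  shows "Re (Q (\<lambda>k. f k + s * g k) (\<lambda>k. f k + s * g k)) =
    Re (Q f f) + 2 * Re (cnj s * Q f g) + (cmod s)\<^sup>2 * Re (Q g g)"
proof -
  let ?h = "\<lambda>k. 1 * f k + s * g k"
  have h: "?h \<in> X"
    by (rule X_lin[OF assms])
  have r: "Q f' ?h = Q f' f + cnj s * Q f' g" if "f' \<in> X" for f'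
    using Q_cnj[OF h that] Q_lin_left[OF assms that, of 1 s] Q_cnj[OF that assms(1)] Q_cnj[OF that assms(2)]
    by (simp add: Q_cnj[OF h that])
  have "Q ?h ?h = Q f f + cnj s * Q f g + s * (Q g f + cnj s * Q g g)"
    unfolding Q_lin_left[OF assms h] r[OF assms(1)] r[OF assms(2)] by simp
  moreover have "s * Q g f = cnj (cnj s * Q f g)"
    using Q_cnj[OF assms] by simp
  moreover have "s * (cnj s * Q g g) = of_real ((cmod s)\<^sup>2 * Re (Q g g))"
    using Q_self_real[OF assms(2)] complex_norm_square[of s] by (simp add: mult.assoc[symmetric])
  ultimately show ?thesis
    by (simp add: distrib_left del: of_real_mult)
qed

lemma nrm2_expand:
  assumes "f \<in> X" "g \<in> X"
  shows "nrm2 (\<lambda>k. f k + s * g k) = nrm2 f + 2 * Re (cnj s * ip f g) + (cmod s)\<^sup>2 * nrm2 g"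
proof -
  let ?h = "\<lambda>k. 1 * f k + s * g k"
  have h: "?h \<in> X"
    by (rule X_lin[OF assms])
  have r: "ip f' ?h = ip f' f + cnj s * ip f' g" if "f' \<in> X" for f'
    using ip_cnj[of f' ?h] ip_lin_left[OF assms that, of 1 s] ip_cnj[of f f'] ip_cnj[of g f']
    by simp
  have "ip ?h ?h = ip f f + cnj s * ip f g + s * (ip g f + cnj s * ip g g)"
    unfolding ip_lin_left[OF assms h] r[OF assms(1)] r[OF assms(2)] by simp
  moreover have "s * ip g f = cnj (cnj s * ip f g)"
    using ip_cnj[of g f] by simp
  moreover have "s * (cnj s * ip g g) = of_real ((cmod s)\<^sup>2 * nrm2 g)"
    using ip_self[OF X_l2[OF assms(2)]] complex_norm_square[of s] by (simp add: mult.assoc[symmetric])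
  ultimately have "complex_of_real (nrm2 ?h) = of_real (nrm2 f) + cnj s * ip f g + cnj (cnj s * ip f g) +
      of_real ((cmod s)\<^sup>2 * nrm2 g)"
    unfolding ip_self[OF X_l2[OF h], symmetric] ip_self[OF X_l2[OF assms(1)], symmetric]
    by (simp add: distrib_left)
  then have "Re (complex_of_real (nrm2 ?h)) = Re (of_real (nrm2 f) + cnj s * ip f g + cnj (cnj s * ip f g) +
      of_real ((cmod s)\<^sup>2 * nrm2 g))"
    by (rule arg_cong)
  then show ?thesis
    by simp
qed

section \<open>Compactness in the form domain and existence of minimizers\<close>

lemma NX_diff_le:
  assumes "f \<in> X" "g \<in> X"
  shows "NX (\<lambda>k. f k - g k) \<le> 2 * NX f + 2 * NX g"
proof -
  have "NX (\<lambda>k. f k - g k) \<le>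
      (\<Sum>\<^sub>\<infinity>k. 2 * (wt k ^ (2 * m) * (cmod (f k))\<^sup>2) + 2 * (wt k ^ (2 * m) * (cmod (g k))\<^sup>2))"
    unfolding NX_def
  proof (rule infsum_mono)
    show "(\<lambda>k. wt k ^ (2 * m) * (cmod (f k - g k))\<^sup>2) summable_on UNIV"
      by (rule XD[OF X_diff[OF assms]])
    show "(\<lambda>k. 2 * (wt k ^ (2 * m) * (cmod (f k))\<^sup>2) + 2 * (wt k ^ (2 * m) * (cmod (g k))\<^sup>2)) summable_on UNIV"
      by (intro summable_on_add summable_on_cmult_right XD assms)
    fix k
    have "(cmod (f k - g k))\<^sup>2 \<le> 2 * (cmod (f k))\<^sup>2 + 2 * (cmod (g k))\<^sup>2"
      using norm_add_square_le[of "f k" "- g k"] by simp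
    then have "wt k ^ (2 * m) * (cmod (f k - g k))\<^sup>2 \<le>
        wt k ^ (2 * m) * (2 * (cmod (f k))\<^sup>2 + 2 * (cmod (g k))\<^sup>2)"
      by (intro mult_left_mono) auto
    then show "wt k ^ (2 * m) * (cmod (f k - g k))\<^sup>2 \<le>
        2 * (wt k ^ (2 * m) * (cmod (f k))\<^sup>2) + 2 * (wt k ^ (2 * m) * (cmod (g k))\<^sup>2)"
      by (simp add: algebra_simps)
  qed
  also have "\<dots> = 2 * NX f + 2 * NX g"
    unfolding NX_def
    by (subst infsum_add) (auto intro!: summable_on_cmult_right XD assms simp: infsum_cmult_right')
  finally show ?thesis .
qed

lemma pointwise_le_NX:
  assumes "f \<in> X"
  shows "wt k ^ (2 * m) * (cmod (f k))\<^sup>2 \<le> NX f" "(cmod (f k))\<^sup>2 \<le> NX f"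
proof -
  show 1: "wt k ^ (2 * m) * (cmod (f k))\<^sup>2 \<le> NX f"
    unfolding NX_def using finite_sum_le_infsum[OF XD[OF assms], of "{k}"] by auto
  have "1 \<le> wt k ^ (2 * m)"
    by (rule one_le_wt_power)
  then have "(cmod (f k))\<^sup>2 \<le> wt k ^ (2 * m) * (cmod (f k))\<^sup>2"
    by (simp add: mult_le_cancel_right1)
  with 1 show "(cmod (f k))\<^sup>2 \<le> NX f"
    by linarith
qed

text \<open>Weak compactness of balls in \<open>X\<close>, in terms of coordinates. Passing to the
  limit in finite partial sums keeps \<open>g\<close> in the same ball.\<close>

lemma NX_bounded_subsequence:
  fixes f :: "nat \<Rightarrow> int \<Rightarrow> complex"
  assumes f: "\<And>n. f n \<in> X" "\<And>n. NX (f n) \<le> B"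
  obtains g r where "strict_mono r" "\<And>k. (\<lambda>n. f (r n) k) \<longlonglongrightarrow> g k" "g \<in> X" "NX g \<le> B"
proof -
  have bnd: "cmod (f n k) \<le> sqrt B" for n k
    using pointwise_le_NX(2)[OF f(1)] f(2) by (intro real_le_rsqrt) (meson order.trans)
  obtain g r where g: "strict_mono r" "\<And>k. (\<lambda>n. f (r n) k) \<longlonglongrightarrow> g k"
    by (rule bounded_pointwise_subsequence[of f, OF bnd]) blast
  have fin: "(\<Sum>k\<in>F. wt k ^ (2 * m) * (cmod (g k))\<^sup>2) \<le> B" if "finite F" for F
  proof (rule LIMSEQ_le_const2)
    show "(\<lambda>n. \<Sum>k\<in>F. wt k ^ (2 * m) * (cmod (f (r n) k))\<^sup>2) \<longlonglongrightarrow>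
        (\<Sum>k\<in>F. wt k ^ (2 * m) * (cmod (g k))\<^sup>2)"
      by (intro tendsto_intros g)
    have "(\<Sum>k\<in>F. wt k ^ (2 * m) * (cmod (f (r n) k))\<^sup>2) \<le> B" for n
      using finite_sum_le_infsum[OF XD[OF f(1)] that, of "r n"] f(2)[of "r n"]
      unfolding NX_def by (auto intro: order.trans)
    then show "\<exists>N. \<forall>n\<ge>N. (\<Sum>k\<in>F. wt k ^ (2 * m) * (cmod (f (r n) k))\<^sup>2) \<le> B"
      by blast
  qed
  have "g \<in> X"
    unfolding X_def mem_Collect_eq
    by (rule nonneg_bdd_above_summable_on) (auto intro!: bdd_aboveI2 fin)
  moreover from this have "NX g \<le> B"
    unfolding NX_def by (intro infsum_le_finite_sums XD) (auto intro: fin)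
  ultimately show ?thesis
    using that g by blast
qed

text \<open>A bounded sequence in \<open>X\<close> with vanishing coordinates tends to 0 weakly,
  hence against every element of the dual, and strongly in the square-summable norm because that
  embedding is compact: \<open>(cmod (h n k))\<^sup>2\<close> is at most
  \<open>B / wt k ^ (2 m)\<close>, a summable bound uniform in \<open>n\<close>.\<close>

lemma
  assumes h: "\<And>n. h n \<in> X" "\<And>n. NX (h n) \<le> B" and lim: "\<And>k. (\<lambda>n. h n k) \<longlonglongrightarrow> 0"
  shows nrm2_tendsto_0: "(\<lambda>n. nrm2 (h n)) \<longlonglongrightarrow> 0"
    and dual_pairing_tendsto_0: "(\<lambda>k. (cmod (a k))\<^sup>2 / wt k ^ (2 * m)) summable_on UNIV \<Longrightarrow>
      (\<lambda>n. ip a (h n)) \<longlonglongrightarrow> 0"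
proof -
  have B: "0 \<le> B"
    using NX_nonneg h(2) order.trans by blast
  have sub: "(\<Sum>\<^sub>\<infinity>k\<in>S. wt k ^ (2 * m) * (cmod (h n k))\<^sup>2) \<le> B" for S n
    using infsum_mono2[OF summable_on_subset_banach[OF XD[OF h(1)]] XD[OF h(1)], of S n] h(2)[of n]
    unfolding NX_def by force
  show "(\<lambda>n. nrm2 (h n)) \<longlonglongrightarrow> 0"
    unfolding nrm2_def
  proof (rule infsum_tendsto_0)
    show "(\<lambda>n. (cmod (h n k))\<^sup>2) \<longlonglongrightarrow> 0" for k
      using tendsto_power[OF tendsto_norm[OF lim[of k]], of 2] by simp
    fix e :: real assume "e > 0"
    \<comment> \<open>The divisor is \<open>B + 1\<close> because \<open>B\<close> may be 0.\<close>
    then obtain F where F: "finite F" "infsum (\<lambda>k. 1 / wt k ^ (2 * m)) (- F) \<le> e / (B + 1)"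
      using summable_tail[OF summable_on_wt[OF m_ge_1], of "e / (B + 1)"] B by auto
    have "(\<Sum>\<^sub>\<infinity>k\<in>- F. (cmod (h n k))\<^sup>2) \<le> e" for n
    proof -
      have "(\<Sum>\<^sub>\<infinity>k\<in>- F. (cmod (h n k))\<^sup>2) \<le> (\<Sum>\<^sub>\<infinity>k\<in>- F. B * (1 / wt k ^ (2 * m)))"
      proof (rule infsum_mono)
        show "(\<lambda>k. (cmod (h n k))\<^sup>2) summable_on - F"
          by (rule summable_on_subset_banach[OF X_l2[OF h(1)]]) auto
        show "(\<lambda>k. B * (1 / wt k ^ (2 * m))) summable_on - F"
          by (rule summable_on_subset_banach[OF summable_on_cmult_right[OF summable_on_wt[OF m_ge_1]]]) auto
        show "(cmod (h n k))\<^sup>2 \<le> B * (1 / wt k ^ (2 * m))" for k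
          using order.trans[OF pointwise_le_NX(1)[OF h(1), of k n] h(2)[of n]]
          by (simp add: field_simps)
      qed
      also have "\<dots> = B * infsum (\<lambda>k. 1 / wt k ^ (2 * m)) (- F)"
        by (rule infsum_cmult_right')
      also have "\<dots> \<le> (B + 1) * (e / (B + 1))"
        using F(2) B \<open>e > 0\<close> by (intro mult_mono) (auto intro!: infsum_nonneg)
      also have "\<dots> = e"
        using B by simp
      finally show ?thesis .
    qed
    then show "\<exists>F. finite F \<and> (\<forall>n. (\<Sum>\<^sub>\<infinity>k\<in>- F. (cmod (h n k))\<^sup>2) \<le> e)"
      using F(1) by blast
  qed (use X_l2 h in auto)
  assume a: "(\<lambda>k. (cmod (a k))\<^sup>2 / wt k ^ (2 * m)) summable_on UNIV"
  have abs: "(\<lambda>k. a k * cnj (h n k)) abs_summable_on S" for n S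
    by (rule weighted_product_abs_summable(1)[where R = "\<lambda>k. wt k ^ (2 * m)"])
      (use summable_on_subset_banach[OF a] summable_on_subset_banach[OF XD[OF h(1)]] in auto)
  have "(\<lambda>n. \<Sum>\<^sub>\<infinity>k. cmod (a k * cnj (h n k))) \<longlonglongrightarrow> 0"
  proof (rule infsum_tendsto_0)
    show "(\<lambda>n. cmod (a k * cnj (h n k))) \<longlonglongrightarrow> 0" for k
      using tendsto_mult_right_zero[OF tendsto_norm_zero[OF lim[of k]], of "cmod (a k)"]
      by (simp add: norm_mult)
    show "(\<lambda>k. cmod (a k * cnj (h n k))) summable_on UNIV" for n
      by (rule abs)
    fix e :: real assume "e > 0"
    then obtain F where F: "finite F" "infsum (\<lambda>k. (cmod (a k))\<^sup>2 / wt k ^ (2 * m)) (- F) \<le> e\<^sup>2 / (B + 1)"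
      using summable_tail[OF a, of "e\<^sup>2 / (B + 1)"] B by auto
    have "(\<Sum>\<^sub>\<infinity>k\<in>- F. cmod (a k * cnj (h n k))) \<le> e" for n
    proof (rule power2_le_imp_le)
      have "(\<Sum>\<^sub>\<infinity>k\<in>- F. cmod (a k * cnj (h n k)))\<^sup>2 \<le>
          infsum (\<lambda>k. (cmod (a k))\<^sup>2 / wt k ^ (2 * m)) (- F) *
          (\<Sum>\<^sub>\<infinity>k\<in>- F. wt k ^ (2 * m) * (cmod (cnj (h n k)))\<^sup>2)"
        by (rule weighted_product_abs_summable(2)[where R = "\<lambda>k. wt k ^ (2 * m)"])
          (use summable_on_subset_banach[OF a] summable_on_subset_banach[OF XD[OF h(1)]] in auto)
      also have "\<dots> \<le> e\<^sup>2 / (B + 1) * (B + 1)"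
        using F(2) sub[of n "- F"] B by (intro mult_mono) (auto intro!: infsum_nonneg)
      also have "\<dots> = e\<^sup>2"
        using B by simp
      finally show "(\<Sum>\<^sub>\<infinity>k\<in>- F. cmod (a k * cnj (h n k)))\<^sup>2 \<le> e\<^sup>2" .
    qed (use \<open>e > 0\<close> in simp)
    then show "\<exists>F. finite F \<and> (\<forall>n. (\<Sum>\<^sub>\<infinity>k\<in>- F. cmod (a k * cnj (h n k))) \<le> e)"
      using F(1) by blast
  qed auto
  then show "(\<lambda>n. ip a (h n)) \<longlonglongrightarrow> 0"
    by (rule Lim_null_comparison[rotated])
      (use norm_infsum_bound[OF abs] in \<open>auto simp: ip_def\<close>)
qed

lemma X_dual:
  assumes "f \<in> X"
  shows "(\<lambda>k. (cmod (f k))\<^sup>2 / wt k ^ (2 * m)) summable_on UNIV"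
proof (rule summable_on_comparison_test[OF X_l2[OF assms]])
  fix k
  have "1 \<le> wt k ^ (2 * m)"
    by (rule one_le_wt_power)
  then show "(cmod (f k))\<^sup>2 / wt k ^ (2 * m) \<le> (cmod (f k))\<^sup>2"
    by (simp add: divide_le_eq mult_le_cancel_left1)
qed auto

text \<open>The minimum is attained: along a pointwise convergent minimizing subsequence \<open>g + h\<^sub>n\<close> the cross
  terms vanish in the limit, and \<open>Q h\<^sub>n h\<^sub>n\<close> is asymptotically nonnegative by coercivity.\<close>

lemma minimizer_exists:
  assumes K: "finite K" "\<And>i. i \<in> K \<Longrightarrow> \<phi> i \<in> X"
    and f0: "f0 \<in> X" "\<And>i. i \<in> K \<Longrightarrow> ip f0 (\<phi> i) = 0" "nrm2 f0 > 0"
  obtains g where "g \<in> X" "\<forall>i\<in>K. ip g (\<phi> i) = 0" "nrm2 g = 1"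
    "\<forall>f\<in>X. (\<forall>i\<in>K. ip f (\<phi> i) = 0) \<longrightarrow> Re (Q g g) * nrm2 f \<le> Re (Q f f)"
proof -
  define M where "M = {f \<in> X. \<forall>i\<in>K. ip f (\<phi> i) = 0}"
  obtain C where C: "\<And>f. f \<in> X \<Longrightarrow> NX f \<le> 2 * Re (Q f f) + C * nrm2 f"
    using coercive by blast
  have scale: "(\<lambda>k. c * f k) \<in> M \<and> nrm2 (\<lambda>k. c * f k) = (cmod c)\<^sup>2 * nrm2 f \<and>
      Re (Q (\<lambda>k. c * f k) (\<lambda>k. c * f k)) = (cmod c)\<^sup>2 * Re (Q f f)" if "f \<in> M" for c f
  proof -
    have f: "f \<in> X"
      using that by (simp add: M_def)
    have z: "Q (\<lambda>_. 0) g = 0" "ip (\<lambda>_. 0) g = 0" "nrm2 (\<lambda>_. 0) = 0" for g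
      by (simp_all add: Q_def ip_def oper_def conv_def nrm2_def)
    show ?thesis
      using that X_scale[OF f, of c] nrm2_expand[OF X_zero f, of c] Q_expand[OF X_zero f, of c]
        ip_lin_left[OF f X_zero, of _ c 0] K
      by (auto simp: M_def z)
  qed
  define R where "R = {Re (Q f f) |f. f \<in> M \<and> nrm2 f = 1}"
  define \<nu> where "\<nu> = Inf R"
  have "f0 \<in> M"
    using f0 by (auto simp: M_def)
  then have "R \<noteq> {}"
    using scale[of f0 "of_real (1 / sqrt (nrm2 f0))"] f0(3)
    by (auto simp: R_def power_divide norm_divide norm_inverse)
  have bdd: "bdd_below R"
  proof (rule bdd_belowI)
    fix x assume "x \<in> R"
    then obtain f where "x = Re (Q f f)" "f \<in> M" "nrm2 f = 1"
      by (auto simp: R_def)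
    moreover from this have "NX f \<le> 2 * Re (Q f f) + C"
      using C[of f] by (simp add: M_def)
    ultimately show "- C / 2 \<le> x"
      using NX_nonneg[of f] by linarith
  qed
  have low: "\<nu> * nrm2 f \<le> Re (Q f f)" if "f \<in> M" for f
  proof (cases "nrm2 f = 0")
    case True
    then have "f = (\<lambda>_. 0)"
      using that by (intro nrm2_eq_0D X_l2) (auto simp: M_def)
    then show ?thesis
      by (simp add: Q_def ip_def nrm2_def)
  next
    case False
    then have p: "nrm2 f > 0"
      using nrm2_nonneg[of f] by linarith
    let ?c = "complex_of_real (1 / sqrt (nrm2 f))"
    have c: "(cmod ?c)\<^sup>2 = 1 / nrm2 f"
      using p by (simp add: norm_divide power_divide)
    have "Re (Q f f) / nrm2 f \<in> R"
      unfolding R_def mem_Collect_eq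
      by (rule exI[of _ "\<lambda>k. ?c * f k"]) (use scale[OF that, of ?c] p c in auto)
    then have "\<nu> \<le> Re (Q f f) / nrm2 f"
      unfolding \<nu>_def using bdd by (rule cInf_lower)
    then show ?thesis
      using p by (simp add: field_simps)
  qed
  have "\<exists>f. f \<in> M \<and> nrm2 f = 1 \<and> Re (Q f f) < \<nu> + 1 / real (Suc n)" for n
  proof -
    have "\<exists>x\<in>R. x < \<nu> + 1 / real (Suc n)"
      using cInf_lessD[OF \<open>R \<noteq> {}\<close>, of "\<nu> + 1 / real (Suc n)"] by (simp add: \<nu>_def)
    then show ?thesis
      by (auto simp: R_def)
  qed
  then obtain f where f: "\<And>n. f n \<in> M" "\<And>n. nrm2 (f n) = 1" "\<And>n. Re (Q (f n) (f n)) < \<nu> + 1 / real (Suc n)"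
    by metis
  have fX: "f n \<in> X" for n
    using f(1) by (simp add: M_def)
  define B where "B = 2 * (\<nu> + 1) + C"
  have NB: "NX (f n) \<le> B" for n
  proof -
    have "1 / real (Suc n) \<le> 1"
      by simp
    then have "Re (Q (f n) (f n)) \<le> \<nu> + 1"
      using f(3)[of n] by linarith
    moreover have "NX (f n) \<le> 2 * Re (Q (f n) (f n)) + C"
      using C[OF fX[of n]] f(2)[of n] by simp
    ultimately show ?thesis
      unfolding B_def by argo
  qed
  obtain g r where g: "strict_mono r" "\<And>k. (\<lambda>n. f (r n) k) \<longlonglongrightarrow> g k" "g \<in> X" "NX g \<le> B"
    by (rule NX_bounded_subsequence[of f, OF fX NB]) blast
  define h where "h n = (\<lambda>k. f (r n) k - g k)" for n
  have hX: "h n \<in> X" for n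
    unfolding h_def by (rule X_diff[OF fX g(3)])
  have hB: "NX (h n) \<le> 4 * B" for n
    using NX_diff_le[OF fX[of "r n"] g(3)] NB[of "r n"] g(4) by (simp add: h_def)
  have h0: "(\<lambda>n. h n k) \<longlonglongrightarrow> 0" for k
    unfolding h_def using g(2)[of k] by (rule LIM_zero)
  have fgh: "f (r n) = (\<lambda>k. g k + 1 * h n k)" for n
    by (simp add: h_def)
  have n0: "(\<lambda>n. nrm2 (h n)) \<longlonglongrightarrow> 0"
    by (rule nrm2_tendsto_0[OF hX hB h0])
  have d0: "(\<lambda>n. ip a (h n)) \<longlonglongrightarrow> 0" if "(\<lambda>k. (cmod (a k))\<^sup>2 / wt k ^ (2 * m)) summable_on UNIV" for a
    by (rule dual_pairing_tendsto_0[OF hX hB h0 that])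
  \<comment> \<open>No mass escapes in the limit: \<open>n0\<close> is the strong convergence
    supplied by the compact embedding.\<close>
  have "nrm2 g = 1"
  proof -
    have "(\<lambda>n. nrm2 g + 2 * Re (ip g (h n)) + nrm2 (h n)) \<longlonglongrightarrow> nrm2 g + 2 * Re 0 + 0"
      by (intro tendsto_intros n0 d0 X_dual g)
    moreover have "nrm2 g + 2 * Re (ip g (h n)) + nrm2 (h n) = 1" for n
      using nrm2_expand[OF g(3) hX[of n], of 1] f(2)[of "r n"] fgh[of n] by simp
    ultimately show ?thesis
      by (simp add: LIMSEQ_const_iff)
  qed
  moreover have gM: "ip g (\<phi> i) = 0" if "i \<in> K" for i
  proof -
    have "ip (\<phi> i) (h n) = - ip (\<phi> i) g" for n
    proof -
      have "ip g (\<phi> i) + ip (h n) (\<phi> i) = 0"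
        using ip_lin_left[OF g(3) hX[of n] K(2)[OF that], of 1 1] f(1)[of "r n"] fgh[of n] that
        by (simp add: M_def)
      then have "cnj (ip g (\<phi> i) + ip (h n) (\<phi> i)) = 0"
        by simp
      then show ?thesis
        by (simp add: ip_cnj[symmetric] eq_neg_iff_add_eq_0 add.commute)
    qed
    then have "(\<lambda>n. - ip (\<phi> i) g) \<longlonglongrightarrow> 0"
      using d0[OF X_dual[OF K(2)[OF that]]] by simp
    then have "ip (\<phi> i) g = 0"
      by (simp add: LIMSEQ_const_iff)
    then show ?thesis
      using ip_cnj[of g "\<phi> i"] by simp
  qed
  moreover have "Re (Q g g) \<le> \<nu>"
  proof (rule LIMSEQ_le)
    show "(\<lambda>n. Re (Q g g) + 2 * Re (Q g (h n)) - C / 2 * nrm2 (h n)) \<longlonglongrightarrow> Re (Q g g)"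
    proof -
      have "(\<lambda>n. Re (Q g g) + 2 * Re (Q g (h n)) - C / 2 * nrm2 (h n)) \<longlonglongrightarrow> Re (Q g g) + 2 * Re 0 - C / 2 * 0"
        unfolding Q_def by (intro tendsto_intros n0 d0 oper_dual g)
      then show ?thesis
        by simp
    qed
    have "(\<lambda>n. \<nu> + 1 / real (Suc n)) \<longlonglongrightarrow> \<nu> + 0"
      by (intro tendsto_intros lim_1_over_n[THEN LIMSEQ_Suc])
    then show "(\<lambda>n. \<nu> + 1 / real (Suc n)) \<longlonglongrightarrow> \<nu>"
      by simp
    have "Re (Q g g) + 2 * Re (Q g (h n)) - C / 2 * nrm2 (h n) \<le> \<nu> + 1 / real (Suc n)" for n
    proof -
      have "Re (Q (f (r n)) (f (r n))) = Re (Q g g) + 2 * Re (Q g (h n)) + Re (Q (h n) (h n))"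
        using Q_expand[OF g(3) hX[of n], of 1] unfolding fgh[of n] by simp
      moreover have "0 \<le> 2 * Re (Q (h n) (h n)) + C * nrm2 (h n)"
        using C[OF hX[of n]] NX_nonneg[of "h n"] by linarith
      moreover have "1 / real (Suc (r n)) \<le> 1 / real (Suc n)"
        using seq_suble[OF g(1), of n] by (intro divide_left_mono) auto
      ultimately show ?thesis
        using f(3)[of "r n"] by simp
    qed
    then show "\<exists>N. \<forall>n\<ge>N. Re (Q g g) + 2 * Re (Q g (h n)) - C / 2 * nrm2 (h n) \<le> \<nu> + 1 / real (Suc n)"
      by blast
  qed
  moreover have "Re (Q g g) * nrm2 f \<le> Re (Q f f)" if "f \<in> X" "\<And>i. i \<in> K \<Longrightarrow> ip f (\<phi> i) = 0" for f
  proof -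
    have "Re (Q g g) * nrm2 f \<le> \<nu> * nrm2 f"
      using \<open>Re (Q g g) \<le> \<nu>\<close> by (intro mult_right_mono) auto
    also have "\<dots> \<le> Re (Q f f)"
      using that by (intro low) (auto simp: M_def)
    finally show ?thesis .
  qed
  ultimately show ?thesis
    using that g(3) by blast
qed

text \<open>The residual \<open>r g\<close> vanishes against all admissible variations
  (Euler-Lagrange), and against each \<open>\<phi> i\<close> because that is an eigenvector
  orthogonal to \<open>g\<close>. A unit sequence is a combination of the \<open>\<phi> i\<close>
  plus an admissible \<open>h\<close>, so every coordinate of the residual is 0.\<close>

lemma minimizer_eigenvector:
  assumes K: "finite K" "\<And>i. i \<in> K \<Longrightarrow> \<phi> i \<in> X"
    and orth: "\<And>i j. i \<in> K \<Longrightarrow> j \<in> K \<Longrightarrow> ip (\<phi> i) (\<phi> j) = (if i = j then 1 else 0)"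
    and eig: "\<And>i. i \<in> K \<Longrightarrow> oper (\<phi> i) = (\<lambda>k. of_real (l i) * \<phi> i k)"
    and g: "g \<in> X" "\<And>i. i \<in> K \<Longrightarrow> ip g (\<phi> i) = 0" "nrm2 g = 1"
    and min: "\<And>f. f \<in> X \<Longrightarrow> (\<And>i. i \<in> K \<Longrightarrow> ip f (\<phi> i) = 0) \<Longrightarrow> Re (Q g g) * nrm2 f \<le> Re (Q f f)"
  shows "oper g = (\<lambda>k. of_real (Re (Q g g)) * g k)"
proof
  fix k
  define \<nu> where "\<nu> = Re (Q g g)"
  define r where "r f h = Q f h - of_real \<nu> * ip f h" for f h
  have EL: "r g h = 0" if h: "h \<in> X" "\<And>i. i \<in> K \<Longrightarrow> ip h (\<phi> i) = 0" for h
  proof (rule ccontr)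
    assume nz: "r g h \<noteq> 0"
    define z where "z = r g h"
    define d where "d = Re (Q h h) - \<nu> * nrm2 h"
    have *: "0 \<le> (cmod z)\<^sup>2 * (t\<^sup>2 * d - 2 * t)" for t :: real
    proof -
      \<comment> \<open>The factor \<open>z\<close> aligns the phase: the first-order change becomes
        \<open>- 2 t (cmod z)\<^sup>2\<close>, which beats the quadratic term
        \<open>t\<^sup>2 (cmod z)\<^sup>2 d\<close> for small \<open>t > 0\<close>.\<close>
      let ?s = "- of_real t * z"
      have "ip (\<lambda>k. g k + ?s * h k) (\<phi> i) = 0" if "i \<in> K" for i
        using ip_lin_left[OF g(1) h(1) K(2)[OF that], of 1 ?s] g(2)[OF that] h(2)[OF that] by simp
      then have "\<nu> * nrm2 (\<lambda>k. g k + ?s * h k) \<le> Re (Q (\<lambda>k. g k + ?s * h k) (\<lambda>k. g k + ?s * h k))"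
        unfolding \<nu>_def using X_lin[OF g(1) h(1), of 1 ?s] by (intro min) auto
      then have "0 \<le> 2 * (Re (cnj ?s * Q g h) - \<nu> * Re (cnj ?s * ip g h)) + (cmod ?s)\<^sup>2 * d"
        unfolding Q_expand[OF g(1) h(1)] nrm2_expand[OF g(1) h(1)] g(3) d_def \<nu>_def[symmetric]
        by (simp add: algebra_simps)
      also have "Re (cnj ?s * Q g h) - \<nu> * Re (cnj ?s * ip g h) = Re (cnj ?s * z)"
        unfolding z_def r_def by (simp add: algebra_simps)
      also have "cnj ?s * z = - of_real (t * (cmod z)\<^sup>2)"
        using complex_norm_square[of z] by (simp add: mult_ac)
      also have "(cmod ?s)\<^sup>2 = t\<^sup>2 * (cmod z)\<^sup>2"
        by (simp add: norm_mult power_mult_distrib)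
      finally show ?thesis
        by (simp add: algebra_simps)
    qed
    have z: "(cmod z)\<^sup>2 > 0"
      using nz by (simp add: z_def)
    define t where "t = 1 / (\<bar>d\<bar> + 1)"
    have t: "t > 0" "t * \<bar>d\<bar> < 1"
      by (auto simp: t_def divide_simps)
    have "t\<^sup>2 * d - 2 * t = t * (t * d - 2)"
      by (simp add: power2_eq_square algebra_simps)
    moreover have "t * d \<le> t * \<bar>d\<bar>"
      using t(1) by (intro mult_left_mono) auto
    moreover from this have "t * d - 2 < 0"
      using t by linarith
    ultimately have "t\<^sup>2 * d - 2 * t < 0"
      using t by (simp add: mult_pos_neg)
    then show False
      using *[of t] z by (simp add: zero_le_mult_iff)
  qed
  have r\<phi>: "r (\<phi> i) g = 0" if "i \<in> K" for i
  proof -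
    have "ip (\<phi> i) g = 0"
      using ip_cnj[of "\<phi> i" g] g(2)[OF that] by simp
    moreover have "Q (\<phi> i) g = of_real (l i) * ip (\<phi> i) g"
      unfolding Q_def eig[OF that] ip_def mult.assoc by (rule infsum_cmult_right')
    ultimately show ?thesis
      by (simp add: r_def)
  qed
  define h where "h = (\<lambda>j. 1 * unit_seq k j + (- 1) * (\<Sum>i\<in>K. ip (unit_seq k) (\<phi> i) * \<phi> i j))"
  have sX: "(\<lambda>j. \<Sum>i\<in>K. ip (unit_seq k) (\<phi> i) * \<phi> i j) \<in> X"
    by (rule X_sum[OF K])
  have hX: "h \<in> X"
    unfolding h_def by (rule X_lin[OF X_unit sX])
  have "ip h (\<phi> i) = 0" if "i \<in> K" for i
  proof -
    have "(\<Sum>j\<in>K. ip (unit_seq k) (\<phi> j) * ip (\<phi> j) (\<phi> i)) = (\<Sum>j\<in>K. if j = i then ip (unit_seq k) (\<phi> j) else 0)"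
      using orth that by (intro sum.cong) auto
    also have "\<dots> = ip (unit_seq k) (\<phi> i)"
      using K(1) that by simp
    finally have "ip (\<lambda>j. \<Sum>i\<in>K. ip (unit_seq k) (\<phi> i) * \<phi> i j) (\<phi> i) = ip (unit_seq k) (\<phi> i)"
      by (subst ip_sum_left) (use K that in auto)
    then show ?thesis
      unfolding h_def ip_lin_left[OF X_unit sX K(2)[OF that]] by simp
  qed
  then have "r g h = 0"
    by (rule EL[OF hX])
  moreover have "cnj (r g h) = r h g"
    using Q_cnj[OF g(1) hX] ip_cnj[of h g] by (simp add: r_def)
  moreover have "r h g = r (unit_seq k) g - (\<Sum>i\<in>K. ip (unit_seq k) (\<phi> i) * r (\<phi> i) g)"
  proof -
    have "Q (\<lambda>j. \<Sum>i\<in>K. ip (unit_seq k) (\<phi> i) * \<phi> i j) g = (\<Sum>i\<in>K. ip (unit_seq k) (\<phi> i) * Q (\<phi> i) g)"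
      "ip (\<lambda>j. \<Sum>i\<in>K. ip (unit_seq k) (\<phi> i) * \<phi> i j) g = (\<Sum>i\<in>K. ip (unit_seq k) (\<phi> i) * ip (\<phi> i) g)"
      by (rule Q_sum_left ip_sum_left; use K g(1) in blast)+
    then show ?thesis
      unfolding r_def h_def Q_lin_left[OF X_unit sX g(1)] ip_lin_left[OF X_unit sX g(1)]
      by (simp add: algebra_simps sum_subtractf sum_negf sum_distrib_left)
  qed
  moreover have "cnj (r (unit_seq k) g) = oper g k - of_real \<nu> * g k"
    using Q_cnj[OF X_unit g(1), of k] ip_cnj[of g "unit_seq k"] by (simp add: r_def)
  ultimately show "oper g k = of_real (Re (Q g g)) * g k"
    using r\<phi> by (simp add: \<nu>_def)
qed

end

text \<open>The information that the multiplicities provide. \<open>complete\<close> is maximality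
  inside each single eigenspace: an eigenvector to \<nu> cannot be orthogonal to all
  \<open>\<phi> i\<close> with \<open>l i = \<nu>\<close>, and a \<nu> missing from the list has no
  eigenvectors. That the \<open>\<phi> i\<close> span everything is not assumed.\<close>

locale hill_spectrum = hill_form +
  fixes \<phi> :: "nat \<Rightarrow> int \<Rightarrow> complex" and l :: "nat \<Rightarrow> real"
  assumes \<phi>_X: "\<And>i. \<phi> i \<in> X"
    and orthonormal: "\<And>i j. ip (\<phi> i) (\<phi> j) = (if i = j then 1 else 0)"
    and eigen: "\<And>i. oper (\<phi> i) = (\<lambda>k. of_real (l i) * \<phi> i k)"
    and l_mono: "mono l"
    and l_finite: "\<And>T. finite {i. l i \<le> T}"
    and complete: "\<And>g \<nu>. g \<in> X \<Longrightarrow> oper g = (\<lambda>k. of_real \<nu> * g k) \<Longrightarrow>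
      (\<And>i. l i = \<nu> \<Longrightarrow> ip g (\<phi> i) = 0) \<Longrightarrow> g = (\<lambda>_. 0)"
begin

text \<open>The span of \<open>\<phi> 0\<close> to \<open>\<phi> d\<close> has more dimensions than
  there are constraints, so it contains a nonzero \<open>f\<close> orthogonal to all
  \<open>u j\<close>. On this span the form is diagonal, and \<open>l d < T\<close> would push its
  value at \<open>f\<close> below \<open>T * nrm2 f\<close>.\<close>

lemma eigenvalue_ge:
  assumes J: "finite J" "card J \<le> d" "\<And>j. j \<in> J \<Longrightarrow> u j \<in> X"
    and low: "\<And>f. f \<in> X \<Longrightarrow> (\<And>j. j \<in> J \<Longrightarrow> ip f (u j) = 0) \<Longrightarrow> T * nrm2 f \<le> Re (Q f f)"
  shows "T \<le> l d"
proof (rule ccontr)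
  assume "\<not> T \<le> l d"
  then have lt: "l i < T" if "i \<le> d" for i
    using monoD[OF l_mono that] by linarith
  obtain c where c: "\<exists>i\<in>{..d}. c i \<noteq> 0" "\<forall>j\<in>J. (\<Sum>i\<le>d. c i * ip (\<phi> i) (u j)) = 0"
    using homogeneous_system_nontrivial[of "{..d}" J "\<lambda>i j. ip (\<phi> i) (u j)"] J by auto
  define f where "f = (\<lambda>k. \<Sum>i\<le>d. c i * \<phi> i k)"
  have fX: "f \<in> X"
    unfolding f_def by (intro X_sum \<phi>_X) auto
  have f\<phi>: "ip f (\<phi> i) = c i" if "i \<le> d" for i
    unfolding f_def by (subst ip_sum_left) (use that in \<open>auto simp: \<phi>_X orthonormal if_distrib cong: if_cong\<close>)
  have \<phi>f: "ip (\<phi> i) f = cnj (c i)" if "i \<le> d" for i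
    using ip_cnj[of "\<phi> i" f] f\<phi>[OF that] by simp
  have "ip f f = (\<Sum>i\<le>d. c i * ip (\<phi> i) f)"
    unfolding f_def by (rule ip_sum_left) (auto simp: \<phi>_X fX[unfolded f_def])
  also have "\<dots> = (\<Sum>i\<le>d. of_real ((cmod (c i))\<^sup>2))"
    by (intro sum.cong) (auto simp: \<phi>f complex_norm_square simp del: of_real_power)
  finally have n: "nrm2 f = (\<Sum>i\<le>d. (cmod (c i))\<^sup>2)"
    unfolding ip_self[OF X_l2[OF fX]] of_real_sum[symmetric] of_real_eq_iff .
  have "Q f f = (\<Sum>i\<le>d. c i * Q (\<phi> i) f)"
    unfolding f_def by (rule Q_sum_left) (auto simp: \<phi>_X fX[unfolded f_def])
  also have "\<dots> = (\<Sum>i\<le>d. of_real (l i * (cmod (c i))\<^sup>2))"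
  proof (rule sum.cong)
    fix i assume "i \<in> {..d}"
    then have "Q (\<phi> i) f = of_real (l i) * cnj (c i)"
      unfolding Q_def eigen using \<phi>f[of i] by (simp add: ip_def mult.assoc infsum_cmult_right')
    then show "c i * Q (\<phi> i) f = of_real (l i * (cmod (c i))\<^sup>2)"
      unfolding of_real_mult complex_norm_square by (simp only: mult_ac)
  qed simp
  finally have q: "Re (Q f f) = (\<Sum>i\<le>d. l i * (cmod (c i))\<^sup>2)"
    unfolding of_real_sum[symmetric] by simp
  have "ip f (u j) = 0" if "j \<in> J" for j
    unfolding f_def using c(2) that by (subst ip_sum_left) (auto simp: \<phi>_X J)
  then have "T * nrm2 f \<le> Re (Q f f)"
    by (rule low[OF fX])
  moreover have "(\<Sum>i\<le>d. l i * (cmod (c i))\<^sup>2) < (\<Sum>i\<le>d. T * (cmod (c i))\<^sup>2)"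
  proof (rule sum_strict_mono_ex1)
    show "\<forall>i\<in>{..d}. l i * (cmod (c i))\<^sup>2 \<le> T * (cmod (c i))\<^sup>2"
      using mult_right_mono[OF less_imp_le[OF lt]] by simp
    show "\<exists>i\<in>{..d}. l i * (cmod (c i))\<^sup>2 < T * (cmod (c i))\<^sup>2"
    proof -
      obtain i where "i \<le> d" "c i \<noteq> 0"
        using c(1) by auto
      then show ?thesis
        using lt[of i] by (intro bexI[of _ i] mult_strict_right_mono) auto
    qed
  qed simp
  ultimately show False
    by (simp add: n q sum_distrib_left)
qed

text \<open>If \<open>l d > T\<close>, at most \<open>d\<close> of the \<open>\<phi> i\<close> have
  \<open>l i \<le> T\<close>, and the trial space contains an \<open>f\<close> orthogonal to them
  with Rayleigh quotient at most \<open>T\<close>. The minimizer under these constraints is then an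
  eigenvector with eigenvalue at most \<open>T\<close> orthogonal to all of them, which
  \<open>complete\<close> excludes. Positivity of \<open>nrm2\<close> in \<open>up\<close> encodes
  independence of the \<open>p i\<close>.\<close>

lemma eigenvalue_le:
  assumes I: "finite I" "card I = Suc d" "\<And>i. i \<in> I \<Longrightarrow> p i \<in> X"
    and up: "\<And>c. (\<exists>i\<in>I. c i \<noteq> 0) \<Longrightarrow> nrm2 (\<lambda>k. \<Sum>i\<in>I. c i * p i k) > 0 \<and>
      Re (Q (\<lambda>k. \<Sum>i\<in>I. c i * p i k) (\<lambda>k. \<Sum>i\<in>I. c i * p i k)) \<le> T * nrm2 (\<lambda>k. \<Sum>i\<in>I. c i * p i k)"
  shows "l d \<le> T"
proof (rule ccontr)
  assume d: "\<not> l d \<le> T"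
  define K where "K = {i. l i \<le> T}"
  have "K \<subseteq> {..<d}"
  proof
    fix i assume "i \<in> K"
    then show "i \<in> {..<d}"
      using d monoD[OF l_mono, of d i] by (cases "d \<le> i") (auto simp: K_def)
  qed
  then have K: "finite K" "card K \<le> d"
    using card_mono[of "{..<d}" K] by (auto intro: finite_subset)
  obtain c where c: "\<exists>i\<in>I. c i \<noteq> 0" "\<forall>j\<in>K. (\<Sum>i\<in>I. c i * ip (p i) (\<phi> j)) = 0"
    using homogeneous_system_nontrivial[of I K "\<lambda>i j. ip (p i) (\<phi> j)"] I K by auto
  define f where "f = (\<lambda>k. \<Sum>i\<in>I. c i * p i k)"
  have fX: "f \<in> X"
    unfolding f_def by (intro X_sum I)
  have f0: "nrm2 f > 0" "Re (Q f f) \<le> T * nrm2 f"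
    using up[OF c(1)] by (auto simp: f_def)
  have f\<phi>: "ip f (\<phi> j) = 0" if "j \<in> K" for j
    unfolding f_def using c(2) that by (subst ip_sum_left) (auto simp: \<phi>_X I)
  obtain g where g: "g \<in> X" "\<forall>i\<in>K. ip g (\<phi> i) = 0" "nrm2 g = 1"
    "\<forall>f\<in>X. (\<forall>i\<in>K. ip f (\<phi> i) = 0) \<longrightarrow> Re (Q g g) * nrm2 f \<le> Re (Q f f)"
    by (rule minimizer_exists[OF K(1) \<phi>_X fX f\<phi> f0(1)]) blast
  have "Re (Q g g) * nrm2 f \<le> T * nrm2 f"
    using g(4) fX f\<phi> f0(2) by (meson order.trans)
  then have \<nu>: "Re (Q g g) \<le> T"
    using f0(1) by simp
  have "oper g = (\<lambda>k. of_real (Re (Q g g)) * g k)"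
    by (rule minimizer_eigenvector[OF K(1) \<phi>_X orthonormal eigen g(1) _ g(3)]) (use g in auto)
  then have "g = (\<lambda>_. 0)"
    using \<nu> g(2) by (intro complete[OF g(1)]) (auto simp: K_def)
  then show False
    using g(3) by (simp add: nrm2_def)
qed

end

section \<open>Estimates near the unperturbed eigenvalues\<close>

text \<open>Factor out \<open>x - y\<close>: the remaining sum of \<open>x ^ p y ^ (N - p)\<close>
  contains \<open>max x y ^ N\<close>, and the maximum dominates the mean
  \<open>(x + y) / 2\<close>.\<close>

lemma power_diff_lower_bound:
  fixes x y :: real
  assumes "0 \<le> x" "0 \<le> y" "m \<ge> 1"
  shows "\<bar>x - y\<bar> * (x + y) ^ (2 * m - 1) / 2 ^ (2 * m - 1) \<le> \<bar>x ^ (2 * m) - y ^ (2 * m)\<bar>"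
proof -
  define N where "N = 2 * m - 1"
  have N: "2 * m = Suc N"
    using assms(3) by (simp add: N_def)
  let ?S = "\<Sum>p<Suc N. x ^ p * y ^ (N - p)"
  have "((x + y) / 2) ^ N \<le> max x y ^ N"
    using assms by (intro power_mono) auto
  also have "max x y ^ N \<le> ?S"
  proof (cases "y \<le> x")
    case True
    have "x ^ N * y ^ (N - N) \<le> ?S"
      by (rule member_le_sum) (use assms in auto)
    then show ?thesis
      using True by (simp add: max_def)
  next
    case False
    have "x ^ 0 * y ^ (N - 0) \<le> ?S"
      by (rule member_le_sum) (use assms in auto)
    then show ?thesis
      using False by (simp add: max_def)
  qed
  finally have S: "((x + y) / 2) ^ N \<le> ?S" .
  have "x ^ Suc N - y ^ Suc N = (x - y) * ?S"
    by (rule diff_power_eq_sum)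
  then have "\<bar>x ^ Suc N - y ^ Suc N\<bar> = \<bar>x - y\<bar> * ?S"
    using assms by (simp add: abs_mult sum_nonneg)
  moreover have "\<bar>x - y\<bar> * ((x + y) / 2) ^ N \<le> \<bar>x - y\<bar> * ?S"
    by (intro mult_left_mono S) auto
  ultimately show ?thesis
    unfolding N N_def[symmetric] by (simp add: power_divide)
qed

lemma powr_shift_le:
  fixes b n :: real
  assumes "0 < n" "n \<le> b" "0 \<le> e"
  shows "b powr (1 - e) \<le> n powr (- e) * b"
proof -
  have "b powr (1 - e) = b powr (- e) * b"
    using assms by (simp add: powr_diff powr_minus field_simps)
  also have "\<dots> \<le> n powr (- e) * b"
    using assms by (intro mult_right_mono powr_mono2') auto
  finally show ?thesis .
qed

lemma powr_split_le:
  fixes w b :: real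
  assumes "0 < w" "0 < b" "w \<le> 2 * b" "m \<ge> 1" "0 < e" "e \<le> 1"
  shows "w powr (2 * real m - e) \<le> 4 ^ m * b ^ (2 * m - 1) * b powr (1 - e)"
proof -
  have "w powr (2 * real m - e) \<le> (2 * b) powr (2 * real m - e)"
    using assms by (intro powr_mono2) auto
  also have "\<dots> = 2 powr (2 * real m - e) * b powr (2 * real m - e)"
    by (rule powr_mult)
  also have "2 powr (2 * real m - e) \<le> 2 powr (real (2 * m))"
    using assms by (intro powr_mono) auto
  also have "2 powr (real (2 * m)) = (4 :: real) ^ m"
    by (subst powr_realpow) (auto simp: power_mult)
  also have "b powr (2 * real m - e) = b powr (real (2 * m - 1)) * b powr (1 - e)"
    using assms by (simp add: powr_add[symmetric] of_nat_diff)
  also have "b powr (real (2 * m - 1)) = b ^ (2 * m - 1)"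
    by (rule powr_realpow) (rule assms)
  finally show ?thesis
    using assms by (simp add: mult.assoc mult_right_mono)
qed

text \<open>Here \<open>a = \<bar>\<bar>i\<bar> - n\<bar>\<close>,
  \<open>b = \<bar>i\<bar> + n\<close>, the primed letters belong to \<open>j\<close>, and
  \<open>w = wt (i - j)\<close>. Since \<open>w \<le> 2 b\<close>, the power \<open>2 m - e\<close>
  splits into \<open>b ^ (2 m - 1)\<close>, which cancels against the gap of \<open>i\<close>, and
  \<open>b powr (1 - e) \<le> n powr (- e) * b\<close>, which gives the gain. The leftover
  \<open>b \<le> a + 2 b'\<close> is absorbed by \<open>a\<close> and \<open>b'\<close>, leaving
  inverse squares.\<close>

lemma resolvent_kernel_bound_aux:
  fixes a b a' b' w n e :: real
  assumes n: "1 \<le> n" and a: "1 \<le> a" "n \<le> b" "b \<le> a + 2 * n"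
    and a': "1 \<le> a'" "n \<le> b'" "a' \<le> b'"
    and w: "0 < w" "w \<le> b + b'" and b: "b' \<le> b" and m: "m \<ge> 1" and e: "0 < e" "e \<le> 1"
  shows "w powr (2 * real m - e) / ((a * b ^ (2 * m - 1)) * (a' * b' ^ (2 * m - 1))) \<le>
    2 * 4 ^ m * n powr (- e) * (1 / a\<^sup>2 + 1 / a'\<^sup>2)"
proof -
  have pos: "0 < a" "0 < a'" "0 < b" "0 < b'"
    using assms by auto
  have "w powr (2 * real m - e) \<le> 4 ^ m * b ^ (2 * m - 1) * b powr (1 - e)"
    using assms pos by (intro powr_split_le) auto
  also have "\<dots> \<le> 4 ^ m * b ^ (2 * m - 1) * (n powr (- e) * b)"
    using assms by (intro mult_left_mono powr_shift_le) auto
  finally have "w powr (2 * real m - e) / ((a * b ^ (2 * m - 1)) * (a' * b' ^ (2 * m - 1))) \<le>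
      4 ^ m * b ^ (2 * m - 1) * (n powr (- e) * b) / ((a * b ^ (2 * m - 1)) * (a' * b' ^ (2 * m - 1)))"
    using pos by (intro divide_right_mono) auto
  also have "\<dots> = 4 ^ m * n powr (- e) * (b / (a * (a' * b' ^ (2 * m - 1))))"
    using pos by simp
  also have "\<dots> \<le> 4 ^ m * n powr (- e) * (2 * (1 / a\<^sup>2 + 1 / a'\<^sup>2))"
  proof (intro mult_left_mono)
    have "b' ^ 1 \<le> b' ^ (2 * m - 1)"
      using assms by (intro power_increasing) auto
    then have "b / (a * (a' * b' ^ (2 * m - 1))) \<le> b / (a * (a' * b'))"
      using pos by (intro divide_left_mono mult_left_mono mult_pos_pos) auto
    also have "\<dots> \<le> (a + 2 * b') / (a * (a' * b'))"
      using assms pos by (intro divide_right_mono) auto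
    also have "\<dots> = 1 / (a' * b') + 2 * ((1 / a) * (1 / a'))"
      using pos by (simp add: field_simps)
    also have "1 / (a' * b') \<le> 1 / a'\<^sup>2"
      unfolding power2_eq_square using pos a' by (intro divide_left_mono mult_left_mono mult_pos_pos) auto
    also have "2 * ((1 / a) * (1 / a')) \<le> 1 / a\<^sup>2 + 1 / a'\<^sup>2"
      using sum_squares_bound[of "1 / a" "1 / a'"] by (simp add: power_divide)
    finally have "b / (a * (a' * b' ^ (2 * m - 1))) \<le> 1 / a'\<^sup>2 + (1 / a\<^sup>2 + 1 / a'\<^sup>2)"
      by simp
    moreover have "0 \<le> 1 / a\<^sup>2"
      by simp
    ultimately show "b / (a * (a' * b' ^ (2 * m - 1))) \<le> 2 * (1 / a\<^sup>2 + 1 / a'\<^sup>2)"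
      by argo
  qed auto
  finally show ?thesis
    by (simp only: mult_ac)
qed

lemma resolvent_kernel_bound:
  fixes a b a' b' w n e :: real
  assumes n: "1 \<le> n" and a: "1 \<le> a" "n \<le> b" "a \<le> b" "b \<le> a + 2 * n"
    and a': "1 \<le> a'" "n \<le> b'" "a' \<le> b'" "b' \<le> a' + 2 * n"
    and w: "0 < w" "w \<le> b + b'" and m: "m \<ge> 1" and e: "0 < e" "e \<le> 1"
  shows "w powr (2 * real m - e) / ((a * b ^ (2 * m - 1)) * (a' * b' ^ (2 * m - 1))) \<le>
    2 * 4 ^ m * n powr (- e) * (1 / a\<^sup>2 + 1 / a'\<^sup>2)"
proof (cases "b' \<le> b")
  case True
  then show ?thesis
    using assms by (intro resolvent_kernel_bound_aux) auto
next
  case False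
  have "w powr (2 * real m - e) / ((a' * b' ^ (2 * m - 1)) * (a * b ^ (2 * m - 1))) \<le>
      2 * 4 ^ m * n powr (- e) * (1 / a'\<^sup>2 + 1 / a\<^sup>2)"
    using assms False by (intro resolvent_kernel_bound_aux) auto
  then show ?thesis
    by (simp add: mult_ac add_ac)
qed

context hill_form
begin

section \<open>Gaps of the unperturbed spectrum\<close>

definition off :: "nat \<Rightarrow> int set" where
  "off n = - {int n, - int n}"

text \<open>The value 1 at \<open>\<plusminus>n\<close> is arbitrary; it makes \<open>gap n\<close> a positive weight.\<close>

definition gap :: "nat \<Rightarrow> int \<Rightarrow> real" where
  "gap n j = (if j \<in> off n then \<bar>mu j - mu (int n)\<bar> else 1)"

definition R :: "nat \<Rightarrow> real" where
  "R n = (\<Sum>\<^sub>\<infinity>j\<in>off n. (cmod (V (int n - j)))\<^sup>2 / gap n j)"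

lemma gap_lower:
  "\<bar>\<bar>real_of_int j\<bar> - real n\<bar> * (\<bar>real_of_int j\<bar> + real n) ^ (2 * m - 1) / 2 ^ (2 * m - 1) \<le> gap n j"
proof (cases "j \<in> off n")
  case True
  have mu: "mu k = pi ^ (2 * m) * \<bar>real_of_int k\<bar> ^ (2 * m)" for k
    by (simp add: mu_abs power_mult_distrib)
  have "gap n j = pi ^ (2 * m) * \<bar>\<bar>real_of_int j\<bar> ^ (2 * m) - real n ^ (2 * m)\<bar>"
    using True unfolding gap_def mu by (simp add: abs_mult flip: right_diff_distrib)
  moreover have "1 * \<bar>\<bar>real_of_int j\<bar> ^ (2 * m) - real n ^ (2 * m)\<bar> \<le>
      pi ^ (2 * m) * \<bar>\<bar>real_of_int j\<bar> ^ (2 * m) - real n ^ (2 * m)\<bar>"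
    using pi_ge_two by (intro mult_right_mono one_le_power) auto
  ultimately show ?thesis
    using power_diff_lower_bound[of "\<bar>real_of_int j\<bar>" "real n" m] m_ge_1 by simp
qed (auto simp: gap_def off_def)

lemma off_dist: "j \<in> off n \<Longrightarrow> 1 \<le> \<bar>\<bar>real_of_int j\<bar> - real n\<bar>"
  unfolding off_def by (auto simp: abs_if split: if_splits)

lemma gap_lower_uniform:
  assumes "j \<in> off n"
  shows "real n ^ (2 * m - 1) / 2 ^ (2 * m - 1) \<le> gap n j"
proof -
  have "1 * real n ^ (2 * m - 1) \<le> \<bar>\<bar>real_of_int j\<bar> - real n\<bar> * (\<bar>real_of_int j\<bar> + real n) ^ (2 * m - 1)"
    using off_dist[OF assms] by (intro mult_mono power_mono) auto
  then show ?thesis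
    using gap_lower[of j n] by (auto dest: divide_right_mono[of _ _ "2 ^ (2 * m - 1)"])
qed

lemma gap_pos:
  assumes "n \<ge> 1"
  shows "0 < gap n j"
proof (cases "j \<in> off n")
  case True
  have "0 < real n ^ (2 * m - 1) / 2 ^ (2 * m - 1)"
    using assms by simp
  then show ?thesis
    using gap_lower_uniform[OF True] by linarith
qed (simp add: gap_def)

lemma gap_nonneg [simp]: "0 \<le> gap n j"
  by (simp add: gap_def)

text \<open>The terms at \<plusminus>n are \<open>1 / 0 = 0\<close>, so the sum may run over all
  integers. Each term is majorized by two shifted copies of the inverse-square series, which makes
  the bound independent of \<open>n\<close>.\<close>

lemma sum_off_inverse_square:
  "(\<lambda>j. 1 / (\<bar>real_of_int j\<bar> - real n)\<^sup>2) summable_on UNIV"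
  "(\<Sum>\<^sub>\<infinity>j. 1 / (\<bar>real_of_int j\<bar> - real n)\<^sup>2) \<le> 2 * (\<Sum>\<^sub>\<infinity>j. 1 / (real_of_int j)\<^sup>2)"
proof -
  have s: "((\<lambda>j. 1 / (real_of_int (j + c))\<^sup>2) has_sum (\<Sum>\<^sub>\<infinity>j. 1 / (real_of_int j)\<^sup>2)) UNIV" for c
  proof -
    have "bij (\<lambda>j. j + c)"
      by (rule bij_betw_byWitness[where f' = "\<lambda>j. j - c"]) auto
    from has_sum_reindex_bij_betw[OF this, of "\<lambda>j. 1 / (real_of_int j)\<^sup>2"] show ?thesis
      using has_sum_infsum[OF summable_on_inverse_square_int] by simp
  qed
  have S: "((\<lambda>j. 1 / (real_of_int (j + - int n))\<^sup>2 + 1 / (real_of_int (j + int n))\<^sup>2) has_sum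
      (\<Sum>\<^sub>\<infinity>j. 1 / (real_of_int j)\<^sup>2) + (\<Sum>\<^sub>\<infinity>j. 1 / (real_of_int j)\<^sup>2)) UNIV"
    by (intro has_sum_add s)
  have le: "1 / (\<bar>real_of_int j\<bar> - real n)\<^sup>2 \<le>
      1 / (real_of_int (j + - int n))\<^sup>2 + 1 / (real_of_int (j + int n))\<^sup>2" for j
  proof (cases "0 \<le> j")
    case False
    then have "(\<bar>real_of_int j\<bar> - real n)\<^sup>2 = (real_of_int (j + int n))\<^sup>2"
      by (simp add: power2_eq_iff)
    then show ?thesis
      by simp
  qed simp
  show s1: "(\<lambda>j. 1 / (\<bar>real_of_int j\<bar> - real n)\<^sup>2) summable_on UNIV"
    by (rule summable_on_comparison_test[OF has_sum_imp_summable[OF S] le]) auto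
  show "(\<Sum>\<^sub>\<infinity>j. 1 / (\<bar>real_of_int j\<bar> - real n)\<^sup>2) \<le> 2 * (\<Sum>\<^sub>\<infinity>j. 1 / (real_of_int j)\<^sup>2)"
    using has_sum_mono[OF has_sum_infsum[OF s1] S le] by simp
qed

end

section \<open>Decay of the kernel and of \<open>R\<close> when the coefficients have exponent
  \<open>-(m - e / 2)\<close>\<close>

locale hill_form_decay = hill_form +
  fixes e :: real
  assumes e: "0 < e" "e \<le> 1"
    and V_decay: "(\<lambda>k. wt k powr (- (2 * real m - e)) * (cmod (V k))\<^sup>2) summable_on UNIV"
begin

definition v :: "int \<Rightarrow> real" where
  "v k = wt k powr (- (2 * real m - e)) * (cmod (V k))\<^sup>2"

lemma v_nonneg [simp]: "0 \<le> v k"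
  by (simp add: v_def)

lemma v_summable: "v summable_on UNIV"
  using V_decay by (simp add: v_def[abs_def])

lemma V_eq: "(cmod (V k))\<^sup>2 = wt k powr (2 * real m - e) * v k"
proof -
  have "wt k powr (2 * real m - e) * wt k powr (- (2 * real m - e)) = 1"
    by (simp flip: powr_add)
  then show ?thesis
    unfolding v_def mult.assoc[symmetric] by simp
qed

lemma infsum_v_nonneg [simp]: "0 \<le> infsum v UNIV"
  by (rule infsum_nonneg) auto

text \<open>The factor \<open>real n powr (- e)\<close> is the point: away from \<plusminus>n the
  potential becomes small relative to the gaps. Each gap costs \<open>2 ^ (2 m - 1)\<close>,
  together \<open>4 ^ (2 m - 1)\<close>; the separate factor 4 is two convolutions, each with a sum
  bounded by twice the inverse-square series.\<close>

lemma off_kernel_HS: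
  assumes n: "n \<ge> 1"
  shows "(\<lambda>(i, j). (cmod (V (i - j)))\<^sup>2 / (gap n i * gap n j)) summable_on off n \<times> off n"
    and "(\<Sum>\<^sub>\<infinity>(i, j)\<in>off n \<times> off n. (cmod (V (i - j)))\<^sup>2 / (gap n i * gap n j)) \<le>
      (2 * 4 ^ m * 4 ^ (2 * m - 1) * 4 * infsum v UNIV * (\<Sum>\<^sub>\<infinity>j. 1 / (real_of_int j)\<^sup>2)) * real n powr (- e)"
proof -
  let ?t = "\<lambda>j. 1 / (\<bar>real_of_int j\<bar> - real n)\<^sup>2"
  let ?C = "2 * 4 ^ m * 4 ^ (2 * m - 1) * real n powr (- e)"
  note c = has_sum_convolution_nonneg[OF v_summable sum_off_inverse_square(1)[of n] v_nonneg]
  have S: "((\<lambda>x. ?C * ((case x of (i, j) \<Rightarrow> v (i - j) * ?t j) + (case x of (i, j) \<Rightarrow> v (i - j) * ?t i)))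
      has_sum ?C * (infsum v UNIV * infsum ?t UNIV + infsum v UNIV * infsum ?t UNIV)) UNIV"
    by (intro has_sum_cmult_right has_sum_add c) auto
  have le: "(case x of (i, j) \<Rightarrow> (cmod (V (i - j)))\<^sup>2 / (gap n i * gap n j)) \<le>
      ?C * ((case x of (i, j) \<Rightarrow> v (i - j) * ?t j) + (case x of (i, j) \<Rightarrow> v (i - j) * ?t i))"
    if x: "x \<in> off n \<times> off n" for x
  proof -
    obtain i j where ij: "x = (i, j)" "i \<in> off n" "j \<in> off n"
      using x by auto
    define ai bi aj bj where "ai = \<bar>\<bar>real_of_int i\<bar> - real n\<bar>" and "bi = \<bar>real_of_int i\<bar> + real n"
      and "aj = \<bar>\<bar>real_of_int j\<bar> - real n\<bar>" and "bj = \<bar>real_of_int j\<bar> + real n"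
    note d = ai_def bi_def aj_def bj_def
    have w: "wt (i - j) \<le> bi + bj"
      unfolding wt_def d using n by simp
    have pos: "0 < ai" "0 < bi" "0 < aj" "0 < bj"
      using off_dist[OF ij(2)] off_dist[OF ij(3)] n by (auto simp: d)
    let ?P = "(ai * bi ^ (2 * m - 1)) * (aj * bj ^ (2 * m - 1))"
    have K: "wt (i - j) powr (2 * real m - e) / ?P \<le> 2 * 4 ^ m * real n powr (- e) * (1 / ai\<^sup>2 + 1 / aj\<^sup>2)"
      using off_dist[OF ij(2)] off_dist[OF ij(3)] n w e m_ge_1
      by (intro resolvent_kernel_bound) (auto simp: d)
    have "?P / 4 ^ (2 * m - 1) = (ai * bi ^ (2 * m - 1) / 2 ^ (2 * m - 1)) * (aj * bj ^ (2 * m - 1) / 2 ^ (2 * m - 1))"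
      by (simp add: power_mult_distrib[symmetric])
    also have "\<dots> \<le> gap n i * gap n j"
      using gap_lower[of i n] gap_lower[of j n] pos unfolding d by (intro mult_mono) auto
    finally have "(cmod (V (i - j)))\<^sup>2 / (gap n i * gap n j) \<le> (cmod (V (i - j)))\<^sup>2 / (?P / 4 ^ (2 * m - 1))"
      using gap_pos[OF n] pos by (intro divide_left_mono) auto
    also have "\<dots> = 4 ^ (2 * m - 1) * v (i - j) * (wt (i - j) powr (2 * real m - e) / ?P)"
      unfolding V_eq by simp
    also have "\<dots> \<le> 4 ^ (2 * m - 1) * v (i - j) * (2 * 4 ^ m * real n powr (- e) * (1 / ai\<^sup>2 + 1 / aj\<^sup>2))"
      by (intro mult_left_mono K) auto
    also have "\<dots> = ?C * (v (i - j) * ?t j + v (i - j) * ?t i)"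
      unfolding d by (simp add: algebra_simps)
    finally show ?thesis
      by (simp add: ij)
  qed
  have SS: "(\<lambda>x. ?C * ((case x of (i, j) \<Rightarrow> v (i - j) * ?t j) + (case x of (i, j) \<Rightarrow> v (i - j) * ?t i)))
      summable_on off n \<times> off n"
    by (rule summable_on_subset_banach[OF has_sum_imp_summable[OF S]]) auto
  show s: "(\<lambda>(i, j). (cmod (V (i - j)))\<^sup>2 / (gap n i * gap n j)) summable_on off n \<times> off n"
    by (rule summable_on_comparison_test[OF SS le]) auto
  have "(\<Sum>\<^sub>\<infinity>(i, j)\<in>off n \<times> off n. (cmod (V (i - j)))\<^sup>2 / (gap n i * gap n j)) \<le>
      ?C * (infsum v UNIV * infsum ?t UNIV + infsum v UNIV * infsum ?t UNIV)"
    by (rule has_sum_mono_neutral[OF has_sum_infsum[OF s] S]) (use le in \<open>auto simp: case_prod_unfold\<close>)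
  also have "\<dots> \<le> ?C * (infsum v UNIV * (2 * (\<Sum>\<^sub>\<infinity>j. 1 / (real_of_int j)\<^sup>2)) +
      infsum v UNIV * (2 * (\<Sum>\<^sub>\<infinity>j. 1 / (real_of_int j)\<^sup>2)))"
    by (intro mult_left_mono add_mono sum_off_inverse_square) auto
  finally show "(\<Sum>\<^sub>\<infinity>(i, j)\<in>off n \<times> off n. (cmod (V (i - j)))\<^sup>2 / (gap n i * gap n j)) \<le>
      (2 * 4 ^ m * 4 ^ (2 * m - 1) * 4 * infsum v UNIV * (\<Sum>\<^sub>\<infinity>j. 1 / (real_of_int j)\<^sup>2)) * real n powr (- e)"
    by (simp add: mult_ac)
qed

text \<open>With \<open>k = n - j\<close> one has \<open>(\<bar>j\<bar> - n) (\<bar>j\<bar> + n) = k (k - 2 n)\<close>.\<close>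

lemma R_term_bound:
  assumes n: "n \<ge> 1" and k: "int n - k \<in> off n"
  shows "(cmod (V k))\<^sup>2 / gap n (int n - k) \<le>
    (4 ^ (2 * m) * real n powr (- e)) * (v k + 3 * real n * (v k / \<bar>real_of_int (k - 2 * int n)\<bar>))"
proof -
  define j where "j = int n - k"
  define a b l where "a = \<bar>\<bar>real_of_int j\<bar> - real n\<bar>" and "b = \<bar>real_of_int j\<bar> + real n"
    and "l = \<bar>real_of_int (k - 2 * int n)\<bar>"
  have pos: "1 \<le> a" "real n \<le> b" "0 < b" "0 < a"
    using off_dist[of j n] k n by (auto simp: a_def b_def j_def)
  have k0: "k \<noteq> 0" "k \<noteq> 2 * int n"
    using k by (auto simp: off_def)
  then have l: "1 \<le> l"
    unfolding l_def by linarith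
  have ab: "a * b = \<bar>real_of_int k\<bar> * l"
  proof -
    have "(\<bar>real_of_int j\<bar> - real n) * (\<bar>real_of_int j\<bar> + real n) = \<bar>real_of_int j\<bar> ^ 2 - real n ^ 2"
      by (simp only: power2_eq_square) (simp add: algebra_simps)
    then have "a * b = \<bar>\<bar>real_of_int j\<bar> ^ 2 - real n ^ 2\<bar>"
      unfolding a_def b_def by (metis abs_mult abs_of_nonneg add_nonneg_nonneg abs_ge_zero of_nat_0_le_iff)
    also have "\<bar>real_of_int j\<bar> ^ 2 - real n ^ 2 = real_of_int k * real_of_int (k - 2 * int n)"
      unfolding j_def by (simp add: power2_eq_square algebra_simps)
    finally show ?thesis
      by (simp add: l_def abs_mult)
  qed
  have kp: "1 \<le> \<bar>real_of_int k\<bar>"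
    using k0 by linarith
  have w1: "wt k \<le> 2 * \<bar>real_of_int k\<bar>"
    using kp by (simp add: wt_def)
  have w2: "wt k \<le> 2 * b"
  proof -
    have "1 \<le> real n"
      using n by simp
    moreover have "\<bar>real_of_int k\<bar> \<le> \<bar>real n - real_of_int k\<bar> + real n"
      using abs_triangle_ineq4[of "real n" "real n - real_of_int k"] by simp
    moreover have "0 \<le> \<bar>real n - real_of_int k\<bar>"
      by simp
    ultimately have "1 + \<bar>real_of_int k\<bar> \<le> 2 * (\<bar>real n - real_of_int k\<bar> + real n)"
      by argo
    then show ?thesis
      by (simp add: wt_def b_def j_def)
  qed
  have w3: "wt k \<le> 3 * real n + l"
    unfolding wt_def l_def using n by simp
  \<comment> \<open>With \<open>a b ^ (2 m - 1) = \<bar>k\<bar> l b ^ (2 m - 2)\<close> as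
    denominator, one factor \<open>wt k\<close> is spent on \<open>\<bar>k\<bar>\<close>,
    \<open>2 m - 2\<close> of them on powers of \<open>b\<close>, and the power \<open>1 - e\<close>
    yields the decay in \<open>n\<close> at the price of \<open>3 n + l\<close>.\<close>
  have "wt k powr (2 * real m - e) = wt k * wt k ^ (2 * m - 2) * wt k powr (1 - e)"
  proof -
    have "wt k powr (2 * real m - e) = wt k powr (1 + real (2 * m - 2) + (1 - e))"
      using m_ge_1 by (simp add: of_nat_diff)
    also have "\<dots> = wt k * wt k ^ (2 * m - 2) * wt k powr (1 - e)"
      by (simp only: powr_add powr_realpow wt_pos wt_nonneg powr_one)
    finally show ?thesis .
  qed
  also have "\<dots> \<le> (2 * \<bar>real_of_int k\<bar>) * (2 * b) ^ (2 * m - 2) * (real n powr (- e) * (3 * real n + l))"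
  proof (intro mult_mono power_mono w1 w2)
    have "wt k powr (1 - e) \<le> (3 * real n + l) powr (1 - e)"
      using e w3 by (intro powr_mono2) auto
    also have "\<dots> \<le> real n powr (- e) * (3 * real n + l)"
      using n l e by (intro powr_shift_le) auto
    finally show "wt k powr (1 - e) \<le> real n powr (- e) * (3 * real n + l)" .
  qed (use pos l in auto)
  finally have W: "wt k powr (2 * real m - e) \<le>
      (2 * \<bar>real_of_int k\<bar>) * (2 * b) ^ (2 * m - 2) * (real n powr (- e) * (3 * real n + l))" .
  have b2: "b ^ (2 * m - 1) = b * b ^ (2 * m - 2)"
  proof -
    have "2 * m - 1 = Suc (2 * m - 2)"
      using m_ge_1 by linarith
    then show ?thesis
      by simp
  qed
  have "(cmod (V k))\<^sup>2 / gap n j \<le> (cmod (V k))\<^sup>2 / (a * b ^ (2 * m - 1) / 2 ^ (2 * m - 1))"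
    using gap_lower[of j n] gap_pos[OF n] pos
    by (intro divide_left_mono) (auto simp: a_def b_def j_def)
  also have "\<dots> = 2 ^ (2 * m - 1) * v k * wt k powr (2 * real m - e) / (\<bar>real_of_int k\<bar> * l * b ^ (2 * m - 2))"
    unfolding V_eq b2 ab[symmetric] by (simp add: mult_ac)
  also have "\<dots> \<le> 2 ^ (2 * m - 1) * v k * ((2 * \<bar>real_of_int k\<bar>) * (2 * b) ^ (2 * m - 2) *
      (real n powr (- e) * (3 * real n + l))) / (\<bar>real_of_int k\<bar> * l * b ^ (2 * m - 2))"
    using pos l by (intro divide_right_mono mult_left_mono W) auto
  also have "\<dots> = (2 ^ (2 * m - 1) * (2 * 2 ^ (2 * m - 2)) * real n powr (- e)) * (v k + 3 * real n * (v k / l))"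
    using pos l kp by (simp add: power_mult_distrib field_simps)
  also have "\<dots> \<le> (4 ^ (2 * m) * real n powr (- e)) * (v k + 3 * real n * (v k / l))"
  proof (intro mult_right_mono)
    have "(2 :: real) ^ (2 * m - 1) * (2 * 2 ^ (2 * m - 2)) \<le> 2 ^ (2 * m) * 2 ^ (2 * m)"
      by (intro mult_mono) (use m_ge_1 in \<open>auto simp flip: power_Suc intro!: power_increasing\<close>)
    also have "\<dots> = (4 :: real) ^ (2 * m)"
      by (simp flip: power_mult_distrib)
    finally show "(2 :: real) ^ (2 * m - 1) * (2 * 2 ^ (2 * m - 2)) \<le> 4 ^ (2 * m)" .
  qed (use l in auto)
  finally show ?thesis
    by (simp add: j_def l_def)
qed

text \<open>The convolution of \<open>v\<close> with \<open>1 / \<bar>k\<bar>\<close>, sampled at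
  \<open>2 n\<close>; the singular index \<open>k = 2 n\<close> contributes 0.\<close>

definition tail_conv :: "nat \<Rightarrow> real" where
  "tail_conv n = (\<Sum>\<^sub>\<infinity>k. v k * (1 / \<bar>real_of_int (2 * int n - k)\<bar>))"

lemma tail_conv_summable:
  "(\<lambda>k. v k * (1 / \<bar>real_of_int (c - k)\<bar>)) summable_on UNIV"
proof (rule summable_on_comparison_test[OF v_summable])
  fix k
  have "1 / \<bar>real_of_int (c - k)\<bar> \<le> 1"
    by (cases "c = k") (auto simp: divide_simps)
  then show "v k * (1 / \<bar>real_of_int (c - k)\<bar>) \<le> v k"
    using mult_left_mono[OF _ v_nonneg[of k]] by fastforce
qed auto

lemma tail_conv_nonneg: "0 \<le> tail_conv n"
  unfolding tail_conv_def by (rule infsum_nonneg) auto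

lemma tail_conv_le: "tail_conv n \<le> infsum v UNIV"
  unfolding tail_conv_def
proof (rule infsum_mono[OF tail_conv_summable v_summable])
  fix k
  have "1 / \<bar>real_of_int (2 * int n - k)\<bar> \<le> 1"
    by (cases "2 * int n = k") (auto simp: divide_simps)
  then show "v k * (1 / \<bar>real_of_int (2 * int n - k)\<bar>) \<le> v k"
    using mult_left_mono[OF _ v_nonneg[of k]] by fastforce
qed

text \<open>Young's inequality: \<open>v\<close> is summable and \<open>1 / \<bar>k\<bar>\<close> is
  square summable, so their convolution is square summable. The proof is Cauchy-Schwarz with
  \<open>v\<close> split into two square roots.\<close>

lemma tail_conv_square_summable: "(\<lambda>n. (tail_conv n)\<^sup>2) summable_on UNIV"
proof -
  have C: "((\<lambda>(i, j). 1 / (real_of_int (i - j))\<^sup>2 * v j) has_sum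
      (\<Sum>\<^sub>\<infinity>k. 1 / (real_of_int k)\<^sup>2) * infsum v UNIV) (UNIV \<times> UNIV)"
    using has_sum_convolution_nonneg(1)[OF summable_on_inverse_square_int v_summable] by simp
  have rows: "(\<lambda>k. 1 / (real_of_int (l - k))\<^sup>2 * v k) summable_on UNIV" for l
    using summable_on_SigmaD1[OF has_sum_imp_summable[OF C], of l] by simp
  have "(\<lambda>l. \<Sum>\<^sub>\<infinity>k. 1 / (real_of_int (l - k))\<^sup>2 * v k) summable_on UNIV"
    using summable_on_Sigma_banach[OF has_sum_imp_summable[OF C]] by simp
  then have "(\<lambda>l. \<Sum>\<^sub>\<infinity>k. 1 / (real_of_int (l - k))\<^sup>2 * v k) summable_on range (\<lambda>n. 2 * int n)"
    by (rule summable_on_subset_banach) auto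
  then have "(\<lambda>n. \<Sum>\<^sub>\<infinity>k. 1 / (real_of_int (2 * int n - k))\<^sup>2 * v k) summable_on UNIV"
    by (subst (asm) summable_on_reindex) (auto simp: inj_on_def o_def)
  then have "(\<lambda>n. infsum v UNIV * (\<Sum>\<^sub>\<infinity>k. 1 / (real_of_int (2 * int n - k))\<^sup>2 * v k)) summable_on UNIV"
    by (rule summable_on_cmult_right)
  then show ?thesis
  proof (rule summable_on_comparison_test)
    fix n
    have e1: "(sqrt (v k))\<^sup>2 = v k" for k
      by simp
    have e2: "(sqrt (v k) / \<bar>real_of_int (2 * int n - k)\<bar>)\<^sup>2 = 1 / (real_of_int (2 * int n - k))\<^sup>2 * v k" for k
      by (simp add: power_divide)
    have e3: "\<bar>sqrt (v k) * (sqrt (v k) / \<bar>real_of_int (2 * int n - k)\<bar>)\<bar> =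
        v k * (1 / \<bar>real_of_int (2 * int n - k)\<bar>)" for k
      by (simp add: abs_mult)
    show "(tail_conv n)\<^sup>2 \<le> infsum v UNIV * (\<Sum>\<^sub>\<infinity>k. 1 / (real_of_int (2 * int n - k))\<^sup>2 * v k)"
      using infsum_Cauchy_Schwarz(3)[of "\<lambda>k. sqrt (v k)" UNIV
          "\<lambda>k. sqrt (v k) / \<bar>real_of_int (2 * int n - k)\<bar>", unfolded e1 e2 e3, OF _ rows]
        v_summable by (simp add: tail_conv_def)
  qed auto
qed

lemma R_bound:
  assumes n: "n \<ge> 1"
  shows "(\<lambda>j. (cmod (V (int n - j)))\<^sup>2 / gap n j) summable_on off n"
    and "R n \<le> 4 ^ (2 * m) * real n powr (- e) * (infsum v UNIV + 3 * real n * tail_conv n)"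
proof -
  let ?C = "4 ^ (2 * m) * real n powr (- e)"
  let ?g = "\<lambda>k. ?C * (v k + 3 * real n * (v k * (1 / \<bar>real_of_int (2 * int n - k)\<bar>)))"
  have bij: "bij (\<lambda>j. int n - j)"
    by (rule bij_betw_byWitness[where f' = "\<lambda>j. int n - j"]) auto
  have "(?g has_sum ?C * (infsum v UNIV + 3 * real n * tail_conv n)) UNIV"
    unfolding tail_conv_def
    by (intro has_sum_cmult_right has_sum_add has_sum_infsum v_summable tail_conv_summable)
  then have S: "((\<lambda>j. ?g (int n - j)) has_sum ?C * (infsum v UNIV + 3 * real n * tail_conv n)) UNIV"
    by (subst has_sum_reindex_bij_betw[OF bij])
  have le: "(cmod (V (int n - j)))\<^sup>2 / gap n j \<le> ?g (int n - j)" if "j \<in> off n" for j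
  proof -
    have "\<bar>real_of_int (int n - j - 2 * int n)\<bar> = \<bar>real_of_int (2 * int n - (int n - j))\<bar>"
      by simp
    then show ?thesis
      using R_term_bound[OF n, of "int n - j"] that by (simp del: of_int_diff)
  qed
  show s: "(\<lambda>j. (cmod (V (int n - j)))\<^sup>2 / gap n j) summable_on off n"
    by (rule summable_on_comparison_test[OF summable_on_subset_banach[OF has_sum_imp_summable[OF S]] le]) auto
  show "R n \<le> ?C * (infsum v UNIV + 3 * real n * tail_conv n)"
    unfolding R_def by (rule has_sum_mono_neutral[OF has_sum_infsum[OF s] S]) (use le in auto)
qed

lemma R_nonneg: "0 \<le> R n"
  unfolding R_def by (rule infsum_nonneg) auto

text \<open>After multiplication by \<open>real n powr (- (1 - e))\<close>, the bound on
  \<open>R n\<close> is a constant times \<open>1 / n\<close> plus a constant times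
  \<open>tail_conv n\<close>, and both are square summable. This is the gain in regularity that
  drives the bootstrap.\<close>

lemma R_weighted_summable:
  "(\<lambda>n. (1 + real n) powr (- (2 * (1 - e))) * (R n)\<^sup>2) summable_on {1..}"
proof -
  let ?D = "4 ^ (2 * m) :: real"
  let ?v = "infsum v UNIV"
  have "(\<lambda>n. 1 / real n ^ 2) summable_on UNIV"
    using inverse_power_summable[of 2, where 'a = real]
    by (auto simp: summable_on_UNIV_nonneg_real_iff divide_inverse power_inverse)
  then have "(\<lambda>n. 2 * ((?D * ?v)\<^sup>2 * (1 / real n ^ 2)) + 2 * ((3 * ?D)\<^sup>2 * (tail_conv n)\<^sup>2)) summable_on UNIV"
    by (intro summable_on_add summable_on_cmult_right tail_conv_square_summable)
  then have "(\<lambda>n. 2 * ((?D * ?v)\<^sup>2 * (1 / real n ^ 2)) + 2 * ((3 * ?D)\<^sup>2 * (tail_conv n)\<^sup>2)) summable_on {1..}"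
    by (rule summable_on_subset_banach) auto
  then show ?thesis
  proof (rule summable_on_comparison_test)
    fix n :: nat assume "n \<in> {1..}"
    then have n: "1 \<le> n"
      by simp
    let ?x = "real n powr (- (1 - e)) * R n"
    have "(1 + real n) powr (- (2 * (1 - e))) * (R n)\<^sup>2 \<le> real n powr (- (2 * (1 - e))) * (R n)\<^sup>2"
      using n e by (intro mult_right_mono powr_mono2') auto
    also have "\<dots> = ?x\<^sup>2"
      using n by (simp add: power_mult_distrib powr_power mult.commute)
    also have "?x \<le> ?D * ?v * (1 / real n) + 3 * ?D * tail_conv n"
    proof -
      have "?x \<le> real n powr (- (1 - e)) * (?D * real n powr (- e) * (?v + 3 * real n * tail_conv n))"
        by (intro mult_left_mono R_bound n) auto
      also have "\<dots> = (real n powr (- (1 - e)) * real n powr (- e)) * (?D * (?v + 3 * real n * tail_conv n))"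
        by simp
      also have "real n powr (- (1 - e)) * real n powr (- e) = 1 / real n"
      proof -
        have "real n powr (- (1 - e)) * real n powr (- e) = real n powr (- (1 - e) + - e)"
          by (simp only: powr_add)
        then show ?thesis
          using n by (simp add: powr_minus_divide)
      qed
      finally show ?thesis
        using n by (simp add: field_simps)
    qed
    then have "?x\<^sup>2 \<le> (?D * ?v * (1 / real n) + 3 * ?D * tail_conv n)\<^sup>2"
      by (intro power_mono) (auto simp: R_nonneg)
    also have "\<dots> \<le> 2 * (?D * ?v * (1 / real n))\<^sup>2 + 2 * (3 * ?D * tail_conv n)\<^sup>2"
      by (rule square_add_le)
    finally show "(1 + real n) powr (- (2 * (1 - e))) * (R n)\<^sup>2 \<le>
        2 * ((?D * ?v)\<^sup>2 * (1 / real n ^ 2)) + 2 * ((3 * ?D)\<^sup>2 * (tail_conv n)\<^sup>2)"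
      by (simp add: power_mult_distrib power_divide)
  qed auto
qed

text \<open>A single term of a summable family is bounded by the sum; 9 is the square of the 3 in
  \<open>1 + 2 n \<le> 3 n\<close>. The power \<open>2 m - 1\<close> is that of the lower bound on
  the gaps.\<close>

lemma V_double_bound:
  assumes n: "n \<ge> 1"
  shows "cmod (V (2 * int n)) \<le> sqrt (9 ^ m * infsum v UNIV) * real n ^ (2 * m - 1) * real n powr (- e / 2)"
proof (rule power2_le_imp_le)
  have "v (2 * int n) \<le> infsum v UNIV"
    using finite_sum_le_infsum[OF v_summable, of "{2 * int n}"] by simp
  moreover have "wt (2 * int n) powr (2 * real m - e) \<le> 9 ^ m * (real n ^ (2 * m - 1))\<^sup>2 * real n powr (- e)"
  proof -
    have "wt (2 * int n) powr (2 * real m - e) \<le> (3 * real n) powr (2 * real m - e)"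
      using n m_ge_1 e by (intro powr_mono2) (auto simp: wt_def)
    also have "\<dots> = 3 powr (2 * real m - e) * (real n powr (real (2 * m)) * real n powr (- e))"
      using n by (simp add: powr_mult powr_add[symmetric])
    also have "\<dots> \<le> 9 ^ m * ((real n ^ (2 * m - 1))\<^sup>2 * real n powr (- e))"
    proof (intro mult_mono)
      have "(3 :: real) powr (2 * real m - e) \<le> 3 powr (real (2 * m))"
        using e by (intro powr_mono) auto
      also have "\<dots> = 9 ^ m"
        by (subst powr_realpow) (auto simp: power_mult)
      finally show "(3 :: real) powr (2 * real m - e) \<le> 9 ^ m" .
      have "real n powr (real (2 * m)) = real n ^ (2 * m)"
        by (rule powr_realpow) (use n in simp)
      also have "\<dots> \<le> (real n ^ (2 * m - 1))\<^sup>2"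
        unfolding power_mult[symmetric] using n m_ge_1 by (intro power_increasing) auto
      finally show "real n powr (real (2 * m)) \<le> (real n ^ (2 * m - 1))\<^sup>2" .
    qed auto
    finally show ?thesis
      by simp
  qed
  ultimately have "(cmod (V (2 * int n)))\<^sup>2 \<le>
      (9 ^ m * (real n ^ (2 * m - 1))\<^sup>2 * real n powr (- e)) * infsum v UNIV"
    unfolding V_eq by (intro mult_mono) auto
  also have "\<dots> = (sqrt (9 ^ m * infsum v UNIV) * real n ^ (2 * m - 1) * real n powr (- e / 2))\<^sup>2"
    using n by (simp add: power_mult_distrib powr_power real_sqrt_mult)
  finally show "(cmod (V (2 * int n)))\<^sup>2 \<le>
      (sqrt (9 ^ m * infsum v UNIV) * real n ^ (2 * m - 1) * real n powr (- e / 2))\<^sup>2" .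
qed auto

text \<open>\<open>cmod (V 0)\<close>, \<open>cmod (V (2 n))\<close> and \<open>R n\<close> are all
  of order \<open>n ^ (2 m - 1)\<close> times \<open>n powr (- e / 2)\<close>, whereas every gap is
  at least \<open>(n / 2) ^ (2 m - 1)\<close>. The kernel sum decays by
  \<open>off_kernel_HS\<close>.\<close>

lemma eventually_small:
  assumes "c > 0"
  shows "eventually (\<lambda>n. (\<Sum>\<^sub>\<infinity>(i, j)\<in>off n \<times> off n. (cmod (V (i - j)))\<^sup>2 / (gap n i * gap n j)) \<le> c \<and>
    (\<forall>j\<in>off n. cmod (V 0) + cmod (V (2 * int n)) + 4 * R n \<le> c * gap n j)) sequentially"
proof -
  define C1 where "C1 = 2 * 4 ^ m * 4 ^ (2 * m - 1) * 4 * infsum v UNIV * (\<Sum>\<^sub>\<infinity>j. 1 / (real_of_int j)\<^sup>2)"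
  define C2 where "C2 = cmod (V 0) + sqrt (9 ^ m * infsum v UNIV) + 16 * 4 ^ (2 * m) * infsum v UNIV"
  have lim: "(\<lambda>n. K * real n powr (- p)) \<longlonglongrightarrow> 0" if "p > 0" for K p
    using tendsto_mult_right_zero[OF tendsto_neg_powr[OF _ filterlim_real_sequentially, of "- p"], of K] that
    by simp
  have "eventually (\<lambda>n. C1 * real n powr (- e) < c) sequentially"
    using order_tendstoD(2)[OF lim[OF e(1), of C1] assms] .
  moreover have "eventually (\<lambda>n. C2 * real n powr (- (e / 2)) < c / 2 ^ (2 * m - 1)) sequentially"
    using order_tendstoD(2)[OF lim[of "e / 2" C2], of "c / 2 ^ (2 * m - 1)"] e assms by simp
  moreover have "eventually (\<lambda>n. n \<ge> 1) sequentially"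
    by (rule eventually_ge_at_top)
  ultimately show ?thesis
  proof eventually_elim
    case (elim n)
    let ?N = "real n ^ (2 * m - 1)" and ?p = "real n powr (- e / 2)"
    have n1: "1 \<le> real n"
      using elim by simp
    have N: "real n \<le> ?N"
      using power_increasing[of 1 "2 * m - 1" "real n"] n1 m_ge_1 by simp
    have p1: "1 \<le> ?N * ?p"
    proof -
      have "1 \<le> real n powr (1 + - e / 2)"
        using n1 e by (intro ge_one_powr_ge_zero) auto
      also have "\<dots> = real n * ?p"
        unfolding powr_add using n1 by simp
      also have "\<dots> \<le> ?N * ?p"
        by (intro mult_right_mono N) auto
      finally show ?thesis .
    qed
    have "cmod (V 0) * 1 \<le> cmod (V 0) * (?N * ?p)"
      by (intro mult_left_mono p1) auto
    moreover have "R n \<le> 4 * 4 ^ (2 * m) * infsum v UNIV * (?N * ?p)"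
    proof -
      have "R n \<le> 4 ^ (2 * m) * real n powr (- e) * (infsum v UNIV + 3 * real n * tail_conv n)"
        using elim by (intro R_bound) auto
      also have "\<dots> \<le> 4 ^ (2 * m) * ?p * (?N * infsum v UNIV + 3 * ?N * infsum v UNIV)"
      proof (intro mult_mono add_mono tail_conv_le tail_conv_nonneg N)
        show "real n powr (- e) \<le> ?p"
          using n1 e by (intro powr_mono) auto
        show "infsum v UNIV \<le> ?N * infsum v UNIV"
          using n1 N mult_right_mono[of 1 ?N "infsum v UNIV"] by simp
      qed (use tail_conv_nonneg[of n] in auto)
      finally show ?thesis
        by (simp add: algebra_simps)
    qed
    ultimately have "cmod (V 0) + cmod (V (2 * int n)) + 4 * R n \<le> C2 * (?N * ?p)"
      using V_double_bound[of n] elim unfolding C2_def by (simp add: algebra_simps)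
    also have "\<dots> = (C2 * ?p) * ?N"
      by simp
    also have "\<dots> \<le> c / 2 ^ (2 * m - 1) * ?N"
      using elim by (intro mult_right_mono) auto
    finally have A: "cmod (V 0) + cmod (V (2 * int n)) + 4 * R n \<le> c * (?N / 2 ^ (2 * m - 1))"
      by simp
    have "cmod (V 0) + cmod (V (2 * int n)) + 4 * R n \<le> c * gap n j" if "j \<in> off n" for j
      using A mult_left_mono[OF gap_lower_uniform[OF that], of c] assms by linarith
    then show ?case
      using off_kernel_HS(2)[of n] elim unfolding C1_def by force
  qed
qed

end

section \<open>Localization of the eigenvalues\<close>

context hill_form
begin

lemma off_minus: "j \<in> off n \<Longrightarrow> - j \<in> off n"
  by (auto simp: off_def)

lemma gap_minus: "gap n (- j) = gap n j"
  by (simp add: gap_def off_def mu_def power_mult)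

lemma mu_minus [simp]: "mu (- k) = mu k"
  by (simp add: mu_def power_mult)

text \<open>By conjugate symmetry of \<open>V\<close> the mode \<open>- n\<close> couples to the
  others with the same strength as \<open>n\<close>, so a single \<open>R n\<close> serves
  both.\<close>

lemma R_minus:
  assumes "(\<lambda>j. (cmod (V (int n - j)))\<^sup>2 / gap n j) summable_on off n"
  shows "((\<lambda>j. (cmod (V (- int n - j)))\<^sup>2 / gap n j) has_sum R n) (off n)"
proof -
  have bij: "bij_betw uminus (off n) (off n)"
    by (rule bij_betw_byWitness[where f' = uminus]) (auto simp: off_minus)
  have "((\<lambda>j. (cmod (V (int n - j)))\<^sup>2 / gap n j) has_sum R n) (off n)"
    unfolding R_def by (rule has_sum_infsum[OF assms])
  then have "((\<lambda>j. (cmod (V (int n - - j)))\<^sup>2 / gap n (- j)) has_sum R n) (off n)"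
    by (subst has_sum_reindex_bij_betw[OF bij])
  moreover have "cmod (V (int n - - j)) = cmod (V (- int n - j))" for j
  proof -
    have "int n - - j = - (- int n - j)"
      by simp
    then show ?thesis
      by (simp only: V_minus complex_mod_cnj)
  qed
  ultimately show ?thesis
    by (simp add: gap_minus)
qed

lemma gap_weight_summable:
  assumes "g \<in> X"
  shows "(\<lambda>j. gap n j * (cmod (g j))\<^sup>2) summable_on S"
proof -
  let ?C = "pi ^ (2 * m) + mu (int n) + 1"
  have "(\<lambda>j. ?C * (wt j ^ (2 * m) * (cmod (g j))\<^sup>2)) summable_on UNIV"
    by (intro summable_on_cmult_right XD assms)
  then have "(\<lambda>j. gap n j * (cmod (g j))\<^sup>2) summable_on UNIV"
  proof (rule summable_on_comparison_test)
    fix j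
    have w: "1 \<le> wt j ^ (2 * m)"
      by (intro one_le_power) simp
    have "\<bar>mu j - mu (int n)\<bar> \<le> mu j + mu (int n)"
      using mu_nonneg[of j] mu_nonneg[of "int n"] by linarith
    then have "gap n j \<le> mu j + mu (int n) + 1"
      by (simp add: gap_def)
    also have "\<dots> \<le> pi ^ (2 * m) * wt j ^ (2 * m) + mu (int n) * wt j ^ (2 * m) + wt j ^ (2 * m)"
      using w mu_le_wt[of j] mult_left_mono[OF w mu_nonneg[of "int n"]] by linarith
    finally have "gap n j \<le> ?C * wt j ^ (2 * m)"
      by (simp add: algebra_simps)
    then show "gap n j * (cmod (g j))\<^sup>2 \<le> ?C * (wt j ^ (2 * m) * (cmod (g j))\<^sup>2)"
      unfolding mult.assoc[symmetric] by (rule mult_right_mono) simp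
  qed auto
  then show ?thesis
    by (rule summable_on_subset_banach) auto
qed

lemma oper_unit: "oper (unit_seq j) k = of_real (mu k) * (if k = j then 1 else 0) + V (k - j)"
proof -
  have "conv (unit_seq j) k = V (k - j)"
    unfolding conv_def by (subst infsum_single[of j]) (auto simp: unit_seq_def)
  then show ?thesis
    by (simp add: oper_def unit_seq_def)
qed

text \<open>With \<open>s = 1\<close> the modes outside \<open>\<plusminus>n\<close> lie below \<open>mu n\<close>, with \<open>s = -1\<close> above. The coupling to them
  costs at most \<open>4 R n\<close> times the mass in the modes \<open>\<plusminus>n\<close>, by AM-GM against their gap.\<close>

lemma localized_form_bound:
  assumes n: "n \<ge> 1"
    and HS: "(\<lambda>(i, j). (cmod (V (i - j)))\<^sup>2 / (gap n i * gap n j)) summable_on off n \<times> off n"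
    and HS_le: "(\<Sum>\<^sub>\<infinity>(i, j)\<in>off n \<times> off n. (cmod (V (i - j)))\<^sup>2 / (gap n i * gap n j)) \<le> 1 / 16"
    and Rs: "(\<lambda>j. (cmod (V (int n - j)))\<^sup>2 / gap n j) summable_on off n"
    and small: "\<And>j. j \<in> off n \<Longrightarrow> \<bar>T - mu (int n)\<bar> \<le> gap n j / 4"
    and s: "s = 1 \<or> s = - 1"
    and f: "f \<in> X"
    and side: "\<And>j. j \<in> off n \<Longrightarrow> f j \<noteq> 0 \<Longrightarrow> s * (mu (int n) - mu j) = gap n j"
    and block: "s * ((mu (int n) + Re (V 0) - T) * ((cmod (f (int n)))\<^sup>2 + (cmod (f (- int n)))\<^sup>2) +
      2 * Re (V (2 * int n) * f (- int n) * cnj (f (int n)))) \<le>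
      - (4 * R n * ((cmod (f (int n)))\<^sup>2 + (cmod (f (- int n)))\<^sup>2))"
  shows "s * Re (Q f f) \<le> s * (T * nrm2 f)"
proof -
  define x y where "x = f (int n)" and "y = f (- int n)"
  define p where "p = (\<lambda>k. x * unit_seq (int n) k + y * unit_seq (- int n) k)"
  define g where "g = (\<lambda>k. if k \<in> off n then f k else 0)"
  define P where "P = (cmod x)\<^sup>2 + (cmod y)\<^sup>2"
  define G where "G = (\<Sum>\<^sub>\<infinity>j\<in>off n. gap n j * (cmod (g j))\<^sup>2)"
  have gX: "g \<in> X"
    unfolding g_def by (rule X_restrict[OF f])
  have pX: "p \<in> X"
    unfolding p_def by (rule X_lin[OF X_unit X_unit])
  have g_pm: "g (int n) = 0" "g (- int n) = 0"
    by (auto simp: g_def off_def)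
  have g_off: "g j = 0" if "j \<notin> off n" for j
    using that by (simp add: g_def)
  have g_in: "j \<in> off n" if "g j \<noteq> 0" for j
    using that by (auto simp: g_def split: if_splits)
  have p_pm: "p (int n) = x" "p (- int n) = y"
    using n by (auto simp: p_def unit_seq_def)
  have fpg: "f = (\<lambda>k. p k + 1 * g k)"
    using n by (auto simp: p_def g_def x_def y_def off_def unit_seq_def fun_eq_iff)
  have G0: "0 \<le> G"
    unfolding G_def by (rule infsum_nonneg) auto
  have R0: "0 \<le> R n"
    unfolding R_def by (rule infsum_nonneg) auto
  have s1: "\<bar>s\<bar> = 1"
    using s by auto
  have sle: "s * z \<le> \<bar>z\<bar>" for z
    using s by auto
  have V0: "cnj (V 0) = V 0"
    using V_minus[of 0] by simp
  have Vm: "V (- (2 * int n)) = cnj (V (2 * int n))"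
    by (rule V_minus)

  have Qp: "Q p h = x * Q (unit_seq (int n)) h + y * Q (unit_seq (- int n)) h" if "h \<in> X" for h
    unfolding p_def by (rule Q_lin_left[OF X_unit X_unit that])
  have Qu: "Q (unit_seq k) h = cnj (oper h k)" if "h \<in> X" for h k
    using Q_cnj[OF that X_unit, of k] by simp
  have op: "oper p (int n) = (of_real (mu (int n)) + V 0) * x + V (2 * int n) * y"
    "oper p (- int n) = V (- (2 * int n)) * x + (of_real (mu (int n)) + V 0) * y"
  proof -
    have "oper p k = x * oper (unit_seq (int n)) k + y * oper (unit_seq (- int n)) k" for k
      using Qp[OF X_unit, of k] by simp
    then show "oper p (int n) = (of_real (mu (int n)) + V 0) * x + V (2 * int n) * y"
      "oper p (- int n) = V (- (2 * int n)) * x + (of_real (mu (int n)) + V 0) * y"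
      using n by (auto simp: oper_unit algebra_simps)
  qed
  have Qpp: "Re (Q p p) = (mu (int n) + Re (V 0)) * P + 2 * Re (V (2 * int n) * y * cnj x)"
  proof -
    have "Q p p = x * cnj ((of_real (mu (int n)) + V 0) * x + V (2 * int n) * y) +
        y * cnj (V (- (2 * int n)) * x + (of_real (mu (int n)) + V 0) * y)"
      unfolding Qp[OF pX] Qu[OF pX] op ..
    also have "\<dots> = (of_real (mu (int n)) + V 0) * (x * cnj x + y * cnj y) +
        (V (2 * int n) * y * cnj x + cnj (V (2 * int n) * y * cnj x))"
      unfolding Vm by (simp add: V0 algebra_simps)
    also have "x * cnj x + y * cnj y = of_real P"
      unfolding P_def of_real_add complex_norm_square ..
    also have "V (2 * int n) * y * cnj x + cnj (V (2 * int n) * y * cnj x) =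
        of_real (2 * Re (V (2 * int n) * y * cnj x))"
      by (rule complex_add_cnj)
    finally show ?thesis
      by simp
  qed
  \<comment> \<open>From \<open>(cmod x + cmod y)\<^sup>2 \<le> 2 P\<close>, the squared cross term
    is at most \<open>2 P R G\<close>, written as \<open>(4 R P) (G / 2)\<close> for AM-GM. The
    share \<open>G / 2\<close> is what the next estimate leaves over, and it fixes the constant
    4.\<close>
  have cross: "2 * \<bar>Re (Q p g)\<bar> \<le> 4 * R n * P + G / 2"
  proof -
    have coup: "(cmod (oper g k))\<^sup>2 \<le> R n * G" if k: "k = int n \<or> k = - int n" for k
    proof -
      have "((\<lambda>j. (cmod (V (k - j)))\<^sup>2 / gap n j) has_sum R n) (off n)"
        using k R_minus[OF Rs] has_sum_infsum[OF Rs] by (auto simp: R_def)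
      then have Rk: "(\<lambda>j. (cmod (V (k - j)))\<^sup>2 / gap n j) summable_on off n"
        "(\<Sum>\<^sub>\<infinity>j\<in>off n. (cmod (V (k - j)))\<^sup>2 / gap n j) = R n"
        by (auto simp: summable_on_def infsumI)
      have "oper g k = conv g k"
        using k g_pm by (auto simp: oper_def)
      also have "\<dots> = (\<Sum>\<^sub>\<infinity>j\<in>off n. V (k - j) * g j)"
        unfolding conv_def by (rule infsum_cong_neutral) (auto simp: g_off)
      finally have "oper g k = (\<Sum>\<^sub>\<infinity>j\<in>off n. V (k - j) * g j)" .
      then show ?thesis
        using weighted_product_abs_summable(3)[where R = "gap n", OF gap_pos[OF n] Rk(1) gap_weight_summable[OF gX]]
        unfolding Rk(2) G_def by simp
    qed
    define w where "w = sqrt (R n * G)"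
    have w: "cmod (oper g (int n)) \<le> w" "cmod (oper g (- int n)) \<le> w" "0 \<le> w" "w\<^sup>2 = R n * G"
      using coup R0 G0 by (auto simp: w_def intro: real_le_rsqrt)
    have "\<bar>Re (Q p g)\<bar> \<le> cmod (Q p g)"
      by (rule abs_Re_le_cmod)
    also have "\<dots> \<le> cmod x * cmod (oper g (int n)) + cmod y * cmod (oper g (- int n))"
      unfolding Qp[OF gX] Qu[OF gX] by (rule order.trans[OF norm_triangle_ineq]) (simp add: norm_mult)
    also have "\<dots> \<le> cmod x * w + cmod y * w"
      using w by (intro add_mono mult_left_mono) auto
    finally have "\<bar>Re (Q p g)\<bar> \<le> (cmod x + cmod y) * w"
      by (simp add: algebra_simps)
    then have 1: "2 * \<bar>Re (Q p g)\<bar> \<le> 2 * ((cmod x + cmod y) * w)"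
      by simp
    have "((cmod x + cmod y) * w)\<^sup>2 = (cmod x + cmod y)\<^sup>2 * (R n * G)"
      by (simp add: power_mult_distrib w)
    also have "\<dots> \<le> (2 * P) * (R n * G)"
      using sum_squares_bound[of "cmod x" "cmod y"] R0 G0
      by (intro mult_right_mono) (auto simp: power2_sum P_def)
    also have "\<dots> = (4 * R n * P) * (G / 2)"
      by simp
    finally have "2 * \<bar>(cmod x + cmod y) * w\<bar> \<le> 4 * R n * P + G / 2"
      using R0 G0 by (intro two_abs_le_add_if_square_le) (auto simp: P_def)
    with 1 show ?thesis
      using abs_ge_self[of "(cmod x + cmod y) * w"] by linarith
  qed
  \<comment> \<open>The gap energy \<open>G\<close> is spent as follows: a quarter on the potential
    among the other modes, a quarter on the shift from \<open>mu n\<close> to \<open>T\<close>; half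
    remains.\<close>
  have Qgg: "s * (Re (Q g g) - T * nrm2 g) \<le> - (G / 2)"
  proof -
    let ?M = "\<Sum>\<^sub>\<infinity>k. of_real (mu k) * g k * cnj (g k)"
    let ?W = "\<Sum>\<^sub>\<infinity>(k, j). V (k - j) * g j * cnj (g k)"
    note hs = hilbert_schmidt_form[where A = "\<lambda>k j. V (k - j)" and P = "gap n", OF HS gap_pos[OF n]
        gap_weight_summable[OF gX] gap_weight_summable[OF gX]]
    have W: "cmod ?W \<le> G / 4"
    proof -
      have "?W = (\<Sum>\<^sub>\<infinity>(k, j)\<in>off n \<times> off n. V (k - j) * g j * cnj (g k))"
        by (rule infsum_cong_neutral) (auto dest: g_in)
      then have "cmod ?W \<le> (\<Sum>\<^sub>\<infinity>(k, j)\<in>off n \<times> off n. cmod (V (k - j) * g j * cnj (g k)))"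
        using norm_infsum_bound[OF hs(1)] by (simp add: case_prod_unfold)
      also have "\<dots> \<le> G / 4"
      proof (rule power2_le_imp_le)
        have "(\<Sum>\<^sub>\<infinity>(k, j)\<in>off n \<times> off n. cmod (V (k - j) * g j * cnj (g k)))\<^sup>2 \<le> (1 / 16) * (G * G)"
          unfolding G_def by (rule order.trans[OF hs(2)], intro mult_right_mono HS_le)
            (auto intro!: mult_nonneg_nonneg infsum_nonneg)
        then show "(\<Sum>\<^sub>\<infinity>(k, j)\<in>off n \<times> off n. cmod (V (k - j) * g j * cnj (g k)))\<^sup>2 \<le> (G / 4)\<^sup>2"
          by (simp add: power2_eq_square)
      qed (use G0 in simp)
      finally show ?thesis .
    qed
    have M: "((\<lambda>k. mu k * (cmod (g k))\<^sup>2) has_sum Re ?M) UNIV"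
      by (rule mu_form_has_sum) (rule gX)
    have N: "((\<lambda>k. (cmod (g k))\<^sup>2) has_sum nrm2 g) UNIV"
      unfolding nrm2_def by (intro has_sum_infsum X_l2 gX)
    have GU: "((\<lambda>j. gap n j * (cmod (g j))\<^sup>2) has_sum G) UNIV"
    proof -
      have "((\<lambda>j. gap n j * (cmod (g j))\<^sup>2) has_sum G) (off n)"
        unfolding G_def by (intro has_sum_infsum gap_weight_summable gX)
      then show ?thesis
        by (rule iffD1[OF has_sum_cong_neutral, rotated -1]) (auto simp: g_off)
    qed
    have "((\<lambda>k. s * (mu (int n) * (cmod (g k))\<^sup>2 + - 1 * (mu k * (cmod (g k))\<^sup>2))) has_sum
        s * (mu (int n) * nrm2 g + - 1 * Re ?M)) UNIV"
      by (intro has_sum_cmult_right has_sum_add M N)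
    moreover have "s * (mu (int n) * (cmod (g k))\<^sup>2 + - 1 * (mu k * (cmod (g k))\<^sup>2)) = gap n k * (cmod (g k))\<^sup>2" for k
    proof (cases "k \<in> off n \<and> f k \<noteq> 0")
      case True
      then have "s * (mu (int n) - mu k) * (cmod (g k))\<^sup>2 = gap n k * (cmod (g k))\<^sup>2"
        by (subst side) auto
      then show ?thesis
        by (simp add: algebra_simps)
    next
      case False
      then have "g k = 0"
        by (auto simp: g_def)
      then show ?thesis
        by simp
    qed
    ultimately have MG: "s * (mu (int n) * nrm2 g - Re ?M) = G"
      using has_sum_unique[OF GU] by simp
    have TG: "\<bar>T - mu (int n)\<bar> * nrm2 g \<le> G / 4"
    proof -
      have "((\<lambda>k. \<bar>T - mu (int n)\<bar> * (cmod (g k))\<^sup>2) has_sum \<bar>T - mu (int n)\<bar> * nrm2 g) UNIV"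
        by (intro has_sum_cmult_right N)
      moreover have "((\<lambda>k. 1 / 4 * (gap n k * (cmod (g k))\<^sup>2)) has_sum 1 / 4 * G) UNIV"
        by (intro has_sum_cmult_right GU)
      ultimately have "\<bar>T - mu (int n)\<bar> * nrm2 g \<le> 1 / 4 * G"
      proof (rule has_sum_mono)
        fix k
        show "\<bar>T - mu (int n)\<bar> * (cmod (g k))\<^sup>2 \<le> 1 / 4 * (gap n k * (cmod (g k))\<^sup>2)"
          using mult_right_mono[OF small[of k], of "(cmod (g k))\<^sup>2"] g_off[of k]
          by (cases "k \<in> off n") auto
      qed
      then show ?thesis
        by simp
    qed
    have "s * (Re (Q g g) - T * nrm2 g) =
        - (s * (mu (int n) * nrm2 g - Re ?M)) + s * Re ?W + s * ((mu (int n) - T) * nrm2 g)"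
      unfolding Q_split(1)[OF gX gX] plus_complex.sel by (simp add: algebra_simps)
    also have "\<dots> \<le> - G + G / 4 + G / 4"
    proof (intro add_mono)
      show "s * Re ?W \<le> G / 4"
        using sle[of "Re ?W"] abs_Re_le_cmod[of ?W] W by linarith
      have "\<bar>(mu (int n) - T) * nrm2 g\<bar> = \<bar>T - mu (int n)\<bar> * nrm2 g"
        by (simp add: abs_mult abs_minus_commute)
      then show "s * ((mu (int n) - T) * nrm2 g) \<le> G / 4"
        using sle[of "(mu (int n) - T) * nrm2 g"] TG by linarith
    qed (simp add: MG)
    finally show ?thesis
      by simp
  qed
  have nf: "nrm2 f = P + nrm2 g"
  proof -
    have ipp: "ip p h = x * cnj (h (int n)) + y * cnj (h (- int n))" if "h \<in> X" for h
      unfolding p_def ip_lin_left[OF X_unit X_unit that]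
      using ip_cnj[of "unit_seq (int n)" h] ip_cnj[of "unit_seq (- int n)" h] by simp
    have "of_real (nrm2 p) = x * cnj x + y * cnj y"
      unfolding ip_self[OF X_l2[OF pX], symmetric] ipp[OF pX] p_pm ..
    also have "\<dots> = of_real P"
      unfolding P_def of_real_add complex_norm_square ..
    finally have "nrm2 p = P"
      unfolding of_real_eq_iff .
    moreover have "ip p g = 0"
      unfolding ipp[OF gX] g_pm by simp
    ultimately show ?thesis
      unfolding fpg nrm2_expand[OF pX gX] by simp
  qed
  have qf: "Re (Q f f) = Re (Q p p) + 2 * Re (Q p g) + Re (Q g g)"
    unfolding fpg Q_expand[OF pX gX] by simp
  have "s * Re (Q f f) - s * (T * nrm2 f) =
      s * ((mu (int n) + Re (V 0) - T) * P + 2 * Re (V (2 * int n) * y * cnj x)) +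
      s * (2 * Re (Q p g)) + s * (Re (Q g g) - T * nrm2 g)"
    unfolding qf nf Qpp by (simp add: algebra_simps)
  also have "\<dots> \<le> - (4 * R n * P) + (4 * R n * P + G / 2) + - (G / 2)"
  proof (intro add_mono Qgg)
    show "s * ((mu (int n) + Re (V 0) - T) * P + 2 * Re (V (2 * int n) * y * cnj x)) \<le> - (4 * R n * P)"
      using block by (simp add: P_def x_def y_def)
    show "s * (2 * Re (Q p g)) \<le> 4 * R n * P + G / 2"
      using sle[of "2 * Re (Q p g)"] cross by (simp add: abs_mult)
  qed
  finally show ?thesis
    by simp
qed

lemma mu_le_mono: "\<bar>i\<bar> \<le> \<bar>j\<bar> \<Longrightarrow> mu i \<le> mu j"
proof -
  assume ij: "\<bar>i\<bar> \<le> \<bar>j\<bar>"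
  have "\<bar>real_of_int i\<bar> \<le> \<bar>real_of_int j\<bar>"
    using ij by linarith
  then show ?thesis
    unfolding mu_abs by (intro power_mono mult_left_mono) auto
qed

end

lemma Re_mult_cnj_bound: "\<bar>2 * Re (z * y * cnj x)\<bar> \<le> cmod z * ((cmod x)\<^sup>2 + (cmod y)\<^sup>2)"
proof -
  have "\<bar>2 * Re (z * y * cnj x)\<bar> \<le> 2 * cmod (z * y * cnj x)"
    using abs_Re_le_cmod[of "z * y * cnj x"] by simp
  also have "\<dots> = cmod z * (2 * cmod x * cmod y)"
    by (simp add: norm_mult)
  also have "\<dots> \<le> cmod z * ((cmod x)\<^sup>2 + (cmod y)\<^sup>2)"
    by (intro mult_left_mono sum_squares_bound) auto
  finally show ?thesis .
qed

section \<open>The two eigenvalues near \<open>mu n\<close>\<close>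

context hill_spectrum
begin

text \<open>The block has eigenvalues \<open>c + B\<close> and \<open>c - B\<close>, and each of the
  two eigenvalues of the operator lies within \<open>4 R n\<close> of its counterpart. Upper bounds
  use trial spaces of dimension \<open>2 n + 1\<close> (all modes up to \<open>n\<close>) and
  \<open>2 n\<close> (only the lower block vector at \<plusminus>n); lower bounds use
  \<open>2 n\<close> and \<open>2 n - 1\<close> constraints. Indices start at 0, so these numbers
  match \<open>l (2 n)\<close> and \<open>l (2 n - 1)\<close>.\<close>

lemma eigenvalue_localization:
  assumes n: "n \<ge> 1"
    and HS: "(\<lambda>(i, j). (cmod (V (i - j)))\<^sup>2 / (gap n i * gap n j)) summable_on off n \<times> off n"
    and HS_le: "(\<Sum>\<^sub>\<infinity>(i, j)\<in>off n \<times> off n. (cmod (V (i - j)))\<^sup>2 / (gap n i * gap n j)) \<le> 1 / 16"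
    and Rs: "(\<lambda>j. (cmod (V (int n - j)))\<^sup>2 / gap n j) summable_on off n"
    and small: "\<And>j. j \<in> off n \<Longrightarrow> cmod (V 0) + cmod (V (2 * int n)) + 4 * R n \<le> gap n j / 4"
  shows "\<bar>l (2 * n) - l (2 * n - 1) - 2 * cmod (V (2 * int n))\<bar> \<le> 8 * R n"
proof -
  define c where "c = mu (int n) + Re (V 0)"
  define B where "B = cmod (V (2 * int n))"
  have B0: "0 \<le> B"
    by (simp add: B_def)
  have R0: "0 \<le> R n"
    unfolding R_def by (rule infsum_nonneg) auto
  \<comment> \<open>\<sigma> is the phase of \<open>V (2 n)\<close>; for \<open>V (2 n) = 0\<close>
    any unit number would do. The block eigenvectors are \<open>(\<sigma>, 1)\<close> for
    \<open>c + B\<close> and \<open>(- \<sigma>, 1)\<close> for \<open>c - B\<close>.\<close>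
  obtain \<sigma> where \<sigma>: "cmod \<sigma> = 1" "V (2 * int n) = of_real B * \<sigma>"
  proof (cases "V (2 * int n) = 0")
    case True
    then show ?thesis
      by (intro that[of 1]) (auto simp: B_def)
  next
    case False
    then show ?thesis
      by (intro that[of "V (2 * int n) / of_real B"]) (auto simp: B_def norm_divide)
  qed
  have \<sigma>c: "\<sigma> * cnj \<sigma> = 1"
    using \<sigma>(1) complex_norm_square[of \<sigma>] by simp
  have sm: "\<bar>c + t - mu (int n)\<bar> \<le> gap n j / 4" if "j \<in> off n" "\<bar>t\<bar> \<le> B + 4 * R n" for t j
    using small[OF that(1)] that(2) abs_Re_le_cmod[of "V 0"] unfolding c_def B_def by linarith
  note form = localized_form_bound[OF n HS HS_le Rs]
  let ?P = "\<lambda>f :: int \<Rightarrow> complex. (cmod (f (int n)))\<^sup>2 + (cmod (f (- int n)))\<^sup>2"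
  have Vb: "\<bar>2 * Re (V (2 * int n) * f (- int n) * cnj (f (int n)))\<bar> \<le> B * ?P f" for f
    unfolding B_def by (rule Re_mult_cnj_bound)
  have up: "Re (Q f f) \<le> (c + t) * nrm2 f"
    if "f \<in> X" "\<And>j. int n < \<bar>j\<bar> \<Longrightarrow> f j = 0" "\<bar>t\<bar> \<le> B + 4 * R n"
      "2 * Re (V (2 * int n) * f (- int n) * cnj (f (int n))) \<le> (t - 4 * R n) * ?P f" for f t
  proof -
    have "1 * Re (Q f f) \<le> 1 * ((c + t) * nrm2 f)"
    proof (rule form[OF sm])
      fix j assume j: "j \<in> off n" "f j \<noteq> 0"
      then have "\<bar>j\<bar> \<le> \<bar>int n\<bar>"
        using that(2)[of j] by fastforce
      then show "1 * (mu (int n) - mu j) = gap n j"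
        using mu_le_mono[of j "int n"] j by (simp add: gap_def)
    next
      have "(mu (int n) + Re (V 0) - (c + t)) * ?P f = - (t * ?P f)"
        unfolding c_def by (simp add: algebra_simps)
      then show "1 * ((mu (int n) + Re (V 0) - (c + t)) * ?P f +
          2 * Re (V (2 * int n) * f (- int n) * cnj (f (int n)))) \<le> - (4 * R n * ?P f)"
        using that(4) by (simp add: left_diff_distrib)
    qed (use that in auto)
    then show ?thesis
      by simp
  qed
  have low: "(c + t) * nrm2 f \<le> Re (Q f f)"
    if "f \<in> X" "\<And>j. \<bar>j\<bar> < int n \<Longrightarrow> f j = 0" "\<bar>t\<bar> \<le> B + 4 * R n"
      "(t + 4 * R n) * ?P f \<le> 2 * Re (V (2 * int n) * f (- int n) * cnj (f (int n)))" for f t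
  proof -
    have "- 1 * Re (Q f f) \<le> - 1 * ((c + t) * nrm2 f)"
    proof (rule form[OF sm])
      fix j assume j: "j \<in> off n" "f j \<noteq> 0"
      then have "\<bar>int n\<bar> \<le> \<bar>j\<bar>"
        using that(2)[of j] by fastforce
      then show "- 1 * (mu (int n) - mu j) = gap n j"
        using mu_le_mono[of "int n" j] j by (simp add: gap_def)
    next
      have "(mu (int n) + Re (V 0) - (c + t)) * ?P f = - (t * ?P f)"
        unfolding c_def by (simp add: algebra_simps)
      then show "- 1 * ((mu (int n) + Re (V 0) - (c + t)) * ?P f +
          2 * Re (V (2 * int n) * f (- int n) * cnj (f (int n)))) \<le> - (4 * R n * ?P f)"
        using that(4) by (simp add: distrib_right)
    qed (use that in auto)
    then show ?thesis
      by simp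
  qed

  have unit_sum: "(\<Sum>i\<in>I. a i * unit_seq i k) = (if k \<in> I then a k else 0)"
    if "finite I" for I a k
  proof -
    have "(\<Sum>i\<in>I. a i * unit_seq i k) = (\<Sum>i\<in>I. if k = i then a i else 0)"
      by (intro sum.cong) (auto simp: unit_seq_def)
    then show ?thesis
      using that by simp
  qed
  have nrm_pos: "0 < nrm2 f" if "f \<in> X" "f k \<noteq> 0" for f k
  proof -
    have "nrm2 f \<noteq> 0"
      using nrm2_eq_0D[OF X_l2[OF that(1)]] that(2) by auto
    then show ?thesis
      using nrm2_nonneg[of f] by linarith
  qed

  have 1: "l (2 * n) \<le> c + (B + 4 * R n)"
  proof (rule eigenvalue_le[where I = "{- int n..int n}" and p = unit_seq])
    fix a :: "int \<Rightarrow> complex" assume a: "\<exists>i\<in>{- int n..int n}. a i \<noteq> 0"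
    let ?f = "\<lambda>k. \<Sum>i\<in>{- int n..int n}. a i * unit_seq i k"
    have fX: "?f \<in> X"
      by (intro X_sum X_unit) auto
    have "?f k = 0" if "int n < \<bar>k\<bar>" for k
      using that by (subst unit_sum) auto
    moreover have "2 * Re (V (2 * int n) * ?f (- int n) * cnj (?f (int n))) \<le> ((B + 4 * R n) - 4 * R n) * ?P ?f"
      using Vb[of ?f] by simp
    ultimately have "Re (Q ?f ?f) \<le> (c + (B + 4 * R n)) * nrm2 ?f"
      using B0 R0 by (intro up fX) auto
    moreover obtain k where "?f k \<noteq> 0"
    proof -
      obtain i where "i \<in> {- int n..int n}" "a i \<noteq> 0"
        using a by blast
      then have "?f i \<noteq> 0"
        by (subst unit_sum) auto
      then show ?thesis
        by (rule that)
    qed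
    ultimately show "0 < nrm2 ?f \<and> Re (Q ?f ?f) \<le> (c + (B + 4 * R n)) * nrm2 ?f"
      using nrm_pos[OF fX] by blast
  qed (auto intro: X_unit)
  have 2: "l (2 * n - 1) \<le> c + (- B + 4 * R n)"
  proof -
    \<comment> \<open>The slot \<open>- n\<close> carries the lower block eigenvector, so the trial
      space contains just one direction in the modes \<plusminus>n.\<close>
    define u where "u i = (if i = - int n then (\<lambda>k. - \<sigma> * unit_seq (int n) k + 1 * unit_seq (- int n) k) else unit_seq i)" for i
    have uX: "u i \<in> X" for i
      using X_lin[OF X_unit X_unit, of "- \<sigma>" "int n" 1 "- int n"] X_unit by (simp add: u_def)
    show ?thesis
    proof (rule eigenvalue_le[where I = "{- int n..<int n}" and p = u])
      fix a :: "int \<Rightarrow> complex" assume a: "\<exists>i\<in>{- int n..<int n}. a i \<noteq> 0"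
      let ?f = "\<lambda>k. \<Sum>i\<in>{- int n..<int n}. a i * u i k"
      have fX: "?f \<in> X"
        by (intro X_sum uX) auto
      have fk: "?f k = (if k = int n then - \<sigma> * a (- int n) else if k \<in> {- int n..<int n} then a k else 0)" for k
      proof -
        have "?f k = (\<Sum>i\<in>{- int n..<int n}. a i * unit_seq i k +
            (if i = - int n then - \<sigma> * a (- int n) * unit_seq (int n) k else 0))"
          by (intro sum.cong) (auto simp: u_def algebra_simps)
        also have "\<dots> = (if k \<in> {- int n..<int n} then a k else 0) + - \<sigma> * a (- int n) * unit_seq (int n) k"
          using n by (simp add: sum.distrib unit_sum)
        finally show ?thesis
          by (auto simp: unit_seq_def)
      qed
      have xy: "?f (int n) = - \<sigma> * a (- int n)" "?f (- int n) = a (- int n)"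
        using n by (auto simp: fk)
      have "V (2 * int n) * ?f (- int n) * cnj (?f (int n)) = - of_real B * (\<sigma> * cnj \<sigma>) * (a (- int n) * cnj (a (- int n)))"
        unfolding xy \<sigma>(2) by (simp add: mult_ac)
      also have "\<dots> = of_real (- B * (cmod (a (- int n)))\<^sup>2)"
        unfolding \<sigma>c of_real_mult complex_norm_square by simp
      finally have Re: "2 * Re (V (2 * int n) * ?f (- int n) * cnj (?f (int n))) = - B * (2 * (cmod (a (- int n)))\<^sup>2)"
        by simp
      have P: "?P ?f = 2 * (cmod (a (- int n)))\<^sup>2"
        unfolding xy by (simp add: norm_mult \<sigma>)
      have "?f k = 0" if "int n < \<bar>k\<bar>" for k
        using that unfolding fk by auto
      moreover have "2 * Re (V (2 * int n) * ?f (- int n) * cnj (?f (int n))) \<le> ((- B + 4 * R n) - 4 * R n) * ?P ?f"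
        unfolding Re P by simp
      ultimately have "Re (Q ?f ?f) \<le> (c + (- B + 4 * R n)) * nrm2 ?f"
        using B0 R0 by (intro up fX) auto
      moreover obtain k where "?f k \<noteq> 0"
      proof -
        obtain i where "i \<in> {- int n..<int n}" "a i \<noteq> 0"
          using a by blast
        then have "?f i \<noteq> 0"
          unfolding fk by auto
        then show ?thesis
          by (rule that)
      qed
      ultimately show "0 < nrm2 ?f \<and> Re (Q ?f ?f) \<le> (c + (- B + 4 * R n)) * nrm2 ?f"
        using nrm_pos[OF fX] by blast
    qed (use n in \<open>auto intro: uX\<close>)
  qed
  have 3: "c + (B - 4 * R n) \<le> l (2 * n)"
  proof -
    \<comment> \<open>The same lower block eigenvector, multiplied by \<open>- cnj \<sigma>\<close>.
      Orthogonality to it forces \<open>f n = \<sigma> f (- n)\<close>, the direction of the upper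
      one.\<close>
    define u where "u i = (if i = - int n then (\<lambda>k. 1 * unit_seq (int n) k + (- cnj \<sigma>) * unit_seq (- int n) k) else unit_seq i)" for i
    have uX: "u i \<in> X" for i
      using X_lin[OF X_unit X_unit, of 1 "int n" "- cnj \<sigma>" "- int n"] X_unit by (simp add: u_def)
    show ?thesis
    proof (rule eigenvalue_ge[where J = "{- int n..<int n}" and u = u])
      fix f assume f: "f \<in> X" "\<And>j. j \<in> {- int n..<int n} \<Longrightarrow> ip f (u j) = 0"
      have xy: "f (int n) = \<sigma> * f (- int n)"
      proof -
        have "ip (u (- int n)) f = cnj (f (int n)) - cnj \<sigma> * cnj (f (- int n))"
          unfolding u_def using ip_lin_left[OF X_unit X_unit f(1), of 1 "int n" "- cnj \<sigma>" "- int n"]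
            ip_cnj[of "unit_seq (int n)" f] ip_cnj[of "unit_seq (- int n)" f] by simp
        moreover have "ip (u (- int n)) f = 0"
          using ip_cnj[of "u (- int n)" f] f(2)[of "- int n"] n by simp
        ultimately have "cnj (f (int n)) = cnj (\<sigma> * f (- int n))"
          by simp
        then show ?thesis
          unfolding complex_cnj_cancel_iff .
      qed
      have "f j = 0" if "\<bar>j\<bar> < int n" for j
      proof -
        have "j \<in> {- int n..<int n}" "j \<noteq> - int n"
          using that by auto
        then show ?thesis
          using f(2)[of j] by (simp add: u_def)
      qed
      moreover
      have "V (2 * int n) * f (- int n) * cnj (f (int n)) = of_real B * (\<sigma> * cnj \<sigma>) * (f (- int n) * cnj (f (- int n)))"
        unfolding xy \<sigma>(2) by (simp add: mult_ac)
      then have F: "V (2 * int n) * f (- int n) * cnj (f (int n)) = of_real (B * (cmod (f (- int n)))\<^sup>2)"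
        unfolding \<sigma>c of_real_mult complex_norm_square by simp
      have P: "?P f = 2 * (cmod (f (- int n)))\<^sup>2"
        unfolding xy by (simp add: norm_mult \<sigma>)
      then have "((B - 4 * R n) + 4 * R n) * ?P f \<le> 2 * Re (V (2 * int n) * f (- int n) * cnj (f (int n)))"
        unfolding F P by simp
      ultimately show "(c + (B - 4 * R n)) * nrm2 f \<le> Re (Q f f)"
        using B0 R0 by (intro low f(1)) auto
    qed (use n in \<open>auto intro: uX\<close>)
  qed
  have 4: "c + (- B - 4 * R n) \<le> l (2 * n - 1)"
  proof (rule eigenvalue_ge[where J = "{- int n<..<int n}" and u = unit_seq])
    fix f assume f: "f \<in> X" "\<And>j. j \<in> {- int n<..<int n} \<Longrightarrow> ip f (unit_seq j) = 0"
    have "f j = 0" if "\<bar>j\<bar> < int n" for j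
    proof -
      have "j \<in> {- int n<..<int n}"
        using that by auto
      then show ?thesis
        using f(2)[of j] by simp
    qed
    moreover have "((- B - 4 * R n) + 4 * R n) * ?P f \<le> 2 * Re (V (2 * int n) * f (- int n) * cnj (f (int n)))"
      using Vb[of f] by simp
    ultimately show "(c + (- B - 4 * R n)) * nrm2 f \<le> Re (Q f f)"
      using B0 R0 by (intro low f(1)) auto
  qed (use n in \<open>auto intro: X_unit\<close>)
  show ?thesis
    using 1 2 3 4 unfolding B_def[symmetric] by linarith
qed

end

section \<open>Orthonormal bases of the eigenspaces\<close>

context hill_form
begin

lemma ip_orthonormal_sum:
  assumes "finite I" "\<And>i. i \<in> I \<Longrightarrow> \<psi> i \<in> X"
    "\<And>i j. i \<in> I \<Longrightarrow> j \<in> I \<Longrightarrow> ip (\<psi> i) (\<psi> j) = (if i = j then 1 else 0)" "j \<in> I"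
  shows "ip (\<lambda>k. \<Sum>i\<in>I. c i * \<psi> i k) (\<psi> j) = c j"
proof -
  have "ip (\<lambda>k. \<Sum>i\<in>I. c i * \<psi> i k) (\<psi> j) = (\<Sum>i\<in>I. c i * ip (\<psi> i) (\<psi> j))"
    by (rule ip_sum_left) (use assms in auto)
  also have "\<dots> = (\<Sum>i\<in>I. if i = j then c i else 0)"
    using assms by (intro sum.cong) auto
  also have "\<dots> = c j"
    using assms by simp
  finally show ?thesis .
qed

lemma normalize:
  assumes "f \<in> X" "f \<noteq> (\<lambda>_. 0)"
  obtains c where "ip (\<lambda>k. c * f k) (\<lambda>k. c * f k) = 1"
proof -
  have "nrm2 f \<noteq> 0"
    using nrm2_eq_0D[OF X_l2[OF assms(1)]] assms(2) by blast
  then have p: "0 < nrm2 f"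
    using nrm2_nonneg[of f] by linarith
  let ?c = "complex_of_real (1 / sqrt (nrm2 f))"
  have "nrm2 (\<lambda>_. 0) = 0" "ip (\<lambda>_. 0) f = 0"
    by (simp_all add: nrm2_def ip_def)
  then have "nrm2 (\<lambda>k. ?c * f k) = (cmod ?c)\<^sup>2 * nrm2 f"
    using nrm2_expand[OF X_zero assms(1), of ?c] by simp
  also have "\<dots> = 1"
    using p by (simp add: norm_divide power_divide)
  finally show ?thesis
    using that[of ?c] ip_self[OF X_l2[OF X_scale[OF assms(1), of ?c]]] by simp
qed

text \<open>Gram-Schmidt by dimension counts. With fewer than \<open>d\<close> vectors, an
  underdetermined system yields a nonzero element of \<open>S\<close> orthogonal to them. With
  \<open>d\<close> vectors nothing is left, since \<open>d + 1\<close> orthonormal sequences in the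
  span of \<open>d\<close> would satisfy a nontrivial linear relation.\<close>

lemma orthonormal_basis:
  fixes d :: nat
  assumes S: "S \<subseteq> X" "\<And>a b f g. f \<in> S \<Longrightarrow> g \<in> S \<Longrightarrow> (\<lambda>k. a * f k + b * g k) \<in> S"
    and b: "finite J" "card J = d" "\<And>j. j \<in> J \<Longrightarrow> b j \<in> S"
    and indep: "\<And>c. (\<lambda>k. \<Sum>j\<in>J. c j * b j k) = (\<lambda>_. 0) \<Longrightarrow> \<forall>j\<in>J. c j = 0"
    and span: "\<And>f. f \<in> S \<Longrightarrow> \<exists>c. f = (\<lambda>k. \<Sum>j\<in>J. c j * b j k)"
  obtains \<psi> :: "nat \<Rightarrow> int \<Rightarrow> complex" where "\<And>i. i < d \<Longrightarrow> \<psi> i \<in> S"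
    "\<And>i j. i < d \<Longrightarrow> j < d \<Longrightarrow> ip (\<psi> i) (\<psi> j) = (if i = j then 1 else 0)"
    "\<And>f. f \<in> S \<Longrightarrow> (\<And>i. i < d \<Longrightarrow> ip f (\<psi> i) = 0) \<Longrightarrow> f = (\<lambda>_. 0)"
proof -
  define P where "P r \<psi> \<longleftrightarrow> (\<forall>i<r. \<psi> i \<in> S) \<and> (\<forall>i<r. \<forall>j<r. ip (\<psi> i) (\<psi> j) = (if i = j then 1 else 0))"
    for r :: nat and \<psi> :: "nat \<Rightarrow> int \<Rightarrow> complex"
  have scaleS: "(\<lambda>k. a * f k) \<in> S" if "f \<in> S" for a f
    using S(2)[OF that that, of a 0] by simp
  have sumS: "(\<lambda>k. \<Sum>j\<in>J'. c j * b j k) \<in> S" if "finite J'" "J' \<noteq> {}" "J' \<subseteq> J" for c J'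
    using that
  proof (induction rule: finite_ne_induct)
    case (insert x F)
    then show ?case
      using S(2)[of "b x" "\<lambda>k. \<Sum>j\<in>F. c j * b j k" "c x" 1] b(3) by auto
  qed (use b(3) scaleS in auto)
  have extend: "\<exists>\<psi>'. P (Suc r) \<psi>'" if \<psi>: "P r \<psi>" and f: "f \<in> S" "f \<noteq> (\<lambda>_. 0)" "\<And>i. i < r \<Longrightarrow> ip f (\<psi> i) = 0" for r \<psi> f
  proof -
    have fX: "f \<in> X"
      using f(1) S(1) by blast
    obtain c where c: "ip (\<lambda>k. c * f k) (\<lambda>k. c * f k) = 1"
      by (rule normalize[OF fX f(2)])
    have z: "ip (\<lambda>k. c * f k) (\<psi> i) = 0" if "i < r" for i
      using ip_lin_left[OF fX X_zero, of "\<psi> i" c 0] f(3)[OF that] \<psi> that S(1) by (auto simp: P_def)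
    have z': "ip (\<psi> i) (\<lambda>k. c * f k) = 0" if "i < r" for i
      using ip_cnj[of "\<psi> i" "\<lambda>k. c * f k"] z[OF that] by simp
    have "P (Suc r) (\<psi>(r := (\<lambda>k. c * f k)))"
      using \<psi> scaleS[OF f(1)] z z' c by (auto simp: P_def less_Suc_eq)
    then show ?thesis
      by blast
  qed
  have "r \<le> d \<Longrightarrow> \<exists>\<psi>. P r \<psi>" for r
  proof (induction r)
    case 0
    show ?case
      by (simp add: P_def)
  next
    case (Suc r)
    then obtain \<psi> where \<psi>: "P r \<psi>"
      by auto
    obtain c where c: "\<exists>j\<in>J. c j \<noteq> 0" "\<forall>i\<in>{..<r}. (\<Sum>j\<in>J. c j * ip (b j) (\<psi> i)) = 0"
      using homogeneous_system_nontrivial[of J "{..<r}" "\<lambda>j i. ip (b j) (\<psi> i)"] Suc.prems b by auto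
    show ?case
    proof (rule extend[OF \<psi>])
      show "(\<lambda>k. \<Sum>j\<in>J. c j * b j k) \<in> S"
        using b(1) c(1) by (intro sumS) auto
      show "(\<lambda>k. \<Sum>j\<in>J. c j * b j k) \<noteq> (\<lambda>_. 0)"
        using indep c(1) by blast
      show "ip (\<lambda>k. \<Sum>j\<in>J. c j * b j k) (\<psi> i) = 0" if "i < r" for i
        using c(2) that \<psi> b S(1) by (subst ip_sum_left) (auto simp: P_def)
    qed
  qed
  then obtain \<psi> where \<psi>: "P d \<psi>"
    by blast
  show ?thesis
  proof (rule that[of \<psi>])
    fix f assume f: "f \<in> S" "\<And>i. i < d \<Longrightarrow> ip f (\<psi> i) = 0"
    show "f = (\<lambda>_. 0)"
    proof (rule ccontr)
      assume "f \<noteq> (\<lambda>_. 0)"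
      then obtain \<psi>' where \<psi>': "P (Suc d) \<psi>'"
        using extend[OF \<psi> f(1)] f(2) by blast
      have "\<exists>c. \<psi>' i = (\<lambda>k. \<Sum>j\<in>J. c j * b j k)" if "i < Suc d" for i
        using span \<psi>' that by (auto simp: P_def)
      then obtain A where A: "\<psi>' i = (\<lambda>k. \<Sum>j\<in>J. A i j * b j k)" if "i < Suc d" for i
        by metis
      obtain c where c: "\<exists>i\<in>{..<Suc d}. c i \<noteq> 0" "\<forall>j\<in>J. (\<Sum>i<Suc d. c i * A i j) = 0"
        using homogeneous_system_nontrivial[of "{..<Suc d}" J A] b by auto
      have "(\<Sum>i<Suc d. c i * \<psi>' i k) = 0" for k
      proof -
        have "(\<Sum>i<Suc d. c i * \<psi>' i k) = (\<Sum>i<Suc d. \<Sum>j\<in>J. c i * A i j * b j k)"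
          by (intro sum.cong) (auto simp: A sum_distrib_left mult.assoc simp del: sum.lessThan_Suc)
        also have "\<dots> = (\<Sum>j\<in>J. (\<Sum>i<Suc d. c i * A i j) * b j k)"
          by (subst sum.swap) (simp only: sum_distrib_right)
        also have "\<dots> = 0"
          using c(2) by (intro sum.neutral) auto
        finally show ?thesis .
      qed
      then have z: "(\<lambda>k. \<Sum>i<Suc d. c i * \<psi>' i k) = (\<lambda>_. 0)"
        by auto
      have "c j = 0" if "j < Suc d" for j
      proof -
        have "ip (\<lambda>k. \<Sum>i<Suc d. c i * \<psi>' i k) (\<psi>' j) = c j"
          by (rule ip_orthonormal_sum) (use \<psi>' S(1) that in \<open>auto simp: P_def\<close>)
        then show ?thesis
          unfolding z by (simp add: ip_def)
      qed
      then show False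
        using c(1) by auto
    qed
  qed (use \<psi> in \<open>auto simp: P_def\<close>)
qed

lemma eigenvalue_real:
  assumes "f \<in> X" "f \<noteq> (\<lambda>_. 0)" "oper f = (\<lambda>k. \<mu> * f k)"
  shows "\<mu> \<in> \<real>"
proof -
  have "nrm2 f \<noteq> 0"
    using nrm2_eq_0D[OF X_l2[OF assms(1)]] assms(2) by blast
  have "Q f f = \<mu> * ip f f"
    unfolding Q_def assms(3) ip_def mult.assoc by (rule infsum_cmult_right')
  also have "ip f f = of_real (nrm2 f)"
    by (rule ip_self[OF X_l2[OF assms(1)]])
  finally have "\<mu> = of_real (Re (Q f f) / nrm2 f)"
    using \<open>nrm2 f \<noteq> 0\<close> Q_self_real[OF assms(1)] by (simp add: field_simps)
  then show ?thesis
    by (metis Reals_of_real)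
qed

text \<open>A symmetric operator has no Jordan chains of length two: pair the chain equation for
  \<open>f\<close> with \<open>d\<close> and move the operator to \<open>d\<close>; what remains is
  \<open>nrm2 d = 0\<close>.\<close>

lemma generalized_eigenvector:
  assumes f: "f \<in> X" and d: "d \<in> X" "oper f = (\<lambda>k. \<mu> * f k + d k)" "oper d = (\<lambda>k. \<mu> * d k)"
  shows "d = (\<lambda>_. 0)"
proof (rule ccontr)
  assume nz: "d \<noteq> (\<lambda>_. 0)"
  have \<mu>: "cnj \<mu> = \<mu>"
    using eigenvalue_real[OF d(1) nz d(3)] by (simp add: Reals_cnj_iff)
  have "Q d f = \<mu> * ip d f"
    unfolding Q_def d(3) ip_def mult.assoc by (rule infsum_cmult_right')
  then have "Q f d = \<mu> * ip f d"
    using Q_cnj[OF d(1) f] ip_cnj[of f d] \<mu> by simp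
  moreover have "Q f d = \<mu> * ip f d + 1 * ip d d"
    unfolding Q_def d(2) using ip_lin_left[OF f d(1) d(1), of \<mu> 1] by simp
  ultimately have "of_real (nrm2 d) = (0 :: complex)"
    using ip_self[OF X_l2[OF d(1)]] by simp
  then show False
    using nrm2_eq_0D[OF X_l2[OF d(1)]] nz by simp
qed

end

lemma fourier_series_0: "fourier_series (\<lambda>_. 0) = 0"
  by (auto simp: fourier_series_eq fun_eq_iff)

lemma Hper_zero: "0 \<in> Hper s"
  using fourier_series_Hper[of s "\<lambda>_. 0"] by (simp add: fourier_series_0)

section \<open>The operator on distributions\<close>

locale hill_operator =
  fixes m :: nat and \<alpha> :: real and V :: functional
  assumes m: "m \<ge> 1" and \<alpha>: "0 \<le> \<alpha>" "\<alpha> \<le> 1" and V: "V \<in> Hper (- (real m * \<alpha>))"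
    and V_real: "\<And>k. fcoeff V (- k) = cnj (fcoeff V k)"
begin

sublocale hill_form m "fcoeff V"
proof
  show "(\<lambda>k. wt k powr (- (2 * real m)) * (cmod (fcoeff V k))\<^sup>2) summable_on UNIV"
  proof (rule summable_on_comparison_test[OF HperD(2)[OF V]])
    fix k
    show "wt k powr (- (2 * real m)) * (cmod (fcoeff V k))\<^sup>2 \<le> wt k powr (2 * - (real m * \<alpha>)) * (cmod (fcoeff V k))\<^sup>2"
      using \<alpha> by (intro mult_right_mono powr_mono) (auto simp: mult_left_le)
  qed auto
qed (use m V_real in auto)

lemma fcoeff_Ldom:
  assumes "f \<in> Ldom m \<alpha>"
  shows "fcoeff f \<in> X"
  unfolding X_def mem_Collect_eq
proof (rule summable_on_comparison_test)
  show "(\<lambda>k. wt k powr (2 * (real m * (2 - \<alpha>))) * (cmod (fcoeff f k))\<^sup>2) summable_on UNIV"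
    using HperD(2)[of f] assms by (simp add: Ldom_def)
  fix k
  have "wt k ^ (2 * m) = wt k powr (real (2 * m))"
    by (rule powr_realpow[symmetric]) simp
  also have "\<dots> \<le> wt k powr (2 * (real m * (2 - \<alpha>)))"
    using \<alpha> m by (intro powr_mono) (auto simp: mult_le_cancel_left1)
  finally show "wt k ^ (2 * m) * (cmod (fcoeff f k))\<^sup>2 \<le> wt k powr (2 * (real m * (2 - \<alpha>))) * (cmod (fcoeff f k))\<^sup>2"
    by (rule mult_right_mono) simp
qed auto

lemma Ldom_eq: "f \<in> Ldom m \<alpha> \<Longrightarrow> f = fourier_series (fcoeff f)"
  unfolding Ldom_def by (rule HperD(1))

lemma Lop_eq_fourier_series:
  assumes "c \<in> X"
  shows "Lop m V (fourier_series c) = fourier_series (oper c)"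
proof -
  have w: "wt k powr (2 * - real m) = 1 / wt k ^ (2 * m)" for k
    using powr_realpow[of "wt k" "2 * m"] by (simp add: powr_minus_divide)
  have "(\<lambda>k. wt k powr (2 * - real m) * (cmod (conv c k))\<^sup>2) summable_on UNIV"
    unfolding w using conv_dual[OF assms] by simp
  then have "slow (conv c)"
    unfolding slow_def by (rule exI)
  moreover have "slow (\<lambda>k. of_real (mu k) * c k)"
  proof -
    have "(\<lambda>k. wt k powr (2 * - real m) * (cmod (of_real (mu k) * c k))\<^sup>2) summable_on UNIV"
      unfolding w using mu_dual[OF assms] by simp
    then show ?thesis
      unfolding slow_def by (rule exI)
  qed
  ultimately have "fourier_series (\<lambda>k. of_real (mu k) * c k) + fourier_series (conv c) = fourier_series (oper c)"
    unfolding oper_def[abs_def] by (intro fourier_series_add)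
  then show ?thesis
    unfolding Lop_fourier_series mu_def conv_def[abs_def] .
qed

lemma eigen_equation:
  assumes "f \<in> Ldom m \<alpha>"
  shows "Lop m V f - dist_scale \<mu> f = h \<Longrightarrow> oper (fcoeff f) = (\<lambda>k. \<mu> * fcoeff f k + fcoeff h k)"
    and "oper (fcoeff f) = (\<lambda>k. \<mu> * fcoeff f k) \<Longrightarrow> Lop m V f - dist_scale \<mu> f = 0"
proof -
  have L: "Lop m V f = fourier_series (oper (fcoeff f))"
    using Lop_eq_fourier_series[OF fcoeff_Ldom[OF assms]] Ldom_eq[OF assms] by simp
  have D: "dist_scale \<mu> f = fourier_series (\<lambda>k. \<mu> * fcoeff f k)"
    using dist_scale_fourier_series[of \<mu> "fcoeff f"] Ldom_eq[OF assms] by simp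
  show "oper (fcoeff f) = (\<lambda>k. \<mu> * fcoeff f k + fcoeff h k)" if "Lop m V f - dist_scale \<mu> f = h"
  proof
    fix k
    have "fcoeff (Lop m V f - dist_scale \<mu> f) k = fcoeff h k"
      using that by simp
    then show "oper (fcoeff f) k = \<mu> * fcoeff f k + fcoeff h k"
      unfolding fcoeff_simps L by (simp add: algebra_simps)
  qed
  show "Lop m V f - dist_scale \<mu> f = 0" if "oper (fcoeff f) = (\<lambda>k. \<mu> * fcoeff f k)"
    unfolding L D that by simp
qed

text \<open>Elliptic regularity: \<open>wt ^ (2 m) g\<close> is controlled by \<open>mu g = \<mu> g - V g\<close>, and \<open>V g\<close> inherits the
  regularity of \<open>V\<close>.\<close>

lemma eigenvector_Ldom:
  assumes g: "g \<in> X" "oper g = (\<lambda>k. \<mu> * g k)"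
  shows "fourier_series g \<in> Ldom m \<alpha>"
  unfolding Ldom_def
proof (rule fourier_series_Hper)
  let ?s = "real m * \<alpha>"
  have s: "0 \<le> ?s" "?s \<le> real m"
    using \<alpha> by (auto simp: mult_left_le)
  have "(\<lambda>k. wt k powr (- (2 * ?s)) * (cmod (fcoeff V k))\<^sup>2) summable_on UNIV"
    using HperD(2)[OF V] by simp
  note K = multiplication_kernel_hilbert_schmidt[OF m s this]
  have "(\<lambda>k. (cmod (conv g k))\<^sup>2 / wt k powr (2 * ?s)) summable_on UNIV"
    unfolding conv_def by (rule hilbert_schmidt_operator(3)[OF K]) (auto intro: XD g)
  then have "(\<lambda>k. 2 * ((cmod (conv g k))\<^sup>2 / wt k powr (2 * ?s)) + 2 * ((cmod \<mu> + 1)\<^sup>2 * (cmod (g k))\<^sup>2)) summable_on UNIV"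
    by (intro summable_on_add summable_on_cmult_right X_l2 g)
  then show "(\<lambda>k. wt k powr (2 * (real m * (2 - \<alpha>))) * (cmod (g k))\<^sup>2) summable_on UNIV"
  proof (rule summable_on_comparison_test)
    fix k
    have "of_real (mu k) * g k = \<mu> * g k - conv g k"
      using fun_cong[OF g(2), of k] by (simp add: oper_def algebra_simps)
    then have "mu k * cmod (g k) \<le> cmod \<mu> * cmod (g k) + cmod (conv g k)"
      using norm_triangle_ineq4[of "\<mu> * g k" "conv g k"] by (metis norm_mult norm_of_real abs_of_nonneg mu_nonneg)
    moreover have "wt k ^ (2 * m) * cmod (g k) \<le> (mu k + 1) * cmod (g k)"
      by (intro mult_right_mono wt_le_mu) auto
    ultimately have "wt k ^ (2 * m) * cmod (g k) \<le> cmod (conv g k) + (cmod \<mu> + 1) * cmod (g k)"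
      by (simp add: algebra_simps)
    then have "(wt k ^ (2 * m) * cmod (g k))\<^sup>2 \<le> (cmod (conv g k) + (cmod \<mu> + 1) * cmod (g k))\<^sup>2"
      by (intro power_mono) auto
    also have "\<dots> \<le> 2 * (cmod (conv g k))\<^sup>2 + 2 * ((cmod \<mu> + 1) * cmod (g k))\<^sup>2"
      by (rule square_add_le)
    finally have *: "(wt k ^ (2 * m) * cmod (g k))\<^sup>2 \<le> 2 * (cmod (conv g k))\<^sup>2 + 2 * ((cmod \<mu> + 1)\<^sup>2 * (cmod (g k))\<^sup>2)"
      by (simp add: power_mult_distrib)
    \<comment> \<open>The exponent is \<open>4 m - 2 m \<alpha>\<close>: the square of the gain
      \<open>wt ^ (2 m)\<close>, diminished by what multiplication by \<open>V\<close>
      loses.\<close>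
    have "wt k powr (2 * (real m * (2 - \<alpha>))) = (wt k ^ (2 * m))\<^sup>2 / wt k powr (2 * ?s)"
    proof -
      have "wt k powr (2 * (real m * (2 - \<alpha>))) = wt k powr (real (2 * m * 2)) / wt k powr (2 * ?s)"
        by (simp add: powr_diff[symmetric] algebra_simps)
      also have "wt k powr (real (2 * m * 2)) = (wt k ^ (2 * m))\<^sup>2"
        unfolding power_mult[symmetric] by (rule powr_realpow) simp
      finally show ?thesis .
    qed
    then have "wt k powr (2 * (real m * (2 - \<alpha>))) * (cmod (g k))\<^sup>2 = (wt k ^ (2 * m) * cmod (g k))\<^sup>2 / wt k powr (2 * ?s)"
      by (simp add: power_mult_distrib)
    also have "\<dots> \<le> (2 * (cmod (conv g k))\<^sup>2 + 2 * ((cmod \<mu> + 1)\<^sup>2 * (cmod (g k))\<^sup>2)) / wt k powr (2 * ?s)"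
      by (intro divide_right_mono *) auto
    also have "\<dots> \<le> 2 * ((cmod (conv g k))\<^sup>2 / wt k powr (2 * ?s)) + 2 * ((cmod \<mu> + 1)\<^sup>2 * (cmod (g k))\<^sup>2)"
    proof -
      have "1 \<le> wt k powr (2 * ?s)"
        using s by (intro ge_one_powr_ge_zero) auto
      then have "2 * ((cmod \<mu> + 1)\<^sup>2 * (cmod (g k))\<^sup>2) / wt k powr (2 * ?s) \<le> 2 * ((cmod \<mu> + 1)\<^sup>2 * (cmod (g k))\<^sup>2) / 1"
        by (intro divide_left_mono) auto
      then show ?thesis
        by (simp add: add_divide_distrib)
    qed
    finally show "wt k powr (2 * (real m * (2 - \<alpha>))) * (cmod (g k))\<^sup>2 \<le>
        2 * ((cmod (conv g k))\<^sup>2 / wt k powr (2 * ?s)) + 2 * ((cmod \<mu> + 1)\<^sup>2 * (cmod (g k))\<^sup>2)" .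
  qed auto
qed

text \<open>The power kernels stop growing at the first step: by induction
  \<open>h = (L - \<mu>) f\<close> solves the eigenvalue equation, and
  \<open>generalized_eigenvector\<close> makes it 0.\<close>

lemma power_kernel_1: "f \<in> power_kernel m \<alpha> V \<mu> n \<Longrightarrow> f \<in> Ldom m \<alpha> \<and> Lop m V f - dist_scale \<mu> f = 0"
proof (induction n arbitrary: f)
  case 0
  have z: "(0 :: functional) \<in> Ldom m \<alpha>"
    by (simp add: Ldom_def Hper_zero)
  have "fcoeff 0 = (\<lambda>_. 0)"
    by (rule ext) simp
  then have "oper (fcoeff 0) = (\<lambda>k. \<mu> * fcoeff 0 k)"
    by (simp add: oper_def[abs_def] conv_def)
  then have L: "Lop m V 0 - dist_scale \<mu> 0 = 0"
    by (rule eigen_equation(2)[OF z])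
  have "f = 0"
    using 0 by simp
  show ?case
    unfolding \<open>f = 0\<close> using z L by (rule conjI)
next
  case (Suc n)
  define h where "h = Lop m V f - dist_scale \<mu> f"
  have f: "f \<in> Ldom m \<alpha>" and "h \<in> power_kernel m \<alpha> V \<mu> n"
    using Suc.prems by (auto simp: h_def)
  then have h: "h \<in> Ldom m \<alpha>" "Lop m V h - dist_scale \<mu> h = 0"
    using Suc.IH by blast+
  have "fcoeff h = (\<lambda>_. 0)"
  proof (rule generalized_eigenvector)
    show "oper (fcoeff f) = (\<lambda>k. \<mu> * fcoeff f k + fcoeff h k)"
      by (rule eigen_equation(1)[OF f]) (simp add: h_def)
    show "oper (fcoeff h) = (\<lambda>k. \<mu> * fcoeff h k)"
      using eigen_equation(1)[OF h] by simp
  qed (use f h fcoeff_Ldom in auto)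
  then have "h = 0"
    using Ldom_eq[OF h(1)] by (simp add: fourier_series_0)
  then show ?case
    using f by (simp add: h_def)
qed

lemma root_space_eq: "root_space m \<alpha> V \<mu> = {f \<in> Ldom m \<alpha>. oper (fcoeff f) = (\<lambda>k. \<mu> * fcoeff f k)}"
proof (intro equalityI subsetI)
  fix f assume "f \<in> root_space m \<alpha> V \<mu>"
  then have f: "f \<in> Ldom m \<alpha>" "Lop m V f - dist_scale \<mu> f = 0"
    using power_kernel_1 by (auto simp: root_space_def)
  then show "f \<in> {f \<in> Ldom m \<alpha>. oper (fcoeff f) = (\<lambda>k. \<mu> * fcoeff f k)}"
    using eigen_equation(1)[OF f] by simp
next
  fix f assume f: "f \<in> {f \<in> Ldom m \<alpha>. oper (fcoeff f) = (\<lambda>k. \<mu> * fcoeff f k)}"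
  then have "f \<in> power_kernel m \<alpha> V \<mu> (Suc 0)"
    using eigen_equation(2)[of f \<mu>] by simp
  then show "f \<in> root_space m \<alpha> V \<mu>"
    unfolding root_space_def by blast
qed

section \<open>Eigenspaces as spaces of coefficient sequences\<close>

definition eigenspace :: "complex \<Rightarrow> (int \<Rightarrow> complex) set" where
  "eigenspace \<mu> = {g \<in> X. oper g = (\<lambda>k. \<mu> * g k)}"

text \<open>By elliptic regularity a solution in the form domain lies in the domain of the operator.
  Hence the variational minimizers, known only to lie in \<open>X\<close>, are counted by the
  algebraic multiplicities.\<close>

lemma eigenspace_fcoeff: "eigenspace \<mu> = fcoeff ` root_space m \<alpha> V \<mu>"
proof (intro equalityI subsetI)
  fix g assume "g \<in> eigenspace \<mu>"
  then have g: "g \<in> X" "oper g = (\<lambda>k. \<mu> * g k)"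
    by (auto simp: eigenspace_def)
  then show "g \<in> fcoeff ` root_space m \<alpha> V \<mu>"
    using eigenvector_Ldom[OF g]
    by (intro image_eqI[of _ _ "fourier_series g"]) (auto simp: root_space_eq fcoeff_fourier_series_fun)
qed (auto simp: root_space_eq eigenspace_def intro: fcoeff_Ldom)

lemma eigenspace_lin:
  assumes "f \<in> eigenspace \<mu>" "g \<in> eigenspace \<mu>"
  shows "(\<lambda>k. a * f k + b * g k) \<in> eigenspace \<mu>"
proof -
  have fg: "f \<in> X" "g \<in> X" "oper f = (\<lambda>k. \<mu> * f k)" "oper g = (\<lambda>k. \<mu> * g k)"
    using assms by (auto simp: eigenspace_def)
  have "oper (\<lambda>k. a * f k + b * g k) k = a * oper f k + b * oper g k" for k
    using Q_lin_left[OF fg(1,2) X_unit[of k], of a b] by simp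
  then show ?thesis
    using X_lin[OF fg(1,2)] by (auto simp: eigenspace_def fg algebra_simps)
qed

lemma fcoeff_dist_sum: "fcoeff (\<Sum>v\<in>B. dist_scale (u v) v) k = (\<Sum>v\<in>B. u v * fcoeff v k)"
  by (induction B rule: infinite_finite_induct)
    (simp_all only: sum.infinite sum.empty sum.insert fcoeff_simps not_False_eq_True)

lemma eigenspace_orthonormal_basis:
  assumes "has_algebraic_multiplicity m \<alpha> V \<mu> d"
  obtains \<psi> :: "nat \<Rightarrow> int \<Rightarrow> complex" where "\<And>i. i < d \<Longrightarrow> \<psi> i \<in> eigenspace \<mu>"
    "\<And>i j. i < d \<Longrightarrow> j < d \<Longrightarrow> ip (\<psi> i) (\<psi> j) = (if i = j then 1 else 0)"
    "\<And>f. f \<in> eigenspace \<mu> \<Longrightarrow> (\<And>i. i < d \<Longrightarrow> ip f (\<psi> i) = 0) \<Longrightarrow> f = (\<lambda>_. 0)"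
proof -
  obtain B where B: "finite B" "dist.independent B" "dist.span B = root_space m \<alpha> V \<mu>" "card B = d"
    using assms by (auto simp: has_algebraic_multiplicity_def)
  have span: "root_space m \<alpha> V \<mu> = range (\<lambda>u. \<Sum>v\<in>B. dist_scale (u v) v)"
    using dist.span_finite[OF B(1)] B(3) by simp
  show ?thesis
  proof (rule orthonormal_basis[of "eigenspace \<mu>" B d fcoeff])
    show "eigenspace \<mu> \<subseteq> X"
      by (auto simp: eigenspace_def)
    show "fcoeff v \<in> eigenspace \<mu>" if "v \<in> B" for v
      using dist.span_base[OF that] B(3) by (auto simp: eigenspace_fcoeff)
    show "\<forall>v\<in>B. c v = 0" if c: "(\<lambda>k. \<Sum>v\<in>B. c v * fcoeff v k) = (\<lambda>_. 0)" for c
    proof -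
      let ?f = "\<Sum>v\<in>B. dist_scale (c v) v"
      have "?f \<in> root_space m \<alpha> V \<mu>"
        unfolding span by blast
      then have "?f = fourier_series (fcoeff ?f)"
        by (intro Ldom_eq) (auto simp: root_space_eq)
      moreover have "fcoeff ?f = (\<lambda>_. 0)"
        using c unfolding fun_eq_iff fcoeff_dist_sum .
      ultimately have f0: "?f = 0"
        by (simp only: fourier_series_0)
      show ?thesis
      proof (rule ccontr)
        assume "\<not> (\<forall>v\<in>B. c v = 0)"
        then have "\<exists>v\<in>B. c v \<noteq> 0"
          by blast
        then have "\<exists>u. (\<exists>v\<in>B. u v \<noteq> 0) \<and> (\<Sum>v\<in>B. dist_scale (u v) v) = 0"
          using f0 by (intro exI[of _ c] conjI)
        then have "dist.dependent B"
          unfolding dist.dependent_finite[OF B(1)] .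
        then show False
          using B(2) by contradiction
      qed
    qed
    show "\<exists>c. f = (\<lambda>k. \<Sum>v\<in>B. c v * fcoeff v k)" if fE: "f \<in> eigenspace \<mu>" for f
    proof -
      obtain c where "f = fcoeff (\<Sum>v\<in>B. dist_scale (c v) v)"
        using fE unfolding eigenspace_fcoeff span by blast
      then show ?thesis
        by (intro exI[of _ c] ext) (simp add: fcoeff_dist_sum)
    qed
  next
    fix \<psi> :: "nat \<Rightarrow> int \<Rightarrow> complex"
    assume "\<And>i. i < d \<Longrightarrow> \<psi> i \<in> eigenspace \<mu>"
      "\<And>i j. i < d \<Longrightarrow> j < d \<Longrightarrow> ip (\<psi> i) (\<psi> j) = (if i = j then 1 else 0)"
      "\<And>f. f \<in> eigenspace \<mu> \<Longrightarrow> (\<And>i. i < d \<Longrightarrow> ip f (\<psi> i) = 0) \<Longrightarrow> f = (\<lambda>_. 0)"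
    then show ?thesis
      by (rule that)
  qed (fact B eigenspace_lin)+
qed

text \<open>Links the eigenvalue list to the locale of min-max. Reality belongs to the conclusion
  because the locale works with real \<open>l\<close>, and the gaps must be recovered from the real
  parts.\<close>

lemma spectrum_exists:
  assumes "ordered_periodic_eigenvalues m \<alpha> V ev"
  shows "(\<forall>k. ev k \<in> \<real>) \<and> (\<exists>\<phi>. hill_spectrum m (fcoeff V) \<phi> (\<lambda>k. Re (ev k)))"
proof -
  have mult: "has_algebraic_multiplicity m \<alpha> V \<mu> (card {k. ev k = \<mu>})" for \<mu>
    using assms by (auto simp: ordered_periodic_eigenvalues_def)
  have fin: "finite {k. Re (ev k) \<le> T}" for T
  proof -
    have "eventually (\<lambda>k. Re (ev k) > T) sequentially"
      using assms by (auto simp: ordered_periodic_eigenvalues_def filterlim_at_top_dense)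
    then obtain N where "\<And>k. k \<ge> N \<Longrightarrow> Re (ev k) > T"
      by (auto simp: eventually_sequentially)
    then have "{k. Re (ev k) \<le> T} \<subseteq> {..<N}"
      by (force simp: not_less[symmetric])
    then show ?thesis
      by (rule finite_subset) simp
  qed
  \<comment> \<open>The multiplicity is expressed by \<open>card\<close>, which would be 0 on an
    infinite set; divergence of the real parts rules that out.\<close>
  have fin_eq: "finite {k. ev k = \<mu>}" for \<mu>
    by (rule finite_subset[OF _ fin[of "Re \<mu>"]]) auto
  define ob where "ob \<mu> \<psi> \<longleftrightarrow> (\<forall>i<card {k. ev k = \<mu>}. \<psi> i \<in> eigenspace \<mu>) \<and>
    (\<forall>i<card {k. ev k = \<mu>}. \<forall>j<card {k. ev k = \<mu>}. ip (\<psi> i) (\<psi> j) = (if i = j then 1 else 0)) \<and>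
    (\<forall>f\<in>eigenspace \<mu>. (\<forall>i<card {k. ev k = \<mu>}. ip f (\<psi> i) = 0) \<longrightarrow> f = (\<lambda>_. 0))"
    for \<mu> and \<psi> :: "nat \<Rightarrow> int \<Rightarrow> complex"
  have ex_ob: "\<exists>\<psi>. ob \<mu> \<psi>" for \<mu>
  proof (rule eigenspace_orthonormal_basis[OF mult[of \<mu>]])
    fix \<psi> assume a: "\<And>i. i < card {k. ev k = \<mu>} \<Longrightarrow> \<psi> i \<in> eigenspace \<mu>"
      and b: "\<And>i j. i < card {k. ev k = \<mu>} \<Longrightarrow> j < card {k. ev k = \<mu>} \<Longrightarrow> ip (\<psi> i) (\<psi> j) = (if i = j then 1 else 0)"
      and c: "\<And>f. f \<in> eigenspace \<mu> \<Longrightarrow> (\<And>i. i < card {k. ev k = \<mu>} \<Longrightarrow> ip f (\<psi> i) = 0) \<Longrightarrow> f = (\<lambda>_. 0)"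
    show ?thesis
      unfolding ob_def by (intro exI[of _ \<psi>] conjI allI impI ballI a b c) auto
  qed
  define \<psi> where "\<psi> \<mu> = (SOME \<psi>. ob \<mu> \<psi>)" for \<mu>
  have \<psi>: "ob \<mu> (\<psi> \<mu>)" for \<mu>
    unfolding \<psi>_def by (rule someI_ex[OF ex_ob])
  have ex_h: "\<exists>h. bij_betw h {k. ev k = \<mu>} {..<card {k. ev k = \<mu>}}" for \<mu>
    using finite_same_card_bij[OF fin_eq[of \<mu>], of "{..<card {k. ev k = \<mu>}}"] by auto
  define h where "h \<mu> = (SOME h. bij_betw h {k. ev k = \<mu>} {..<card {k. ev k = \<mu>}})" for \<mu>
  have h: "bij_betw (h \<mu>) {k. ev k = \<mu>} {..<card {k. ev k = \<mu>}}" for \<mu>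
    unfolding h_def by (rule someI_ex[OF ex_h])
  \<comment> \<open>The indices that share the eigenvalue \<open>ev k\<close> are exactly as many as
    the dimension of its eigenspace, so the bijection \<open>h\<close> lets them enumerate an
    orthonormal basis of it.\<close>
  define \<phi> where "\<phi> k = \<psi> (ev k) (h (ev k) k)" for k
  have hk: "h (ev k) k < card {j. ev j = ev k}" for k
    using bij_betwE[OF h[of "ev k"]] by auto
  have \<phi>E: "\<phi> k \<in> eigenspace (ev k)" for k
    using \<psi>[of "ev k"] hk[of k] by (auto simp: ob_def \<phi>_def)
  then have \<phi>X: "\<phi> k \<in> X" and \<phi>eig: "oper (\<phi> k) = (\<lambda>j. ev k * \<phi> k j)" for k
    by (auto simp: eigenspace_def)
  have on: "ip (\<phi> i) (\<phi> j) = (if i = j then 1 else 0)" if "ev i = ev j" for i j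
  proof -
    have "h (ev j) i = h (ev j) j \<longleftrightarrow> i = j"
      using bij_betw_imp_inj_on[OF h[of "ev j"]] that by (auto simp: inj_on_def)
    moreover have "h (ev j) i < card {k. ev k = ev j}"
      using hk[of i] that by simp
    ultimately show ?thesis
      using \<psi>[of "ev j"] hk[of j] that by (simp add: ob_def \<phi>_def)
  qed
  have real: "ev k \<in> \<real>" for k
  proof (rule eigenvalue_real[OF \<phi>X _ \<phi>eig])
    show "\<phi> k \<noteq> (\<lambda>_. 0)"
      using on[of k k] by (auto simp: ip_def)
  qed
  then have ev: "ev k = of_real (Re (ev k))" for k
    by (simp add: complex_is_Real_iff complex_eq_iff)
  have "hill_spectrum m (fcoeff V) \<phi> (\<lambda>k. Re (ev k))"
  proof (intro hill_spectrum.intro hill_spectrum_axioms.intro)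
    show "hill_form m (fcoeff V)"
      by unfold_locales
    show "ip (\<phi> i) (\<phi> j) = (if i = j then 1 else 0)" for i j
    proof (cases "ev i = ev j")
      case False
      have q: "Q (\<phi> i) (\<phi> j) = ev i * ip (\<phi> i) (\<phi> j)" for i j
        unfolding Q_def \<phi>eig ip_def mult.assoc by (rule infsum_cmult_right')
      have "ev i * ip (\<phi> i) (\<phi> j) = cnj (ev j * ip (\<phi> j) (\<phi> i))"
        unfolding q[symmetric] by (rule Q_cnj[OF \<phi>X \<phi>X])
      also have "\<dots> = ev j * ip (\<phi> i) (\<phi> j)"
        using ip_cnj[of "\<phi> i" "\<phi> j"] real[of j] by (simp add: Reals_cnj_iff)
      finally have "ip (\<phi> i) (\<phi> j) = 0"
        using False by simp
      moreover have "i \<noteq> j"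
        using False by auto
      ultimately show ?thesis
        by simp
    qed (rule on)
    show "oper (\<phi> i) = (\<lambda>k. of_real (Re (ev i)) * \<phi> i k)" for i
      using \<phi>eig[of i] ev[of i] by simp
    show "mono (\<lambda>k. Re (ev k))"
      unfolding mono_iff_le_Suc using assms by (auto simp: ordered_periodic_eigenvalues_def intro: less_imp_le)
    fix g \<nu> assume g: "g \<in> X" "oper g = (\<lambda>k. of_real \<nu> * g k)" "\<And>i. Re (ev i) = \<nu> \<Longrightarrow> ip g (\<phi> i) = 0"
    let ?\<mu> = "complex_of_real \<nu>"
    have gE: "g \<in> eigenspace ?\<mu>"
      using g by (simp add: eigenspace_def)
    \<comment> \<open>This includes a \<nu> that is no \<open>ev k\<close>: the cardinality is then
      0, the claim is vacuous, and \<open>ob\<close> says that the eigenspace is trivial.\<close>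
    have "ip g (\<psi> ?\<mu> i) = 0" if "i < card {k. ev k = ?\<mu>}" for i
    proof -
      have "i \<in> h ?\<mu> ` {k. ev k = ?\<mu>}"
        unfolding bij_betw_imp_surj_on[OF h[of ?\<mu>]] using that by (rule lessThan_iff[THEN iffD2])
      then obtain k where k: "i = h ?\<mu> k" "k \<in> {k. ev k = ?\<mu>}"
        by (rule imageE)
      then have "ev k = ?\<mu>"
        by simp
      then have "ip g (\<phi> k) = 0" "\<phi> k = \<psi> ?\<mu> i"
        using g(3)[of k] by (simp_all add: \<phi>_def k(1))
      then show ?thesis
        by simp
    qed
    then show "g = (\<lambda>_. 0)"
      using \<psi>[of ?\<mu>] gE by (auto simp: ob_def)
  qed (use \<phi>X fin in auto)
  then show ?thesis
    using real by blast
qed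

end

section \<open>Regularity and gaps\<close>

lemma summable_on_eventually_le:
  fixes f g :: "nat \<Rightarrow> real"
  assumes g: "g summable_on {1..}" and le: "eventually (\<lambda>n. f n \<le> g n) sequentially"
    and nn: "\<And>n. 0 \<le> f n"
  shows "f summable_on {1..}"
proof -
  obtain N where N: "\<And>n. n \<ge> N \<Longrightarrow> f n \<le> g n"
    using le by (auto simp: eventually_sequentially)
  have "g summable_on {max 1 N..}"
    by (rule summable_on_subset_banach[OF g]) auto
  then have "f summable_on {max 1 N..}"
    by (rule summable_on_comparison_test) (use N nn in auto)
  moreover have "f summable_on {1..<max 1 N}"
    by (rule summable_on_finite) simp
  ultimately have "f summable_on {1..<max 1 N} \<union> {max 1 N..}"
    by (intro summable_on_union)
  then show ?thesis
    by (rule summable_on_subset_banach) auto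
qed

text \<open>Odd coefficients vanish by period 1, opposite ones have equal modulus, and the index 0
  is a single term. The weights at \<open>2 n\<close> and at \<open>n\<close> differ by a factor of
  at most \<open>2 powr (2 \<sigma>)\<close>.\<close>

lemma even_coefficients_summable_iff:
  fixes a :: "int \<Rightarrow> complex"
  assumes odd: "\<And>k. a (2 * k + 1) = 0" and sym: "\<And>k. a (- k) = cnj (a k)" and \<sigma>: "0 \<le> \<sigma>"
  shows "(\<lambda>k. wt k powr (- (2 * \<sigma>)) * (cmod (a k))\<^sup>2) summable_on UNIV \<longleftrightarrow>
    (\<lambda>n. (1 + real n) powr (- (2 * \<sigma>)) * (cmod (a (2 * int n)))\<^sup>2) summable_on {1..}"
    (is "?A summable_on UNIV \<longleftrightarrow> ?B summable_on _")
proof -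
  have AB: "?A (2 * int n) \<le> ?B n" "?B n \<le> 2 powr (2 * \<sigma>) * ?A (2 * int n)" for n
  proof -
    have "wt (2 * int n) powr (- (2 * \<sigma>)) \<le> (1 + real n) powr (- (2 * \<sigma>))"
      using \<sigma> by (intro powr_mono2') (auto simp: wt_def)
    then show "?A (2 * int n) \<le> ?B n"
      by (rule mult_right_mono) simp
    have "wt (2 * int n) powr (2 * \<sigma>) \<le> (2 * (1 + real n)) powr (2 * \<sigma>)"
      using \<sigma> by (intro powr_mono2) (auto simp: wt_def)
    then have "wt (2 * int n) powr (2 * \<sigma>) \<le> 2 powr (2 * \<sigma>) * (1 + real n) powr (2 * \<sigma>)"
      unfolding powr_mult .
    then have "(1 + real n) powr (- (2 * \<sigma>)) \<le> 2 powr (2 * \<sigma>) * wt (2 * int n) powr (- (2 * \<sigma>))"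
      by (simp add: powr_minus field_simps)
    then have "(1 + real n) powr (- (2 * \<sigma>)) * (cmod (a (2 * int n)))\<^sup>2 \<le>
        2 powr (2 * \<sigma>) * wt (2 * int n) powr (- (2 * \<sigma>)) * (cmod (a (2 * int n)))\<^sup>2"
      by (rule mult_right_mono) simp
    then show "?B n \<le> 2 powr (2 * \<sigma>) * ?A (2 * int n)"
      by (simp only: mult.assoc)
  qed
  show ?thesis
  proof
    assume "?A summable_on UNIV"
    then have "?A summable_on range (\<lambda>n. 2 * int n)"
      by (rule summable_on_subset_banach) auto
    then have "(\<lambda>n. ?A (2 * int n)) summable_on UNIV"
      by (subst (asm) summable_on_reindex) (auto simp: inj_on_def o_def)
    then have "(\<lambda>n. 2 powr (2 * \<sigma>) * ?A (2 * int n)) summable_on UNIV"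
      by (rule summable_on_cmult_right)
    then have "?B summable_on UNIV"
      by (rule summable_on_comparison_test) (use AB in auto)
    then show "?B summable_on {1..}"
      by (rule summable_on_subset_banach) auto
  next
    assume "?B summable_on {1..}"
    then have "?B summable_on insert 0 {1..}"
      by (simp add: summable_on_insert_iff)
    also have "insert 0 {1..} = (UNIV :: nat set)"
      by auto
    finally have s: "(\<lambda>n. ?A (2 * int n)) summable_on UNIV"
      by (rule summable_on_comparison_test) (use AB in auto)
    have 1: "?A summable_on range (\<lambda>n. 2 * int n)"
      using s by (subst summable_on_reindex) (auto simp: inj_on_def o_def)
    have "?A (- (2 * int n)) = ?A (2 * int n)" for n
      by (simp only: sym wt_minus complex_mod_cnj)
    then have 2: "?A summable_on range (\<lambda>n. - (2 * int n))"
      using s by (subst summable_on_reindex) (auto simp: inj_on_def o_def)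
    have "?A summable_on (range (\<lambda>n. 2 * int n) \<union> range (\<lambda>n. - (2 * int n)))"
      by (rule summable_on_union[OF 1 2])
    then show "?A summable_on UNIV"
    proof (rule iffD1[OF summable_on_cong_neutral, rotated -1])
      fix k assume k: "k \<in> UNIV - (range (\<lambda>n. 2 * int n) \<union> range (\<lambda>n. - (2 * int n)))"
      have "odd k"
      proof
        assume "even k"
        then obtain j where j: "k = 2 * j"
          by (rule evenE)
        obtain n where "j = int n \<or> j = - int n"
          by (metis int_cases2)
        then show False
          using k j by auto
      qed
      then obtain j where "k = 2 * j + 1"
        by (rule oddE)
      then show "?A k = 0"
        using odd[of j] by simp
    qed auto
  qed
qed

section \<open>Square summability of the gaps against that of the coefficients\<close>

context hill_operator
begin

text \<open>The condition \<open>1 - e \<le> \<sigma>\<close> places \<open>R\<close> in the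
  weighted space with exponent \<open>- \<sigma>\<close>. There the difference between the gap and
  twice the modulus of the coefficient is negligible, and each sequence controls the other.\<close>

lemma gap_asymptotics:
  assumes ev: "ordered_periodic_eigenvalues m \<alpha> V ev"
    and e: "0 < e" "e \<le> 1"
    and decay: "(\<lambda>k. wt k powr (- (2 * real m - e)) * (cmod (fcoeff V k))\<^sup>2) summable_on UNIV"
    and \<sigma>: "1 - e \<le> \<sigma>"
  shows "(\<lambda>n. (1 + real n) powr (- (2 * \<sigma>)) * (cmod (fcoeff V (2 * int n)))\<^sup>2) summable_on {1..} \<longleftrightarrow>
    (\<lambda>n. (1 + real n) powr (- (2 * \<sigma>)) * (cmod (ev (2 * n) - ev (2 * n - 1)))\<^sup>2) summable_on {1..}"
    (is "?B summable_on _ \<longleftrightarrow> ?C summable_on _")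
proof -
  interpret hill_form_decay m "fcoeff V" e
    by unfold_locales (use e decay in auto)
  obtain \<phi> where real: "\<And>k. ev k \<in> \<real>" and sp: "hill_spectrum m (fcoeff V) \<phi> (\<lambda>k. Re (ev k))"
    using spectrum_exists[OF ev] by blast
  interpret sp: hill_spectrum m "fcoeff V" \<phi> "\<lambda>k. Re (ev k)"
    by (rule sp)
  let ?w = "\<lambda>n. (1 + real n) powr (- (2 * \<sigma>))"
  let ?g = "\<lambda>n. cmod (ev (2 * n) - ev (2 * n - 1))"
  let ?V = "\<lambda>n. cmod (fcoeff V (2 * int n))"
  have g: "?g n = \<bar>Re (ev (2 * n)) - Re (ev (2 * n - 1))\<bar>" for n
    using real[of "2 * n"] real[of "2 * n - 1"] by (simp add: complex_is_Real_iff cmod_eq_Re)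
  \<comment> \<open>One constant serves both smallness conditions of
    \<open>eigenvalue_localization\<close>, which are 1/16 for the kernel and 1/4 for the
    gaps.\<close>
  have sixteenth: "(0 :: real) < 1 / 16"
    by simp
  have loc: "eventually (\<lambda>n. \<bar>?g n - 2 * ?V n\<bar> \<le> 8 * R n) sequentially"
    using eventually_small[OF sixteenth] eventually_ge_at_top[of 1]
  proof eventually_elim
    case (elim n)
    have "\<bar>Re (ev (2 * n)) - Re (ev (2 * n - 1)) - 2 * ?V n\<bar> \<le> 8 * R n"
    proof (rule sp.eigenvalue_localization)
      show "cmod (fcoeff V 0) + ?V n + 4 * R n \<le> gap n j / 4" if "j \<in> off n" for j
      proof -
        have "cmod (fcoeff V 0) + ?V n + 4 * R n \<le> 1 / 16 * gap n j"
          using elim that by blast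
        then show ?thesis
          using gap_nonneg[of n j] by linarith
      qed
    qed (use elim off_kernel_HS R_bound in auto)
    moreover have "0 \<le> ?V n"
      by simp
    ultimately show ?case
      unfolding g by linarith
  qed
  have RS: "(\<lambda>n. ?w n * (R n)\<^sup>2) summable_on {1..}"
  proof (rule summable_on_comparison_test[OF R_weighted_summable])
    fix n :: nat
    show "?w n * (R n)\<^sup>2 \<le> (1 + real n) powr (- (2 * (1 - e))) * (R n)\<^sup>2"
      using \<sigma> by (intro mult_right_mono powr_mono) auto
  qed auto
  \<comment> \<open>\<open>8 = 2 * 2\<^sup>2\<close> and \<open>128 = 2 * 8\<^sup>2\<close>. The
    bound is applied with the gap as \<open>x\<close> and the coefficient as \<open>y\<close>, and
    again with the roles exchanged, where the factor 2 is generous.\<close>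
  have sq: "?w n * x\<^sup>2 \<le> 8 * (?w n * y\<^sup>2) + 128 * (?w n * (R n)\<^sup>2)"
    if "0 \<le> x" "x \<le> 2 * y + 8 * R n" for n x y
  proof -
    have "x\<^sup>2 \<le> (2 * y + 8 * R n)\<^sup>2"
      using that by (intro power_mono) auto
    also have "\<dots> \<le> 8 * y\<^sup>2 + 128 * (R n)\<^sup>2"
      using square_add_le[of "2 * y" "8 * R n"] by (simp add: power_mult_distrib)
    finally have "?w n * x\<^sup>2 \<le> ?w n * (8 * y\<^sup>2 + 128 * (R n)\<^sup>2)"
      by (rule mult_left_mono) simp
    then show ?thesis
      by (simp add: algebra_simps)
  qed
  show ?thesis
  proof
    assume B: "?B summable_on {1..}"
    have "(\<lambda>n. 8 * ?B n + 128 * (?w n * (R n)\<^sup>2)) summable_on {1..}"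
      by (intro summable_on_add summable_on_cmult_right B RS)
    then show "?C summable_on {1..}"
    proof (rule summable_on_eventually_le)
      show "eventually (\<lambda>n. ?C n \<le> 8 * ?B n + 128 * (?w n * (R n)\<^sup>2)) sequentially"
        using loc by eventually_elim (intro sq, auto)
    qed auto
  next
    assume C: "?C summable_on {1..}"
    have "(\<lambda>n. 8 * ?C n + 128 * (?w n * (R n)\<^sup>2)) summable_on {1..}"
      by (intro summable_on_add summable_on_cmult_right C RS)
    then show "?B summable_on {1..}"
    proof (rule summable_on_eventually_le)
      show "eventually (\<lambda>n. ?B n \<le> 8 * ?C n + 128 * (?w n * (R n)\<^sup>2)) sequentially"
        using loc
      proof eventually_elim
        case (elim n)
        have "0 \<le> ?g n" "0 \<le> R n"
          by (auto simp: R_nonneg)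
        then show ?case
          using elim by (intro sq) (simp, linarith)
      qed
    qed auto
  qed
qed

end

theorem corollary1p2:
  fixes m :: nat and \<alpha> \<beta> :: real and V :: functional and ev :: "nat \<Rightarrow> complex"
  assumes "m \<ge> 1" and "0 \<le> \<beta>" and "\<beta> < \<alpha>" and "\<alpha> < 1"
    and "V \<in> Hper (- (real m * \<alpha>))"
    and "\<forall>k. fcoeff V (2 * k + 1) = 0"
    and "\<forall>k. fcoeff V (- k) = cnj (fcoeff V k)"
    and "ordered_periodic_eigenvalues m \<alpha> V ev"
  shows "V \<in> Hper (- (real m * \<beta>)) \<longleftrightarrow>
         (\<lambda>n. ev (2 * n) - ev (2 * n - 1)) \<in> hseq (- (real m * \<beta>))"
proof -
  interpret hill_operator m \<alpha> V
    by unfold_locales (use assms in auto)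
  define A where "A t \<longleftrightarrow> (\<lambda>k. wt k powr (- t) * (cmod (fcoeff V k))\<^sup>2) summable_on UNIV" for t
  define C where "C \<sigma> \<longleftrightarrow>
    (\<lambda>n. (1 + real n) powr (- (2 * \<sigma>)) * (cmod (ev (2 * n) - ev (2 * n - 1)))\<^sup>2) summable_on {1..}" for \<sigma>
  let ?b = "real m * \<beta>"
  have b: "0 \<le> ?b" "?b < real m"
    using assms by (auto simp: mult_less_cancel_left1)
  have m1: "1 \<le> real m"
    using assms by simp
  have VA: "V \<in> Hper (- ?b) \<longleftrightarrow> A (2 * ?b)"
    using assms(5) by (simp add: Hper_def A_def wt_def)
  have gC: "(\<lambda>n. ev (2 * n) - ev (2 * n - 1)) \<in> hseq (- ?b) \<longleftrightarrow> C ?b"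
    by (simp add: hseq_def C_def)
  have A_mono: "A t'" if "A t" "t \<le> t'" for t t'
    unfolding A_def
  proof (rule summable_on_comparison_test)
    show "(\<lambda>k. wt k powr (- t) * (cmod (fcoeff V k))\<^sup>2) summable_on UNIV"
      using that(1) by (simp add: A_def)
    show "wt k powr (- t') * (cmod (fcoeff V k))\<^sup>2 \<le> wt k powr (- t) * (cmod (fcoeff V k))\<^sup>2" for k
      using that(2) by (intro mult_right_mono powr_mono) auto
  qed auto
  have C_mono: "C t'" if "C t" "t \<le> t'" for t t'
    unfolding C_def
  proof (rule summable_on_comparison_test)
    show "(\<lambda>n. (1 + real n) powr (- (2 * t)) * (cmod (ev (2 * n) - ev (2 * n - 1)))\<^sup>2) summable_on {1..}"
      using that(1) by (simp add: C_def)
    show "(1 + real n) powr (- (2 * t')) * (cmod (ev (2 * n) - ev (2 * n - 1)))\<^sup>2 \<le>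
        (1 + real n) powr (- (2 * t)) * (cmod (ev (2 * n) - ev (2 * n - 1)))\<^sup>2" for n
      using that(2) by (intro mult_right_mono powr_mono) auto
  qed auto
  have AC: "A (2 * \<sigma>) \<longleftrightarrow> C \<sigma>" if "0 < e" "e \<le> 1" "A (2 * real m - e)" "1 - e \<le> \<sigma>" "0 \<le> \<sigma>" for e \<sigma>
    unfolding A_def C_def
    using even_coefficients_summable_iff[of "fcoeff V" \<sigma>] gap_asymptotics[OF assms(8) that(1,2) _ that(4)] that(3,5) assms(6,7)
    by (simp add: A_def)
  have "A (2 * ?b)" if "C ?b"
  proof -
    \<comment> \<open>The given regularity \<open>2 m \<alpha> = 2 m - 2 m (1 - \<alpha>)\<close>
      corresponds to the value \<open>2 m (1 - \<alpha>)\<close> of \<open>e\<close>, positive since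
      \<alpha> < 1; the cap keeps it admissible for \<open>AC\<close>.\<close>
    define e0 where "e0 = min 1 (2 * real m * (1 - \<alpha>))"
    have e0: "0 < e0" "e0 \<le> 1"
      using assms by (auto simp: e0_def)
    have "A (2 * real m - e0)"
    proof (rule A_mono)
      show "A (2 * (real m * \<alpha>))"
        using HperD(2)[OF assms(5)] by (simp add: A_def)
      have "e0 \<le> 2 * real m * (1 - \<alpha>)"
        by (simp add: e0_def)
      then show "2 * (real m * \<alpha>) \<le> 2 * real m - e0"
        by (simp add: algebra_simps)
    qed
    then have base: "A (2 * real m - min 1 (2 ^ 0 * e0))"
      using e0 by simp
    \<comment> \<open>The disjunction lets the iteration stop as soon as the goal is reached, at
      whatever stage this happens.\<close>
    have "A (2 * ?b) \<or> A (2 * real m - min 1 (2 ^ N * e0))" for N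
    proof (induction N)
      case 0
      show ?case
        using base by blast
    next
      case (Suc N)
      let ?e = "min 1 (2 ^ N * e0)"
      have e: "0 < ?e" "?e \<le> 1"
        using e0 by auto
      show ?case
      proof (cases "A (2 * ?b)")
        case False
        then have Ae: "A (2 * real m - ?e)"
          using Suc.IH by blast
        \<comment> \<open>Otherwise \<open>AC\<close> at \<open>\<sigma> = ?b\<close> would already
          give the excluded goal. The best usable exponent is therefore \<open>1 - e\<close>, a
          weaker demand on the gaps than \<open>C ?b\<close>.\<close>
        have lt: "?b < 1 - ?e"
          using AC[OF e Ae _ b(1)] \<open>C ?b\<close> False by linarith
        have "C (1 - ?e)"
          using C_mono[OF \<open>C ?b\<close>] lt by simp
        then have "A (2 * (1 - ?e))"
          using AC[OF e Ae, of "1 - ?e"] e by simp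
        \<comment> \<open>Because \<open>m \<ge> 1\<close>, the left side is at most
          \<open>2 m - 2 e\<close>, and the next capped value is at most \<open>2 e\<close>.\<close>
        moreover have "2 * (1 - ?e) \<le> 2 * real m - min 1 (2 ^ Suc N * e0)"
          using m1 e by (auto simp: min_def)
        ultimately show ?thesis
          using A_mono by blast
      qed simp
    qed
    moreover obtain N where N: "1 \<le> 2 ^ N * e0"
    proof -
      obtain N where "1 / e0 < 2 ^ N"
        using real_arch_pow[of 2 "1 / e0"] by auto
      then show ?thesis
        using that[of N] e0 by (simp add: field_simps)
    qed
    ultimately have "A (2 * ?b) \<or> A (2 * real m - 1)"
      by (metis min.absorb1)
    \<comment> \<open>At \<open>e = 1\<close> the requirement \<open>1 - e \<le> \<sigma>\<close>
      reads \<open>0 \<le> ?b\<close>, so the target exponent is reached in one application.\<close>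
    then show ?thesis
      using AC[of 1 ?b] b \<open>C ?b\<close> by auto
  qed
  moreover have "C ?b" if "A (2 * ?b)"
  proof -
    define e where "e = min 1 (2 * (real m - ?b))"
    have e: "0 < e" "e \<le> 1"
      using b by (auto simp: e_def)
    have "A (2 * real m - e)"
      using that by (rule A_mono) (auto simp: e_def min_def)
    moreover have "e = 1 \<or> e = 2 * (real m - ?b)"
      by (auto simp: e_def min_def)
    then have "1 - e \<le> ?b"
      using b m1 by argo
    ultimately show ?thesis
      using AC[OF e] that b(1) by blast
  qed
  ultimately show ?thesis
    unfolding VA gC by blast
qed

end
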